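(* Let $P(\partial)\in\mathbb{C}[\partial_t,\partial_1,\dots,\partial_n]$ be a partial differential operator with constant coefficients, let $A\in\mathrm{GL}_n(\mathbb{R})$, $B=2\pi(A^{-1})^{\top}$, and $$\widehat{Y}=\{T\in\mathcal{S}'(\mathbb{R}^{n+1}_{t,x}):\ \forall a\in A\mathbb{Z}^n,\ T(t,x+a)=T(t,x)\}.$$ Assume that for each $\boldsymbol{\xi}\in\mathbb{Z}^n$, $$P(\tau,iB\boldsymbol{\xi})=c_{\boldsymbol{\xi}}\cdot\prod_{j=1}^{m_{\boldsymbol{\xi}}}(\tau-\lambda_{j,\boldsymbol{\xi}}),$$ with $m_{\boldsymbol{\xi}}\in\mathbb{N}_0=\{0,1,2,\dots\}$, $c_{\boldsymbol{\xi}}\in\mathbb{C}\setminus\{0\}$ and $\lambda_{1,\boldsymbol{\xi}},\dots,\lambda_{m_{\boldsymbol{\xi}},\boldsymbol{\xi}}\in\mathbb{C}$. For $\boldsymbol{\xi}\in\mathbb{Z}^n$ let $$d_{\boldsymbol{\xi}}:=\begin{cases}1 & \text{if } \operatorname{Re}(\lambda_{j,\boldsymbol{\xi}})=0 \text{ for all } j=1,\dots,m_{\boldsymbol{\xi}},\\ \displaystyle\min_{j:\,\operatorname{Re}(\lambda_{j,\boldsymbol{\xi}})\neq 0}|\operatorname{Re}(\lambda_{j,\boldsymbol{\xi}})| & \text{otherwise,}\end{cases}$$ and assume furthermore that (1) $(c_{\boldsymbol{\xi}}^{-1})_{\boldsymbol{\xi}\in\mathbb{Z}^n}\in s'(\mathbb{Z}^n)$,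 and (2) $(d_{\boldsymbol{\xi}}^{-1})_{\boldsymbol{\xi}\in\mathbb{Z}^n}\in s'(\mathbb{Z}^n)$. Then $P(\partial):\widehat{Y}\to\widehat{Y}$ is surjective.
   Context: $\mathcal{S}'(\mathbb{R}^{n+1}_{t,x})$ is the space of tempered distributions on $\mathbb{R}^{n+1}$ with variables $t\in\mathbb{R}$ (time) and $x\in\mathbb{R}^n$ (space); $\widehat{Y}$ consists of those that are invariant under translation in $x$ by every vector of the lattice $A\mathbb{Z}^n$. $P(\tau,\zeta)$, $\zeta\in\mathbb{C}^n$, denotes the polynomial obtained from $P(\partial)$ by replacing $\partial_t$ by $\tau$ and $(\partial_1,\dots,\partial_n)$ (the partial derivatives in $x_1,\dots,x_n$) by $\zeta$. The superscript $\top$ denotes transpose. $\|\boldsymbol{\xi}\|_1=|\xi_1|+\cdots+|\xi_n|$, and $s'(\mathbb{Z}^n)$ denotes the space of complex sequences $(a_{\boldsymbol{\xi}})_{\boldsymbol{\xi}\in\mathbb{Z}^n}$ of at most polynomial growth, i.e. such that there is $k\in\mathbb{N}$ with $|a_{\boldsymbol{\xi}}|\le k(1+\|\boldsymbol{\xi}\|_1)^k$ for all $\boldsymbol{\xi}\in\mathbb{Z}^n$. *)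

theory Defs
  imports "HOL-Analysis.Analysis" "HOL-Library.Poly_Mapping"
begin

section \<open>Schwartz functions\<close>

definition dir_deriv :: "'a::euclidean_space \<Rightarrow> ('a \<Rightarrow> complex) \<Rightarrow> 'a \<Rightarrow> complex" where
  "dir_deriv v f = (\<lambda>x. frechet_derivative f (at x) v)"

definition iter_deriv :: "'a::euclidean_space list \<Rightarrow> ('a \<Rightarrow> complex) \<Rightarrow> 'a \<Rightarrow> complex" where
  "iter_deriv vs f = foldr dir_deriv vs f"

text \<open>Total differentiability of all iterated partial derivatives (the empty list gives the
  function itself) is the same as being infinitely differentiable.\<close>

definition smooth :: "('a::euclidean_space \<Rightarrow> complex) \<Rightarrow> bool" where
  "smooth f \<longleftrightarrow> (\<forall>vs\<in>lists Basis. \<forall>x. iter_deriv vs f differentiable (at x))"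

definition schwartz :: "('a::euclidean_space \<Rightarrow> complex) set" where
  "schwartz = {f. smooth f \<and>
     (\<forall>k. \<forall>vs\<in>lists Basis. bdd_above (range (\<lambda>x. (1 + norm x) ^ k * cmod (iter_deriv vs f x))))}"

definition schwartz_seminorm :: "nat \<times> 'a::euclidean_space list \<Rightarrow> ('a \<Rightarrow> complex) \<Rightarrow> real" where
  "schwartz_seminorm = (\<lambda>(k, vs) f. SUP x. (1 + norm x) ^ k * cmod (iter_deriv vs f x))"

text \<open>The locally convex topology defined by these seminorms.\<close>

definition schwartz_open :: "('a::euclidean_space \<Rightarrow> complex) set \<Rightarrow> bool" where
  "schwartz_open U \<longleftrightarrow> U \<subseteq> schwartz \<and>
     (\<forall>f\<in>U. \<exists>F e. finite F \<and> F \<subseteq> UNIV \<times> lists Basis \<and> e > 0 \<and>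
        {g \<in> schwartz. \<forall>p\<in>F. schwartz_seminorm p (\<lambda>x. g x - f x) < e} \<subseteq> U)"

definition schwartz_topology :: "('a::euclidean_space \<Rightarrow> complex) topology" where
  "schwartz_topology = topology schwartz_open"

lemma openin_schwartz_topology: "openin schwartz_topology = schwartz_open"
proof -
  let ?N = "\<lambda>F e f. {g \<in> schwartz. \<forall>p\<in>F. schwartz_seminorm p (\<lambda>x. g x - f x) < e}"
  have "schwartz_open (U \<inter> V)" if U: "schwartz_open U" and V: "schwartz_open V"
    for U V :: "('a \<Rightarrow> complex) set"
    unfolding schwartz_open_def
  proof (intro conjI ballI)
    show "U \<inter> V \<subseteq> schwartz"
      using U unfolding schwartz_open_def by blast
  next
    fix f assume f: "f \<in> U \<inter> V"
    from U f obtain F d where F: "finite F" "F \<subseteq> UNIV \<times> lists Basis" "d > 0" "?N F d f \<subseteq> U"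
      unfolding schwartz_open_def by (elim conjE IntE) (drule (1) bspec, elim exE conjE, rule that)
    from V f obtain G e where G: "finite G" "G \<subseteq> UNIV \<times> lists Basis" "e > 0" "?N G e f \<subseteq> V"
      unfolding schwartz_open_def by (elim conjE IntE) (drule (1) bspec, elim exE conjE, rule that)
    have "?N (F \<union> G) (min d e) f \<subseteq> ?N F d f" "?N (F \<union> G) (min d e) f \<subseteq> ?N G e f"
      by (simp_all add: subset_iff)
    then have "?N (F \<union> G) (min d e) f \<subseteq> U \<inter> V"
      using F(4) G(4) by (meson Int_greatest order_trans)
    moreover have "finite (F \<union> G)" "F \<union> G \<subseteq> UNIV \<times> lists Basis" "min d e > 0"
      using F G by simp_all
    ultimately show "\<exists>F e. finite F \<and> F \<subseteq> UNIV \<times> lists Basis \<and> e > 0 \<and> ?N F e f \<subseteq> U \<inter> V"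
      by (intro exI conjI)
  qed
  moreover have "schwartz_open (\<Union>K)" if K: "\<forall>U\<in>K. schwartz_open U"
    for K :: "('a \<Rightarrow> complex) set set"
    unfolding schwartz_open_def
  proof (intro conjI ballI)
    show "\<Union>K \<subseteq> schwartz"
      using K unfolding schwartz_open_def by (intro Union_least) simp
  next
    fix f assume "f \<in> \<Union>K"
    then obtain U where U: "U \<in> K" "f \<in> U" by (rule UnionE)
    with K have "schwartz_open U" by simp
    with U obtain F d where F: "finite F" "F \<subseteq> UNIV \<times> lists Basis" "d > 0" "?N F d f \<subseteq> U"
      unfolding schwartz_open_def by (elim conjE) (drule (1) bspec, elim exE conjE, rule that)
    moreover have "?N F d f \<subseteq> \<Union>K"
      using F(4) U(1) by (rule subset_trans[OF _ Union_upper])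
    ultimately show "\<exists>F e. finite F \<and> F \<subseteq> UNIV \<times> lists Basis \<and> e > 0 \<and> ?N F e f \<subseteq> \<Union>K"
      by (intro exI conjI)
  qed
  ultimately have "istopology (schwartz_open :: ('a \<Rightarrow> complex) set \<Rightarrow> bool)"
    unfolding istopology_def by simp
  then show ?thesis
    by (simp add: schwartz_topology_def)
qed

section \<open>Tempered distributions\<close>

text \<open>Functionals are total functions in HOL; being \<^term>\<open>extensional schwartz\<close> pins down the
  irrelevant values outside the Schwartz space, so that equality of functionals is equality
  of distributions.\<close>

definition tempered :: "(('a::euclidean_space \<Rightarrow> complex) \<Rightarrow> complex) set" where
  "tempered = {T. T \<in> extensional schwartz \<and>
     (\<forall>f\<in>schwartz. \<forall>g\<in>schwartz. T (\<lambda>x. f x + g x) = T f + T g) \<and>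
     (\<forall>c. \<forall>f\<in>schwartz. T (\<lambda>x. c * f x) = c * T f) \<and>
     continuous_map schwartz_topology euclidean T}"

definition dist_deriv ::
  "'a::euclidean_space \<Rightarrow> (('a \<Rightarrow> complex) \<Rightarrow> complex) \<Rightarrow> ('a \<Rightarrow> complex) \<Rightarrow> complex" where
  "dist_deriv v T = restrict (\<lambda>\<phi>. - T (dir_deriv v \<phi>)) schwartz"

text \<open>The distribution \<open>T(y + h)\<close>, so the test function is translated in the opposite direction.\<close>

definition dist_translate ::
  "'a::euclidean_space \<Rightarrow> (('a \<Rightarrow> complex) \<Rightarrow> complex) \<Rightarrow> ('a \<Rightarrow> complex) \<Rightarrow> complex" where
  "dist_translate h T = restrict (\<lambda>\<phi>. T (\<lambda>y. \<phi> (y - h))) schwartz"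

section \<open>Constant-coefficient operators in time and space\<close>

text \<open>Elements of \<open>\<complex>[\<partial>\<^sub>t, \<partial>\<^sub>1, \<dots>, \<partial>\<^sub>n]\<close>: the variable \<^term>\<open>None\<close> is time, \<open>Some i\<close> is the
  \<open>i\<close>-th space variable, and monomials are finitely supported exponent functions.\<close>

type_synonym 'n pdo = "('n option \<Rightarrow>\<^sub>0 nat) \<Rightarrow>\<^sub>0 complex"

definition symbol_eval :: "'n::finite pdo \<Rightarrow> complex \<Rightarrow> complex ^ 'n \<Rightarrow> complex" where
  "symbol_eval P \<tau> \<zeta> = (\<Sum>\<alpha>\<in>Poly_Mapping.keys P. Poly_Mapping.lookup P \<alpha> *
     (\<tau> ^ Poly_Mapping.lookup \<alpha> None * (\<Prod>i\<in>UNIV. (\<zeta> $ i) ^ Poly_Mapping.lookup \<alpha> (Some i))))"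

fun unit_vec :: "'n::finite option \<Rightarrow> real \<times> (real ^ 'n)" where
  "unit_vec None = (1, 0)"
| "unit_vec (Some i) = (0, axis i 1)"

text \<open>The index type carries no order, so the order in which the derivatives are taken is
  picked by choice; it is immaterial, as partial derivatives of distributions commute.\<close>

definition dist_monom ::
  "('n::finite option \<Rightarrow>\<^sub>0 nat) \<Rightarrow> ((real \<times> (real ^ 'n) \<Rightarrow> complex) \<Rightarrow> complex)
    \<Rightarrow> (real \<times> (real ^ 'n) \<Rightarrow> complex) \<Rightarrow> complex" where
  "dist_monom \<alpha> T = foldr (\<lambda>v. dist_deriv (unit_vec v))
     (SOME vs. \<forall>v. count_list vs v = Poly_Mapping.lookup \<alpha> v) T"

definition pdo_apply ::
  "'n::finite pdo \<Rightarrow> ((real \<times> (real ^ 'n) \<Rightarrow> complex) \<Rightarrow> complex)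
    \<Rightarrow> (real \<times> (real ^ 'n) \<Rightarrow> complex) \<Rightarrow> complex" where
  "pdo_apply P T = restrict
     (\<lambda>\<phi>. \<Sum>\<alpha>\<in>Poly_Mapping.keys P. Poly_Mapping.lookup P \<alpha> * dist_monom \<alpha> T \<phi>) schwartz"

section \<open>Lattice-periodic distributions and sequence spaces\<close>

definition int_vec :: "int ^ 'n \<Rightarrow> real ^ 'n" where
  "int_vec \<xi> = (\<chi> i. real_of_int (\<xi> $ i))"

definition periodic_tempered ::
  "real ^ 'n ^ 'n \<Rightarrow> ((real \<times> (real ^ 'n::finite) \<Rightarrow> complex) \<Rightarrow> complex) set" where
  "periodic_tempered A =
     {T \<in> tempered. \<forall>a \<in> range (\<lambda>k. A *v int_vec k). dist_translate (0, a) T = T}"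

definition norm1 :: "int ^ 'n::finite \<Rightarrow> real" where
  "norm1 \<xi> = (\<Sum>i\<in>UNIV. \<bar>real_of_int (\<xi> $ i)\<bar>)"

definition poly_growth :: "(int ^ 'n::finite \<Rightarrow> complex) set" where
  "poly_growth = {a. \<exists>k::nat. \<forall>\<xi>. cmod (a \<xi>) \<le> real k * (1 + norm1 \<xi>) ^ k}"

end

theory Submission
  imports Defs
begin

text \<open>The operator preserves periodicity because derivatives commute with translations. For
  surjectivity, write \<open>f\<^sub>\<xi>(t) = \<integral> f(t, A y) e\<^bsup>2\<pi>i \<xi>\<bullet>y\<^esup> dy\<close> for the partial Fourier coefficients of a Schwartz function
  \<open>f\<close>. The transposed operator acts on them as
  \<open>P(-\<partial>\<^sub>t, iB\<xi>) = c\<^sub>\<xi> \<Prod>\<^sub>j (-\<partial>\<^sub>t - \<lambda>\<^bsub>j,\<xi>\<^esub>)\<close>, and each factor satisfies an a priori estimate in weighted sup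
  norms on the time axis: by integrating from infinity when \<open>Re \<lambda> = 0\<close>, and by a maximum principle, with a
  constant polynomial in \<open>1/|Re \<lambda>|\<close>, otherwise. Hence \<open>q(f) \<le> C q'(P\<^sup>t f)\<close> for norms of the form
  \<open>q(f) = sup (1 + |\<xi>|)\<^sup>M (1 + |t|)\<^sup>k |\<partial>\<^sub>t\<^sup>l f\<^sub>\<xi>(t)|\<close>. A smooth partition of unity along the lattice and a
  Poisson summation inequality show that a periodic tempered distribution is bounded by such a norm:
  \<open>|T f| \<le> C q(f) \<le> C q'(P\<^sup>t f)\<close>. So \<open>P\<^sup>t f \<mapsto> T f\<close> is well defined and bounded by \<open>q'\<close>, and any
  Hahn--Banach extension \<open>S\<close> solves \<open>P(\<partial>) S = T\<close>. As \<open>q'\<close> vanishes on \<open>f(\<cdot> + a) - f\<close> for lattice vectors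
  \<open>a\<close>, the extension is automatically periodic.\<close>

section \<open>Calculus of iterated derivatives\<close>

text \<open>All frequencies are solved at once by duality, so only bounds on rapidly decreasing
  functions of time are required, and for these no homogeneous solution
  \<open>exp (-\<lambda>t)\<close> interferes. The two kinds of roots differ as follows. If
  \<open>Re \<lambda> = 0\<close>, the integrating factor has modulus 1, and each half of the time
  axis can be integrated from its own end. If \<open>Re \<lambda>\<close> is nonzero, the
  integrating factor is favourable towards one end only, and decay on the other half has to be
  bought with powers of \<open>1/|Re \<lambda>|\<close>; hypothesis (2) makes this affordable,
  hypothesis (1) does the same for the division by the leading coefficient. The number of factors is
  at most the time degree of \<open>P\<close>, so finitely many constants serve all frequencies.

  The obstacle on the space side is that the periodization of a test function does not decay in
  space, so \<open>T\<close> cannot be applied to it. Periodicity of \<open>T\<close> lets the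
  lattice sum be moved from the partition of unity onto \<open>f\<close>, which leaves one decaying
  bump times a periodization. The Poisson inequality then bounds this product by Fourier
  coefficients, uniformly in the truncation of the lattice sum once it is large.\<close>

lemma dir_deriv_eq: "(f has_derivative f') (at x) \<Longrightarrow> dir_deriv v f x = f' v"
  by (metis dir_deriv_def frechet_derivative_at)

lemma iter_deriv_Nil [simp]: "iter_deriv [] f = f"
  by (simp add: iter_deriv_def)

lemma iter_deriv_Cons: "iter_deriv (v # vs) f = dir_deriv v (iter_deriv vs f)"
  by (simp add: iter_deriv_def)

lemma iter_deriv_append: "iter_deriv (us @ vs) f = iter_deriv us (iter_deriv vs f)"
  by (simp add: iter_deriv_def)

lemma smooth_differentiable:
  "smooth f \<Longrightarrow> vs \<in> lists Basis \<Longrightarrow> iter_deriv vs f differentiable (at x)"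
  by (simp add: smooth_def)

lemma smooth_has_derivative:
  "smooth f \<Longrightarrow> vs \<in> lists Basis \<Longrightarrow>
    (iter_deriv vs f has_derivative (\<lambda>v. dir_deriv v (iter_deriv vs f) x)) (at x)"
  using smooth_differentiable frechet_derivative_works unfolding dir_deriv_def by blast

lemma smooth_iter_deriv:
  assumes "smooth f" "us \<in> lists Basis"
  shows "smooth (iter_deriv us f)"
  unfolding smooth_def
  by (metis assms append_in_lists_conv iter_deriv_append smooth_differentiable)

lemma smooth_continuous_iter_deriv:
  "smooth f \<Longrightarrow> vs \<in> lists Basis \<Longrightarrow> continuous_on S (iter_deriv vs f)"
  by (meson continuous_at_imp_continuous_on differentiable_imp_continuous_within smooth_differentiable)

text \<open>Derivatives of sums, products, translates and composites are all found this way: guess a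
  formula \<open>D\<close> for every list of directions at once and check that one further
  derivative of \<open>D vs\<close> is \<open>D (v # vs)\<close>. The check supplies
  differentiability together with the value, so a Frechet derivative is evaluated only where it
  exists.\<close>

lemma iter_deriv_family:
  assumes "D [] = f"
    and "\<And>v vs x. v \<in> Basis \<Longrightarrow> vs \<in> lists Basis \<Longrightarrow>
       \<exists>f'. (D vs has_derivative f') (at x) \<and> f' v = D (v # vs) x"
    and "vs \<in> lists Basis"
  shows "iter_deriv vs f = D vs"
  using assms(3)
proof (induction vs)
  case Nil
  then show ?case by (simp add: assms(1))
next
  case (Cons v vs)
  then have "iter_deriv (v # vs) f x = D (v # vs) x" for x
    using assms(2)[of v vs x] by (auto simp: iter_deriv_Cons dir_deriv_eq)
  then show ?case by blast
qed

lemma smooth_family: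
  fixes D :: "'a::euclidean_space list \<Rightarrow> 'a \<Rightarrow> complex"
  assumes "D [] = f"
    and "\<And>v vs x. v \<in> Basis \<Longrightarrow> vs \<in> lists Basis \<Longrightarrow>
       \<exists>f'. (D vs has_derivative f') (at x) \<and> f' v = D (v # vs) x"
  shows "smooth f"
  unfolding smooth_def
proof (intro ballI allI)
  fix vs :: "'a list" and x
  assume vs: "vs \<in> lists Basis"
  \<comment> \<open>The family condition yields differentiability only together with a direction, so
    some basis vector must be at hand.\<close>
  obtain v :: 'a where "v \<in> Basis" using nonempty_Basis by blast
  with assms(2) vs have "D vs differentiable (at x)"
    by (meson differentiableI)
  then show "iter_deriv vs f differentiable (at x)"
    using iter_deriv_family[of D, OF assms vs] by simp
qed

lemma
  assumes "smooth f" "smooth g"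
  shows iter_deriv_add: "vs \<in> lists Basis \<Longrightarrow>
          iter_deriv vs (\<lambda>x. f x + g x) = (\<lambda>x. iter_deriv vs f x + iter_deriv vs g x)"
    and smooth_add: "smooth (\<lambda>x. f x + g x)"
proof -
  let ?D = "\<lambda>vs x. iter_deriv vs f x + iter_deriv vs g x"
  have *: "\<exists>f'. (?D vs has_derivative f') (at x) \<and> f' v = ?D (v # vs) x"
    if "v \<in> Basis" "vs \<in> lists Basis" for v vs x
    by (rule exI, rule conjI, rule has_derivative_add)
       (rule smooth_has_derivative assms that | simp add: iter_deriv_Cons)+
  show "smooth (\<lambda>x. f x + g x)"
    by (rule smooth_family[of ?D]) (use * in auto)
  show "vs \<in> lists Basis \<Longrightarrow> iter_deriv vs (\<lambda>x. f x + g x) = ?D vs"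
    by (rule iter_deriv_family[of ?D]) (use * in auto)
qed

lemma
  assumes "smooth f"
  shows iter_deriv_cmult: "vs \<in> lists Basis \<Longrightarrow>
          iter_deriv vs (\<lambda>x. c * f x) = (\<lambda>x. c * iter_deriv vs f x)"
    and smooth_cmult: "smooth (\<lambda>x. c * f x)"
proof -
  let ?D = "\<lambda>vs x. c * iter_deriv vs f x"
  have *: "\<exists>f'. (?D vs has_derivative f') (at x) \<and> f' v = ?D (v # vs) x"
    if "v \<in> Basis" "vs \<in> lists Basis" for v vs x
    by (rule exI, rule conjI, rule has_derivative_mult_right)
       (rule smooth_has_derivative assms that | simp add: iter_deriv_Cons)+
  show "smooth (\<lambda>x. c * f x)"
    by (rule smooth_family[of ?D]) (use * in auto)
  show "vs \<in> lists Basis \<Longrightarrow> iter_deriv vs (\<lambda>x. c * f x) = ?D vs"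
    by (rule iter_deriv_family[of ?D]) (use * in auto)
qed

lemma
  assumes "smooth f"
  shows iter_deriv_translate: "vs \<in> lists Basis \<Longrightarrow>
          iter_deriv vs (\<lambda>x. f (x + h)) = (\<lambda>x. iter_deriv vs f (x + h))"
    and smooth_translate: "smooth (\<lambda>x. f (x + h))"
proof -
  let ?D = "\<lambda>vs x. iter_deriv vs f (x + h)"
  have *: "\<exists>f'. (?D vs has_derivative f') (at x) \<and> f' v = ?D (v # vs) x"
    if "v \<in> Basis" "vs \<in> lists Basis" for v vs x
  proof (intro exI conjI)
    have "((\<lambda>x. x + h) has_derivative (\<lambda>y. y)) (at x)"
      by (auto intro!: derivative_eq_intros)
    from has_derivative_compose[OF this smooth_has_derivative[OF assms that(2), of "x + h"]]
    show "(?D vs has_derivative (\<lambda>v. dir_deriv v (iter_deriv vs f) (x + h))) (at x)" .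
    show "dir_deriv v (iter_deriv vs f) (x + h) = ?D (v # vs) x"
      by (simp add: iter_deriv_Cons)
  qed
  show "smooth (\<lambda>x. f (x + h))"
    by (rule smooth_family[of ?D]) (use * in auto)
  show "vs \<in> lists Basis \<Longrightarrow> iter_deriv vs (\<lambda>x. f (x + h)) = ?D vs"
    by (rule iter_deriv_family[of ?D]) (use * in auto)
qed

lemma
  shows iter_deriv_const: "vs \<in> lists Basis \<Longrightarrow>
          iter_deriv vs (\<lambda>x::'a::euclidean_space. c) = (\<lambda>x. if vs = [] then c else 0)"
    and smooth_const: "smooth (\<lambda>x::'a. c)"
proof -
  let ?D = "\<lambda>vs x. if vs = [] then c else 0"
  have *: "\<exists>f'. (?D vs has_derivative f') (at x) \<and> f' v = ?D (v # vs) x"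
    if "v \<in> Basis" "vs \<in> lists Basis" for v :: 'a and vs x
    by (rule exI[of _ "\<lambda>_. 0"]) auto
  show "smooth (\<lambda>x::'a. c)"
    by (rule smooth_family[of ?D]) (use * in auto)
  show "vs \<in> lists Basis \<Longrightarrow> iter_deriv vs (\<lambda>x::'a. c) = ?D vs"
    by (rule iter_deriv_family[of ?D]) (use * in auto)
qed

section \<open>Finite sums, the Leibniz rule and weighted derivative bounds\<close>

lemma iter_deriv_sum:
  assumes "finite I" "\<And>i. i \<in> I \<Longrightarrow> smooth (f i)" "vs \<in> lists Basis"
  shows "iter_deriv vs (\<lambda>x. \<Sum>i\<in>I. f i x) = (\<lambda>x. \<Sum>i\<in>I. iter_deriv vs (f i) x)"
proof -
  \<comment> \<open>Smoothness is carried along because the rule for two summands asks for it on the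
    remaining sum.\<close>
  have "smooth (\<lambda>x. \<Sum>i\<in>I. f i x) \<and>
      iter_deriv vs (\<lambda>x. \<Sum>i\<in>I. f i x) = (\<lambda>x. \<Sum>i\<in>I. iter_deriv vs (f i) x)"
    using assms
  proof (induction I)
    case empty
    then show ?case by (auto simp: smooth_const iter_deriv_const)
  next
    case (insert i I)
    then show ?case by (auto simp: smooth_add iter_deriv_add)
  qed
  then show ?thesis ..
qed

text \<open>The index list of the Leibniz rule: every direction goes to one of the two factors.
  Repetitions are kept and take the place of binomial coefficients.\<close>

fun splits :: "'a list \<Rightarrow> ('a list \<times> 'a list) list" where
  "splits [] = [([], [])]"
| "splits (v # vs) = map (\<lambda>(u, w). (v # u, w)) (splits vs) @ map (\<lambda>(u, w). (u, v # w)) (splits vs)"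

lemma splits_lists:
  assumes "vs \<in> lists S" "p \<in> set (splits vs)"
  shows "fst p \<in> lists S" "snd p \<in> lists S"
proof -
  have "\<forall>p\<in>set (splits vs). fst p \<in> lists S \<and> snd p \<in> lists S"
    using assms(1) by (induction vs) (simp_all add: ball_Un case_prod_beta del: in_lists_conv_set)
  with assms(2) show "fst p \<in> lists S" "snd p \<in> lists S" by blast+
qed

lemma has_derivative_sum_list:
  fixes f :: "'i \<Rightarrow> 'a::real_normed_vector \<Rightarrow> 'b::real_normed_vector"
  assumes "\<And>p. p \<in> set ps \<Longrightarrow> (f p has_derivative f' p) F"
  shows "((\<lambda>x. \<Sum>p\<leftarrow>ps. f p x) has_derivative (\<lambda>v. \<Sum>p\<leftarrow>ps. f' p v)) F"
  using assms by (induction ps) (auto intro!: has_derivative_add)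

lemma
  assumes f: "smooth f" and g: "smooth g"
  shows iter_deriv_mult: "vs \<in> lists Basis \<Longrightarrow> iter_deriv vs (\<lambda>x. f x * g x) =
          (\<lambda>x. \<Sum>p\<leftarrow>splits vs. iter_deriv (fst p) f x * iter_deriv (snd p) g x)"
    and smooth_mult: "smooth (\<lambda>x. f x * g x)"
proof -
  let ?D = "\<lambda>vs x. \<Sum>p\<leftarrow>splits vs. iter_deriv (fst p) f x * iter_deriv (snd p) g x"
  have *: "\<exists>f'. (?D vs has_derivative f') (at x) \<and> f' v = ?D (v # vs) x"
    if "v \<in> Basis" "vs \<in> lists Basis" for v vs x
  proof (intro exI conjI)
    show "(?D vs has_derivative (\<lambda>v. \<Sum>p\<leftarrow>splits vs.
        iter_deriv (fst p) f x * dir_deriv v (iter_deriv (snd p) g) x +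
        dir_deriv v (iter_deriv (fst p) f) x * iter_deriv (snd p) g x)) (at x)"
      by (intro has_derivative_sum_list has_derivative_mult smooth_has_derivative f g
          splits_lists[OF that(2)])
    show "(\<Sum>p\<leftarrow>splits vs.
        iter_deriv (fst p) f x * dir_deriv v (iter_deriv (snd p) g) x +
        dir_deriv v (iter_deriv (fst p) f) x * iter_deriv (snd p) g x) = ?D (v # vs) x"
      by (simp add: iter_deriv_Cons sum_list_addf case_prod_beta comp_def add.commute)
  qed
  show "smooth (\<lambda>x. f x * g x)"
    by (rule smooth_family[of ?D]) (use * in auto)
  show "vs \<in> lists Basis \<Longrightarrow> iter_deriv vs (\<lambda>x. f x * g x) = ?D vs"
    by (rule iter_deriv_family[of ?D]) (use * in auto)
qed

text \<open>Symbol-type estimates for a whole family: the constant may depend on the derivative, but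
  neither on the index nor on the point. The index is the truncation \<open>N\<close> for the
  cut-offs, where uniformity matters, and a dummy for single functions. With all inverse powers of
  \<open>1 + norm x\<close> as weights this describes Schwartz functions.\<close>

definition bounded_derivs ::
  "('k \<Rightarrow> 'a::euclidean_space \<Rightarrow> real) \<Rightarrow> ('k \<Rightarrow> 'a \<Rightarrow> complex) \<Rightarrow> bool" where
  "bounded_derivs W F \<longleftrightarrow> (\<forall>k. smooth (F k)) \<and>
     (\<forall>vs\<in>lists Basis. \<exists>C\<ge>0. \<forall>k x. cmod (iter_deriv vs (F k) x) \<le> C * W k x)"

lemma bounded_derivs_smooth: "bounded_derivs W F \<Longrightarrow> smooth (F k)"
  by (simp add: bounded_derivs_def)

lemma bounded_derivsE:
  assumes "bounded_derivs W F" "vs \<in> lists Basis"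
  obtains C where "C \<ge> 0" "\<And>k x. cmod (iter_deriv vs (F k) x) \<le> C * W k x"
  using assms unfolding bounded_derivs_def by blast

lemma bounded_derivs_mono:
  assumes "bounded_derivs W F" "c \<ge> 0" "\<And>k x. W k x \<le> c * W' k x"
  shows "bounded_derivs W' F"
  unfolding bounded_derivs_def
proof (intro conjI ballI allI)
  fix k show "smooth (F k)" using assms(1) by (rule bounded_derivs_smooth)
next
  fix vs :: "'b list" assume "vs \<in> lists Basis"
  with assms(1) obtain C where C: "C \<ge> 0" "\<And>k x. cmod (iter_deriv vs (F k) x) \<le> C * W k x"
    by (rule bounded_derivsE) blast
  have "cmod (iter_deriv vs (F k) x) \<le> (C * c) * W' k x" for k x
    using order_trans[OF C(2) mult_left_mono[OF assms(3) C(1)]] by (simp add: mult.assoc)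
  with C(1) assms(2) show "\<exists>C\<ge>0. \<forall>k x. cmod (iter_deriv vs (F k) x) \<le> C * W' k x"
    by (intro exI[of _ "C * c"]) auto
qed

lemma bounded_derivs_add:
  assumes F: "bounded_derivs W F" and G: "bounded_derivs W G"
  shows "bounded_derivs W (\<lambda>k x. F k x + G k x)"
  unfolding bounded_derivs_def
proof (intro conjI ballI allI)
  fix k show "smooth (\<lambda>x. F k x + G k x)"
    by (intro smooth_add bounded_derivs_smooth[OF F] bounded_derivs_smooth[OF G])
next
  fix vs :: "'b list" assume vs: "vs \<in> lists Basis"
  from F vs obtain C where C: "C \<ge> 0" "\<And>k x. cmod (iter_deriv vs (F k) x) \<le> C * W k x"
    by (rule bounded_derivsE) blast
  from G vs obtain C' where C': "C' \<ge> 0" "\<And>k x. cmod (iter_deriv vs (G k) x) \<le> C' * W k x"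
    by (rule bounded_derivsE) blast
  have "cmod (iter_deriv vs (\<lambda>x. F k x + G k x) x) \<le> (C + C') * W k x" for k x
    using C(2)[of k x] C'(2)[of k x]
    by (simp add: iter_deriv_add[OF bounded_derivs_smooth[OF F] bounded_derivs_smooth[OF G] vs]
        distrib_right norm_triangle_le)
  with C(1) C'(1)
  show "\<exists>C\<ge>0. \<forall>k x. cmod (iter_deriv vs (\<lambda>x. F k x + G k x) x) \<le> C * W k x"
    by (intro exI[of _ "C + C'"]) auto
qed

lemma bounded_derivs_mult:
  assumes F: "bounded_derivs W F" and G: "bounded_derivs W' G"
  shows "bounded_derivs (\<lambda>k x. W k x * W' k x) (\<lambda>k x. F k x * G k x)"
  unfolding bounded_derivs_def
proof (intro conjI ballI allI)
  fix k show "smooth (\<lambda>x. F k x * G k x)"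
    by (intro smooth_mult bounded_derivs_smooth[OF F] bounded_derivs_smooth[OF G])
next
  fix vs :: "'b list" assume vs: "vs \<in> lists Basis"
  \<comment> \<open>The tail of \<open>splits vs\<close> is not itself of the form
    \<open>splits ws\<close>, so the induction runs over arbitrary lists of admissible
    splittings.\<close>
  have "\<exists>C\<ge>0. \<forall>k x. cmod (\<Sum>p\<leftarrow>ps. iter_deriv (fst p) (F k) x * iter_deriv (snd p) (G k) x)
      \<le> C * (W k x * W' k x)"
    if "set ps \<subseteq> set (splits vs)" for ps
    using that
  proof (induction ps)
    case Nil
    then show ?case by auto
  next
    case (Cons p ps)
    then obtain C where C: "C \<ge> 0" "\<And>k x. cmod (\<Sum>p\<leftarrow>ps. iter_deriv (fst p) (F k) x *
        iter_deriv (snd p) (G k) x) \<le> C * (W k x * W' k x)" by auto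
    have p: "fst p \<in> lists Basis" "snd p \<in> lists Basis"
      using splits_lists[OF vs, of p] Cons.prems by auto
    obtain C1 where C1: "C1 \<ge> 0" "\<And>k x. cmod (iter_deriv (fst p) (F k) x) \<le> C1 * W k x"
      using bounded_derivsE[OF F p(1)] by blast
    obtain C2 where C2: "C2 \<ge> 0" "\<And>k x. cmod (iter_deriv (snd p) (G k) x) \<le> C2 * W' k x"
      using bounded_derivsE[OF G p(2)] by blast
    have "cmod (iter_deriv (fst p) (F k) x * iter_deriv (snd p) (G k) x)
        \<le> (C1 * C2) * (W k x * W' k x)" for k x
      using mult_mono'[OF C1(2)[of k x] C2(2)[of k x]] by (simp add: norm_mult mult_ac)
    then have "cmod (\<Sum>p\<leftarrow>p # ps. iter_deriv (fst p) (F k) x * iter_deriv (snd p) (G k) x)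
        \<le> (C1 * C2 + C) * (W k x * W' k x)" for k x
      using C(2)[of k x] by (simp add: distrib_right norm_triangle_mono)
    with C(1) C1(1) C2(1) show ?case
      by (intro exI[of _ "C1 * C2 + C"]) auto
  qed
  from this[of "splits vs"]
  show "\<exists>C\<ge>0. \<forall>k x. cmod (iter_deriv vs (\<lambda>x. F k x * G k x) x) \<le> C * (W k x * W' k x)"
    by (simp add: iter_deriv_mult[OF bounded_derivs_smooth[OF F] bounded_derivs_smooth[OF G] vs])
qed

lemma bounded_derivs_const:
  assumes "\<And>k. cmod (c k) \<le> C"
  shows "bounded_derivs (\<lambda>_ _. 1) (\<lambda>k x. c k)"
proof -
  have "cmod (if vs = [] then c k else 0) \<le> \<bar>C\<bar> * 1" for k and vs :: "'b list"
    using order_trans[OF assms[of k] abs_ge_self] by simp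
  then show ?thesis
    unfolding bounded_derivs_def
    by (intro conjI allI ballI smooth_const exI[of _ "\<bar>C\<bar>"]) (simp_all only: iter_deriv_const abs_ge_zero)
qed

lemma bounded_derivs_prod:
  assumes "finite I" "\<And>i. i \<in> I \<Longrightarrow> bounded_derivs (W i) (F i)"
  shows "bounded_derivs (\<lambda>k x. \<Prod>i\<in>I. W i k x) (\<lambda>k x. \<Prod>i\<in>I. F i k x)"
  using assms
proof (induction I)
  case empty
  then show ?case using bounded_derivs_const[of "\<lambda>_. 1" 1] by simp
next
  case (insert i I)
  then show ?case by (simp add: bounded_derivs_mult)
qed

section \<open>Schwartz functions and tempered distributions\<close>

lemma schwartz_smooth: "f \<in> schwartz \<Longrightarrow> smooth f"
  by (simp add: schwartz_def)

lemma schwartz_seminorm_upper: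
  assumes "f \<in> schwartz" "vs \<in> lists Basis"
  shows "(1 + norm x) ^ k * cmod (iter_deriv vs f x) \<le> schwartz_seminorm (k, vs) f"
  using assms unfolding schwartz_seminorm_def schwartz_def
  by (auto intro!: cSUP_upper)

lemma schwartz_seminorm_least:
  assumes "\<And>x. (1 + norm x) ^ k * cmod (iter_deriv vs f x) \<le> B"
  shows "schwartz_seminorm (k, vs) f \<le> B"
  using assms unfolding schwartz_seminorm_def by (auto intro!: cSUP_least)

lemma schwartz_seminorm_nonneg:
  assumes "f \<in> schwartz" "vs \<in> lists Basis"
  shows "0 \<le> schwartz_seminorm (k, vs) f"
  by (rule order_trans[OF _ schwartz_seminorm_upper[OF assms, of 0]]) simp

lemma seminorm_indexE:
  assumes "F \<subseteq> UNIV \<times> lists Basis" "p \<in> F"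
  obtains k vs where "p = (k, vs)" "vs \<in> lists Basis"
proof (cases p)
  case (Pair k vs)
  have "vs \<in> lists Basis"
    using subsetD[OF assms] unfolding Pair by (rule SigmaD2)
  with Pair show ?thesis by (rule that)
qed

lemma schwartz_seminorm_nonneg':
  "f \<in> schwartz \<Longrightarrow> F \<subseteq> UNIV \<times> lists Basis \<Longrightarrow> p \<in> F \<Longrightarrow> 0 \<le> schwartz_seminorm p f"
  by (erule (1) seminorm_indexE) (simp only: schwartz_seminorm_nonneg)

lemma schwartzI:
  assumes "smooth f"
    and "\<And>k vs. vs \<in> lists Basis \<Longrightarrow> \<exists>B. \<forall>x. (1 + norm x) ^ k * cmod (iter_deriv vs f x) \<le> B"
  shows "f \<in> schwartz"
  unfolding schwartz_def bdd_above_def using assms by auto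

lemma schwartz_decay:
  assumes "f \<in> schwartz" "vs \<in> lists Basis"
  shows "cmod (iter_deriv vs f x) \<le> schwartz_seminorm (k, vs) f * inverse ((1 + norm x) ^ k)"
  using schwartz_seminorm_upper[OF assms, of x k]
  by (simp add: divide_inverse [symmetric] pos_le_divide_eq mult.commute add_pos_nonneg)

lemma schwartz_bounded_derivs:
  assumes "f \<in> schwartz"
  shows "bounded_derivs (\<lambda>_ x. inverse ((1 + norm x) ^ k)) (\<lambda>_. f)"
  unfolding bounded_derivs_def
  using schwartz_decay[OF assms] schwartz_seminorm_nonneg[OF assms] schwartz_smooth[OF assms] by blast

lemma bounded_derivs_schwartz:
  assumes "\<And>k. bounded_derivs (\<lambda>(_::'k) x. inverse ((1 + norm x) ^ k)) (\<lambda>_. f)"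
  shows "f \<in> schwartz"
proof (rule schwartzI)
  show "smooth f" using assms[of 0] by (rule bounded_derivs_smooth)
next
  fix k and vs :: "'a list" assume "vs \<in> lists Basis"
  with assms[of k] obtain C where
    C: "\<And>x. cmod (iter_deriv vs f x) \<le> C * inverse ((1 + norm x) ^ k)"
    by (rule bounded_derivsE) blast
  have "(1 + norm x) ^ k * cmod (iter_deriv vs f x) \<le> C" for x
    using C[of x]
    by (simp add: divide_inverse [symmetric] pos_le_divide_eq mult.commute add_pos_nonneg)
  then show "\<exists>B. \<forall>x. (1 + norm x) ^ k * cmod (iter_deriv vs f x) \<le> B" by blast
qed

lemma schwartz_add:
  assumes "f \<in> schwartz" "g \<in> schwartz"
  shows "(\<lambda>x. f x + g x) \<in> schwartz"
  using bounded_derivs_add[OF assms[THEN schwartz_bounded_derivs]]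
  by (auto intro!: bounded_derivs_schwartz)

lemma schwartz_mult_left:
  assumes "bounded_derivs (\<lambda>_ _. 1) (\<lambda>_::unit. g)" "f \<in> schwartz"
  shows "(\<lambda>x. g x * f x) \<in> schwartz"
  using bounded_derivs_mult[OF assms(1) schwartz_bounded_derivs[OF assms(2)]]
  by (auto intro!: bounded_derivs_schwartz)

lemma schwartz_cmult: "f \<in> schwartz \<Longrightarrow> (\<lambda>x. c * f x) \<in> schwartz"
  by (rule schwartz_mult_left) (auto intro: bounded_derivs_const)

lemma schwartz_0: "(\<lambda>x. 0) \<in> schwartz"
  by (rule schwartzI[OF smooth_const exI[of _ 0]]) (simp add: iter_deriv_const del: in_lists_conv_set)

lemma schwartz_diff:
  assumes "f \<in> schwartz" "g \<in> schwartz"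
  shows "(\<lambda>x. f x - g x) \<in> schwartz"
  using schwartz_add[OF assms(1) schwartz_cmult[OF assms(2), of "-1"]] by simp

lemma schwartz_sum:
  assumes "\<And>i. i \<in> I \<Longrightarrow> f i \<in> schwartz"
  shows "(\<lambda>x. \<Sum>i\<in>I. f i x) \<in> schwartz"
  using assms by (induction I rule: infinite_finite_induct) (auto intro: schwartz_0 schwartz_add)

lemma schwartz_iter_deriv:
  assumes "f \<in> schwartz" "us \<in> lists Basis"
  shows "iter_deriv us f \<in> schwartz"
proof (rule schwartzI)
  show "smooth (iter_deriv us f)" using assms by (simp add: schwartz_smooth smooth_iter_deriv)
next
  fix k and vs :: "'a list" assume "vs \<in> lists Basis"
  with assms schwartz_seminorm_upper[of f "vs @ us"]
  show "\<exists>B. \<forall>x. (1 + norm x) ^ k * cmod (iter_deriv vs (iter_deriv us f) x) \<le> B"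
    by (auto simp: iter_deriv_append)
qed

lemma schwartz_dir_deriv: "f \<in> schwartz \<Longrightarrow> v \<in> Basis \<Longrightarrow> dir_deriv v f \<in> schwartz"
  using schwartz_iter_deriv[of f "[v]"] by (simp add: iter_deriv_Cons)

lemma schwartz_seminorm_iter_deriv:
  "schwartz_seminorm (k, vs) (iter_deriv us f) = schwartz_seminorm (k, vs @ us) f"
  by (simp add: schwartz_seminorm_def iter_deriv_append)

text \<open>The elementary form of Peetre's inequality: a translation costs a polynomial factor in
  the translation vector alone.\<close>

lemma one_plus_norm_le_mult: "1 + norm (x + y) \<le> (1 + norm x) * (1 + norm y)"
  for x y :: "'a::real_normed_vector"
proof -
  have "0 \<le> norm x * norm y" by simp
  then show ?thesis
    using norm_triangle_ineq[of x y] unfolding distrib_left distrib_right mult_1 mult_1_right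
    by linarith
qed

lemma schwartz_translate_bound:
  assumes "f \<in> schwartz" "vs \<in> lists Basis"
  shows "(1 + norm x) ^ k * cmod (iter_deriv vs (\<lambda>x. f (x + h)) x)
           \<le> (1 + norm h) ^ k * schwartz_seminorm (k, vs) f"
proof -
  have "1 + norm x \<le> (1 + norm h) * (1 + norm (x + h))"
    using one_plus_norm_le_mult[of "x + h" "- h"] by (simp add: mult.commute)
  then have "(1 + norm x) ^ k \<le> (1 + norm h) ^ k * (1 + norm (x + h)) ^ k"
    by (metis power_mono power_mult_distrib norm_ge_zero add_nonneg_nonneg zero_le_one)
  then have "(1 + norm x) ^ k * cmod (iter_deriv vs f (x + h))
      \<le> ((1 + norm h) ^ k * (1 + norm (x + h)) ^ k) * cmod (iter_deriv vs f (x + h))"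
    by (rule mult_right_mono) simp
  also have "\<dots> \<le> (1 + norm h) ^ k * schwartz_seminorm (k, vs) f"
    unfolding mult.assoc by (intro mult_left_mono schwartz_seminorm_upper assms) simp
  finally show ?thesis
    by (simp add: iter_deriv_translate[OF schwartz_smooth[OF assms(1)] assms(2)])
qed

lemma schwartz_translate:
  assumes "f \<in> schwartz"
  shows "(\<lambda>x. f (x + h)) \<in> schwartz"
  using schwartz_translate_bound[OF assms] smooth_translate[OF schwartz_smooth[OF assms]]
  by (intro schwartzI) blast+

lemma schwartz_translate_diff: "f \<in> schwartz \<Longrightarrow> (\<lambda>x. f (x - h)) \<in> schwartz"
  using schwartz_translate[of f "- h"] by simp

section \<open>Continuity as domination by finitely many seminorms\<close>

lemma schwartz_seminorm_cmult:
  assumes "f \<in> schwartz" "vs \<in> lists Basis"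
  shows "schwartz_seminorm (k, vs) (\<lambda>x. c * f x) \<le> cmod c * schwartz_seminorm (k, vs) f"
proof (rule schwartz_seminorm_least)
  fix x
  show "(1 + norm x) ^ k * cmod (iter_deriv vs (\<lambda>x. c * f x) x)
      \<le> cmod c * schwartz_seminorm (k, vs) f"
    using mult_left_mono[OF schwartz_seminorm_upper[OF assms, of x k], of "cmod c"]
    by (simp add: iter_deriv_cmult[OF schwartz_smooth[OF assms(1)] assms(2)] norm_mult mult_ac)
qed

text \<open>Here \<open>p\<close> is any real functional, so that one notion serves
  \<open>cmod (T f)\<close>, the coefficient norms and their compositions with derivatives. A sum
  over \<open>F\<close>, rather than a maximum, makes the closure properties direct.\<close>

definition seminorm_bounded :: "(('a::euclidean_space \<Rightarrow> complex) \<Rightarrow> real) \<Rightarrow> bool" where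
  "seminorm_bounded p \<longleftrightarrow> (\<exists>C F. C \<ge> 0 \<and> finite F \<and> F \<subseteq> UNIV \<times> lists Basis \<and>
     (\<forall>f\<in>schwartz. p f \<le> C * (\<Sum>r\<in>F. schwartz_seminorm r f)))"

lemma seminorm_boundedE:
  assumes "seminorm_bounded p"
  obtains C F where "C \<ge> 0" "finite F" "F \<subseteq> UNIV \<times> lists Basis"
    "\<And>f. f \<in> schwartz \<Longrightarrow> p f \<le> C * (\<Sum>r\<in>F. schwartz_seminorm r f)"
  using assms unfolding seminorm_bounded_def
  by (elim exE conjE) (rule that, assumption+, erule (1) bspec)

lemma seminorm_boundedI:
  assumes "vs \<in> lists Basis" "\<And>f. f \<in> schwartz \<Longrightarrow> p f \<le> C * schwartz_seminorm (k, vs) f"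
  shows "seminorm_bounded p"
  unfolding seminorm_bounded_def
proof (intro exI conjI ballI)
  fix f :: "'a \<Rightarrow> complex" assume f: "f \<in> schwartz"
  have "C * schwartz_seminorm (k, vs) f \<le> \<bar>C\<bar> * schwartz_seminorm (k, vs) f"
    by (rule mult_right_mono) (simp_all only: schwartz_seminorm_nonneg[OF f assms(1)] abs_ge_self)
  then show "p f \<le> \<bar>C\<bar> * (\<Sum>r\<in>{(k, vs)}. schwartz_seminorm r f)"
    using assms(2)[OF f] by simp
qed (use assms(1) in auto)

lemma seminorm_bounded_mono:
  assumes "seminorm_bounded q" "\<And>f. f \<in> schwartz \<Longrightarrow> p f \<le> c * q f" "c \<ge> 0"
  shows "seminorm_bounded p"
proof -
  obtain C F where *: "C \<ge> 0" "finite F" "F \<subseteq> UNIV \<times> lists Basis"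
    "\<And>f. f \<in> schwartz \<Longrightarrow> q f \<le> C * (\<Sum>r\<in>F. schwartz_seminorm r f)"
    using assms(1) by (rule seminorm_boundedE) (rule that)
  have "p f \<le> (c * C) * (\<Sum>r\<in>F. schwartz_seminorm r f)" if "f \<in> schwartz" for f
    using order_trans[OF assms(2)[OF that] mult_left_mono[OF *(4)[OF that] assms(3)]]
    by (simp add: mult.assoc)
  then show ?thesis
    unfolding seminorm_bounded_def
    by (intro exI[of _ "c * C"] exI[of _ F] conjI ballI *(2,3) mult_nonneg_nonneg *(1) assms(3))
qed

lemma seminorm_bounded_add:
  assumes "seminorm_bounded p" "seminorm_bounded q"
  shows "seminorm_bounded (\<lambda>f. p f + q f)"
proof -
  obtain C F where F: "C \<ge> 0" "finite F" "F \<subseteq> UNIV \<times> lists Basis"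
    "\<And>f. f \<in> schwartz \<Longrightarrow> p f \<le> C * (\<Sum>r\<in>F. schwartz_seminorm r f)"
    using assms(1) by (rule seminorm_boundedE) (rule that)
  obtain D G where G: "D \<ge> 0" "finite G" "G \<subseteq> UNIV \<times> lists Basis"
    "\<And>f. f \<in> schwartz \<Longrightarrow> q f \<le> D * (\<Sum>r\<in>G. schwartz_seminorm r f)"
    using assms(2) by (rule seminorm_boundedE) (rule that)
  have "p f + q f \<le> (C + D) * (\<Sum>r\<in>F \<union> G. schwartz_seminorm r f)" if f: "f \<in> schwartz" for f
  proof -
    have nn: "0 \<le> schwartz_seminorm r f" if "r \<in> F \<union> G" for r
      using that by (intro schwartz_seminorm_nonneg'[OF f Un_least[OF F(3) G(3)]])
    have "(\<Sum>r\<in>F. schwartz_seminorm r f) \<le> (\<Sum>r\<in>F \<union> G. schwartz_seminorm r f)"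
      "(\<Sum>r\<in>G. schwartz_seminorm r f) \<le> (\<Sum>r\<in>F \<union> G. schwartz_seminorm r f)"
      using nn F(2) G(2) by (auto intro!: sum_mono2)
    then show ?thesis
      using order_trans[OF F(4)[OF f] mult_left_mono[OF _ F(1)]]
        order_trans[OF G(4)[OF f] mult_left_mono[OF _ G(1)]]
      by (simp add: distrib_right add_mono)
  qed
  then show ?thesis
    unfolding seminorm_bounded_def
    by (intro exI[of _ "C + D"] exI[of _ "F \<union> G"] conjI ballI add_nonneg_nonneg F(1) G(1)
        finite_UnI F(2) G(2) Un_least F(3) G(3))
qed

lemma seminorm_bounded_0: "seminorm_bounded (\<lambda>f. 0)"
  by (rule seminorm_boundedI[of "[]" _ 0 0]) auto

lemma seminorm_bounded_sum:
  assumes "\<And>i. i \<in> I \<Longrightarrow> seminorm_bounded (p i)"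
  shows "seminorm_bounded (\<lambda>f. \<Sum>i\<in>I. p i f)"
  using assms
  by (induction I rule: infinite_finite_induct) (auto intro: seminorm_bounded_0 seminorm_bounded_add)

lemma seminorm_bounded_iter_deriv:
  assumes "seminorm_bounded p" "us \<in> lists Basis"
  shows "seminorm_bounded (\<lambda>f. p (iter_deriv us f))"
proof -
  obtain C F where F: "C \<ge> 0" "finite F" "F \<subseteq> UNIV \<times> lists Basis"
    "\<And>f. f \<in> schwartz \<Longrightarrow> p f \<le> C * (\<Sum>r\<in>F. schwartz_seminorm r f)"
    using assms(1) by (rule seminorm_boundedE) (rule that)
  have "seminorm_bounded (\<lambda>f. \<Sum>r\<in>F. schwartz_seminorm r (iter_deriv us f))"
  proof (rule seminorm_bounded_sum)
    fix r assume "r \<in> F"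
    then obtain k vs where "r = (k, vs)" "vs \<in> lists Basis" by (rule seminorm_indexE[OF F(3)])
    then show "seminorm_bounded (\<lambda>f. schwartz_seminorm r (iter_deriv us f))"
      using assms(2) by (intro seminorm_boundedI[of "vs @ us" _ 1 k])
        (auto simp: schwartz_seminorm_iter_deriv)
  qed
  then show ?thesis
    by (rule seminorm_bounded_mono[OF _ _ F(1)]) (intro F(4) schwartz_iter_deriv assms(2))
qed

text \<open>The preimage of the unit disc contains a basic neighbourhood of 0, and homogeneity
  spreads the bound from there to all Schwartz functions.\<close>

lemma continuous_imp_seminorm_bounded:
  assumes cont: "continuous_map schwartz_topology euclidean (T :: ('a::euclidean_space \<Rightarrow> complex) \<Rightarrow> complex)"
    and hom: "\<And>c f. f \<in> schwartz \<Longrightarrow> T (\<lambda>x. c * f x) = c * T f"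
  shows "seminorm_bounded (\<lambda>f. cmod (T f))"
proof -
  have top: "topspace schwartz_topology = (schwartz :: ('a \<Rightarrow> complex) set)"
  proof
    show "topspace schwartz_topology \<subseteq> (schwartz :: ('a \<Rightarrow> complex) set)"
      using openin_topspace[of schwartz_topology] unfolding openin_schwartz_topology schwartz_open_def
      by blast
    have "schwartz_open (schwartz :: ('a \<Rightarrow> complex) set)"
      unfolding schwartz_open_def by (auto intro!: exI[of _ "{}"] exI[of _ 1])
    then show "(schwartz :: ('a \<Rightarrow> complex) set) \<subseteq> topspace schwartz_topology"
      by (metis openin_schwartz_topology openin_subset)
  qed
  have "openin schwartz_topology {f \<in> topspace schwartz_topology. T f \<in> ball 0 1}"
    using cont by (rule openin_continuous_map_preimage) simp
  then have op: "schwartz_open {f \<in> schwartz. T f \<in> ball 0 1}"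
    by (simp add: openin_schwartz_topology top)
  have T0: "T (\<lambda>x. 0) = 0" using hom[OF schwartz_0, of 0] by simp
  then have "(\<lambda>x. 0) \<in> {f \<in> schwartz. T f \<in> ball 0 1}" using schwartz_0 by auto
  then obtain F e where F: "finite F" "F \<subseteq> UNIV \<times> lists Basis" "e > 0"
    "{g \<in> schwartz. \<forall>p\<in>F. schwartz_seminorm p (\<lambda>x. g x - 0) < e} \<subseteq> {f \<in> schwartz. T f \<in> ball 0 1}"
    using op unfolding schwartz_open_def by (elim conjE) (drule (1) bspec, elim exE conjE, rule that)
  have "cmod (T f) \<le> (1/e) * (\<Sum>r\<in>F. schwartz_seminorm r f)" if f: "f \<in> schwartz" for f
  proof -
    have nn: "0 \<le> schwartz_seminorm p f" if "p \<in> F" for p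
      using that by (rule schwartz_seminorm_nonneg'[OF f F(2)])
    let ?s = "\<Sum>r\<in>F. schwartz_seminorm r f"
    have s0: "?s \<ge> 0" by (rule sum_nonneg) (rule nn)
    \<comment> \<open>Rescaling \<open>f\<close> by \<open>e / ?s\<close> would fail if all
      seminorms in \<open>F\<close> vanished on it. Any \<open>r\<close> above \<open>?s\<close> is
      positive, and it is let down to \<open>?s\<close> at the end.\<close>
    have "cmod (T f) \<le> r / e" if r: "r > ?s" for r
    proof -
      have r0: "r > 0" using r s0 by linarith
      let ?c = "complex_of_real (e / r)"
      have "schwartz_seminorm p (\<lambda>x. ?c * f x) < e" if p: "p \<in> F" for p
      proof -
        obtain k vs where kv: "p = (k, vs)" "vs \<in> lists Basis"
          using p by (rule seminorm_indexE[OF F(2)])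
        have "schwartz_seminorm p (\<lambda>x. ?c * f x) \<le> cmod ?c * schwartz_seminorm p f"
          unfolding kv(1) by (rule schwartz_seminorm_cmult[OF f kv(2)])
        also have "\<dots> = (e / r) * schwartz_seminorm p f"
          using r0 F(3) by (subst norm_of_real) simp
        also have "\<dots> < (e / r) * r"
          using r0 F(3) member_le_sum[of p F "\<lambda>r. schwartz_seminorm r f", OF p nn F(1)] r
          by (intro mult_strict_left_mono) auto
        finally show ?thesis using r0 by simp
      qed
      then have "(\<lambda>x. ?c * f x) \<in> {f \<in> schwartz. T f \<in> ball 0 1}"
        using schwartz_cmult[OF f, of ?c] by (intro subsetD[OF F(4)]) simp
      then have "T (\<lambda>x. ?c * f x) \<in> ball 0 1" by blast
      then have "cmod (?c * T f) < 1" by (simp only: hom[OF f] mem_ball_0)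
      then have "(e / r) * cmod (T f) < 1" using r0 F(3) by (simp add: norm_mult norm_divide)
      then show ?thesis using r0 F(3) by (simp add: field_simps)
    qed
    then have "cmod (T f) * e \<le> r" if "r > ?s" for r
      using that F(3) by (simp add: pos_le_divide_eq)
    then have "cmod (T f) * e \<le> ?s" by (rule dense_ge)
    then show ?thesis using F(3) by (simp add: field_simps)
  qed
  then show ?thesis unfolding seminorm_bounded_def
    using F(3) by (intro exI[of _ "1/e"] exI[of _ F] conjI ballI F(1,2)) simp_all
qed

lemma seminorm_bounded_imp_continuous:
  assumes bdd: "seminorm_bounded (\<lambda>f. cmod (T f))"
    and hom: "\<And>c f. f \<in> schwartz \<Longrightarrow> T (\<lambda>x. c * f x) = c * T f"
    and add: "\<And>f g. f \<in> schwartz \<Longrightarrow> g \<in> schwartz \<Longrightarrow> T (\<lambda>x. f x + g x) = T f + T g"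
  shows "continuous_map schwartz_topology euclidean (T :: ('a::euclidean_space \<Rightarrow> complex) \<Rightarrow> complex)"
proof -
  obtain C F where F: "C \<ge> 0" "finite F" "F \<subseteq> UNIV \<times> lists Basis"
    "\<And>f. f \<in> schwartz \<Longrightarrow> cmod (T f) \<le> C * (\<Sum>r\<in>F. schwartz_seminorm r f)"
    using bdd by (rule seminorm_boundedE) (rule that)
  have op: "schwartz_open {f \<in> schwartz. T f \<in> U}" if U: "open U" for U
    unfolding schwartz_open_def
  proof (intro conjI ballI)
    fix f assume f: "f \<in> {f \<in> schwartz. T f \<in> U}"
    then obtain d where d: "d > 0" "ball (T f) d \<subseteq> U"
      using U by (auto simp: open_contains_ball)
    \<comment> \<open>This makes the variation bound \<open>C * card F * e\<close> strictly less
      than \<open>d\<close>; the summand 1 covers \<open>C = 0\<close> and empty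
      \<open>F\<close>.\<close>
    define e where "e = d / (C * card F + 1)"
    have pos: "C * card F + 1 > 0" using F(1) by (simp add: add_nonneg_pos)
    have "T g \<in> U" if g: "g \<in> schwartz" "\<forall>p\<in>F. schwartz_seminorm p (\<lambda>x. g x - f x) < e" for g
    proof -
      have fs: "f \<in> schwartz" using f by simp
      have "T g = T (\<lambda>x. f x + (g x - f x))" by simp
      also have "\<dots> = T f + T (\<lambda>x. g x - f x)"
        using fs g(1) by (intro add schwartz_diff)
      finally have "dist (T f) (T g) = cmod (T (\<lambda>x. g x - f x))"
        by (simp add: dist_norm norm_minus_commute)
      also have "\<dots> \<le> C * (\<Sum>r\<in>F. schwartz_seminorm r (\<lambda>x. g x - f x))"
        by (intro F(4) schwartz_diff g fs)
      also have "\<dots> \<le> C * (\<Sum>r\<in>F. e)"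
        using g(2) F(1) by (intro mult_left_mono sum_mono) auto
      also have "\<dots> = (C * card F) * e" by simp
      also have "\<dots> < d" using d(1) pos unfolding e_def by (simp add: field_simps)
      finally show ?thesis using d(2) by auto
    qed
    then have "{g \<in> schwartz. \<forall>p\<in>F. schwartz_seminorm p (\<lambda>x. g x - f x) < e} \<subseteq> {f \<in> schwartz. T f \<in> U}"
      by blast
    moreover have "e > 0" using d(1) pos by (simp add: e_def)
    ultimately show "\<exists>F e. finite F \<and> F \<subseteq> UNIV \<times> lists Basis \<and> 0 < e \<and>
        {g \<in> schwartz. \<forall>p\<in>F. schwartz_seminorm p (\<lambda>x. g x - f x) < e} \<subseteq> {f \<in> schwartz. T f \<in> U}"
      using F(2,3) by blast
  qed auto
  have "topspace schwartz_topology \<subseteq> (schwartz :: ('a \<Rightarrow> complex) set)"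
    using openin_topspace[of schwartz_topology] unfolding openin_schwartz_topology schwartz_open_def
    by blast
  moreover from op[of UNIV] have "(schwartz :: ('a \<Rightarrow> complex) set) \<subseteq> topspace schwartz_topology"
    by (simp add: openin_subset openin_schwartz_topology[symmetric])
  ultimately show ?thesis
    using op by (simp add: continuous_map openin_schwartz_topology)
qed

text \<open>From here on continuity is used and proved only in the form of a bound by
  seminorms.\<close>

lemma tempered_iff:
  "T \<in> tempered \<longleftrightarrow> T \<in> extensional schwartz \<and>
     (\<forall>f\<in>schwartz. \<forall>g\<in>schwartz. T (\<lambda>x. f x + g x) = T f + T g) \<and>
     (\<forall>c. \<forall>f\<in>schwartz. T (\<lambda>x. c * f x) = c * T f) \<and>
     seminorm_bounded (\<lambda>f. cmod (T f))"
  unfolding tempered_def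
  by (auto intro: continuous_imp_seminorm_bounded seminorm_bounded_imp_continuous)

lemma
  assumes "T \<in> tempered"
  shows tempered_add: "f \<in> schwartz \<Longrightarrow> g \<in> schwartz \<Longrightarrow> T (\<lambda>x. f x + g x) = T f + T g"
    and tempered_cmult: "f \<in> schwartz \<Longrightarrow> T (\<lambda>x. c * f x) = c * T f"
    and tempered_bounded: "seminorm_bounded (\<lambda>f. cmod (T f))"
  using assms by (auto simp: tempered_iff)

lemma tempered_diff:
  assumes "T \<in> tempered" "f \<in> schwartz" "g \<in> schwartz"
  shows "T (\<lambda>x. f x - g x) = T f - T g"
  using tempered_add[OF assms(1,2) schwartz_cmult[OF assms(3), of "-1"]]
    tempered_cmult[OF assms(1,3), of "-1"] by simp

lemma tempered_sum:
  assumes "T \<in> tempered" "finite I" "\<And>i. i \<in> I \<Longrightarrow> f i \<in> schwartz"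
  shows "T (\<lambda>x. \<Sum>i\<in>I. f i x) = (\<Sum>i\<in>I. T (f i))"
  using assms(2,3)
proof (induction I)
  case empty
  then show ?case using tempered_cmult[OF assms(1) schwartz_0, of 0] by simp
next
  case (insert i I)
  then show ?case using tempered_add[OF assms(1), of "f i" "\<lambda>x. \<Sum>i\<in>I. f i x"]
    by (simp add: schwartz_sum)
qed

section \<open>A smooth partition of unity\<close>

text \<open>The logistic function \<open>h\<close> solves \<open>h' = h (1 - h)\<close>, so all
  derivatives of its shifts are polynomials in a single number between 0 and 1. A partition of unity
  built from it has exponential tails instead of compact support, which is enough against Schwartz
  functions.\<close>

definition logistic :: "real \<Rightarrow> real" where
  "logistic y = 1 / (1 + exp (- y))"

abbreviation logistic_slope :: "real \<Rightarrow> real" where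
  "logistic_slope y \<equiv> logistic y * (1 - logistic y)"

lemma logistic_pos: "0 < logistic y" and logistic_less_1: "logistic y < 1"
  by (simp_all add: logistic_def add_pos_pos)

lemma logistic_le_exp: "logistic y \<le> exp y"
  by (simp add: logistic_def exp_minus field_simps add_pos_pos)

lemma one_minus_logistic: "1 - logistic y = logistic (- y)"
proof -
  have "1 + exp y \<noteq> 0" "1 + exp (- y) \<noteq> 0"
    using exp_gt_zero[of y] exp_gt_zero[of "- y"] by linarith+
  then show ?thesis by (simp add: logistic_def exp_minus field_simps)
qed

lemma logistic_mono: "x \<le> y \<Longrightarrow> logistic x \<le> logistic y"
  by (simp add: logistic_def frac_le add_pos_pos)

lemma DERIV_logistic: "(logistic has_real_derivative logistic_slope y) (at y)"
proof -
  have nz: "1 + exp (- y) \<noteq> 0" using exp_gt_zero[of "- y"] by linarith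
  have "((\<lambda>y. 1 / (1 + exp (- y))) has_real_derivative
      exp (- y) / (1 + exp (- y))\<^sup>2) (at y)"
    using nz by (auto intro!: derivative_eq_intros simp: power2_eq_square)
  moreover have "exp (- y) / (1 + exp (- y))\<^sup>2 = logistic_slope y"
    using nz by (simp add: logistic_def power2_eq_square field_simps)
  ultimately show ?thesis unfolding logistic_def[abs_def] by simp
qed

lemma logistic_slope_nonneg: "0 \<le> logistic_slope y"
  using logistic_pos[of y] logistic_less_1[of y] by simp

lemma logistic_slope_le_1: "logistic_slope y \<le> 1"
  using logistic_pos[of y] logistic_less_1[of y] by (simp add: mult_le_one)

lemma logistic_slope_le_exp: "logistic_slope y \<le> exp (- \<bar>y\<bar>)"
proof (cases "y \<ge> 0")
  case True
  have "logistic_slope y \<le> 1 * logistic (- y)"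
    unfolding one_minus_logistic using logistic_pos[of "-y"] logistic_less_1[of y]
    by (intro mult_right_mono) auto
  then show ?thesis using logistic_le_exp[of "- y"] True by simp
next
  case False
  have "logistic_slope y \<le> logistic y * 1"
    using logistic_pos[of y] by (intro mult_left_mono) auto
  then show ?thesis using logistic_le_exp[of y] False by simp
qed

lemma power_exp_bounded: "\<exists>C. \<forall>y::real. (1 + \<bar>y\<bar>) ^ k * exp (- \<bar>y\<bar>) \<le> C"
proof (intro exI allI)
  fix y :: real
  have "(1 + \<bar>y\<bar>) ^ k / fact k \<le> exp (1 + \<bar>y\<bar>)"
  proof -
    have "(\<lambda>n. (1 + \<bar>y\<bar>) ^ n / fact n) sums exp (1 + \<bar>y\<bar>)"
      using exp_converges[of "1 + \<bar>y\<bar>"] by (simp add: divide_inverse mult.commute)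
    then show ?thesis
      using sum_le_suminf[of "\<lambda>n. (1 + \<bar>y\<bar>) ^ n / fact n" "{k}"]
      by (auto simp: sums_iff)
  qed
  then show "(1 + \<bar>y\<bar>) ^ k * exp (- \<bar>y\<bar>) \<le> fact k * exp 1"
    by (simp add: exp_add exp_minus field_simps)
qed

text \<open>\<open>[:0, 1, -1:]\<close> is \<open>X - X^2\<close>, the right-hand side of the
  differential equation, and \<open>l v\<close> is the inner derivative of the affine argument. The
  polynomial is independent of the shift, which is what makes later bounds uniform in
  \<open>N\<close>.\<close>

fun logistic_poly :: "('a \<Rightarrow> real) \<Rightarrow> 'a list \<Rightarrow> complex poly" where
  "logistic_poly l [] = [:0, 1:]"
| "logistic_poly l (v # vs) =
     smult (complex_of_real (l v)) ([:0, 1, -1:] * pderiv (logistic_poly l vs))"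

lemma
  assumes l: "bounded_linear l"
  shows iter_deriv_logistic: "vs \<in> lists Basis \<Longrightarrow>
      iter_deriv vs (\<lambda>x. complex_of_real (logistic (l x + s))) =
        (\<lambda>x. poly (logistic_poly l vs) (complex_of_real (logistic (l x + s))))"
    and smooth_logistic: "smooth (\<lambda>x. complex_of_real (logistic (l x + s)))"
proof -
  let ?D = "\<lambda>vs x. poly (logistic_poly l vs) (complex_of_real (logistic (l x + s)))"
  have *: "\<exists>f'. (?D vs has_derivative f') (at x) \<and> f' v = ?D (v # vs) x"
    if "v \<in> Basis" "vs \<in> lists Basis" for v vs x
  proof (intro exI conjI)
    have "((\<lambda>x. l x + s) has_derivative l) (at x)"
      by (auto intro!: derivative_eq_intros bounded_linear_imp_has_derivative l)
    from has_derivative_compose[OF this DERIV_logistic[THEN has_field_derivative_imp_has_derivative]]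
    have "((\<lambda>x. complex_of_real (logistic (l x + s))) has_derivative
        (\<lambda>v. complex_of_real (logistic_slope (l x + s) * l v))) (at x)"
      by (rule has_derivative_of_real)
    from has_derivative_compose[OF this poly_DERIV[THEN has_field_derivative_imp_has_derivative]]
    show "(?D vs has_derivative (\<lambda>v. poly (pderiv (logistic_poly l vs))
        (complex_of_real (logistic (l x + s))) * complex_of_real (logistic_slope (l x + s) * l v))) (at x)" .
    show "poly (pderiv (logistic_poly l vs)) (complex_of_real (logistic (l x + s))) *
        complex_of_real (logistic_slope (l x + s) * l v) = ?D (v # vs) x"
      by (simp add: algebra_simps)
  qed
  show "smooth (\<lambda>x. complex_of_real (logistic (l x + s)))"
    by (rule smooth_family[of ?D]) (use * in auto)
  show "vs \<in> lists Basis \<Longrightarrow> iter_deriv vs (\<lambda>x. complex_of_real (logistic (l x + s))) = ?D vs"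
    by (rule iter_deriv_family[of ?D]) (use * in auto)
qed

text \<open>A derivative of positive order contains the factor \<open>X - X^2\<close>, which becomes
  the slope; the remaining polynomial is bounded on the compact interval \<open>[0, 1]\<close> of
  possible values.\<close>

lemma logistic_poly_bound:
  assumes "vs \<noteq> []"
  shows "\<exists>C\<ge>0. \<forall>y. cmod (poly (logistic_poly l vs) (complex_of_real (logistic y))) \<le> C * logistic_slope y"
proof -
  obtain v ws where vs: "vs = v # ws" using assms by (cases vs) auto
  let ?q = "smult (complex_of_real (l v)) (pderiv (logistic_poly l ws))"
  have "compact ((\<lambda>y. poly ?q (complex_of_real y)) ` {0..1})"
    by (intro compact_continuous_image continuous_intros) auto
  from compact_imp_bounded[OF this]
  obtain C where "\<forall>z\<in>(\<lambda>y. poly ?q (complex_of_real y)) ` {0..1}. cmod z \<le> C"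
    unfolding bounded_iff ..
  then have C: "cmod (poly ?q (complex_of_real y)) \<le> C" if "y \<in> {0..1}" for y
    using that by (rule bspec[OF _ imageI])
  have C0: "0 \<le> C" by (rule order_trans[OF norm_ge_zero C[of 0]]) simp
  have "cmod (poly (logistic_poly l vs) (complex_of_real (logistic y))) \<le> C * logistic_slope y" for y
  proof -
    have "poly (logistic_poly l vs) (complex_of_real (logistic y)) =
        poly ?q (complex_of_real (logistic y)) * complex_of_real (logistic_slope y)"
      by (simp add: vs algebra_simps)
    also have "cmod \<dots> = cmod (poly ?q (complex_of_real (logistic y))) * logistic_slope y"
      using logistic_slope_nonneg[of y] by (simp only: norm_mult norm_of_real abs_of_nonneg)
    also have "\<dots> \<le> C * logistic_slope y"
      using logistic_pos[of y] logistic_less_1[of y]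
      by (intro mult_right_mono C logistic_slope_nonneg) auto
    finally show ?thesis .
  qed
  with C0 show ?thesis by blast
qed

text \<open>Shared by plateau, complement of the plateau and bump. Derivatives of positive order are
  controlled by the two slopes separately. At order zero the bound may rest on cancellation between
  the two terms and \<open>c\<close>, so it has to be supplied.\<close>

lemma bounded_derivs_logistic_diff:
  assumes l: "bounded_linear l"
    and W0: "\<And>k x. \<bar>c + logistic (l x + a k) - logistic (l x + b k)\<bar> \<le> C0 * W k x"
    and Wa: "\<And>k x. logistic_slope (l x + a k) \<le> C1 * W k x"
    and Wb: "\<And>k x. logistic_slope (l x + b k) \<le> C1 * W k x"
    and C: "C0 \<ge> 0" "C1 \<ge> 0"
  shows "bounded_derivs W
    (\<lambda>k x. complex_of_real (c + logistic (l x + a k) - logistic (l x + b k)))"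
proof -
  let ?H = "\<lambda>s x. complex_of_real (logistic (l x + s))"
  let ?G = "\<lambda>k x. complex_of_real c + (?H (a k) x + (-1) * ?H (b k) x)"
  have sm: "smooth (?G k)" for k
    by (intro smooth_add smooth_const smooth_cmult smooth_logistic l)
  have it: "iter_deriv vs (?G k) x = (if vs = [] then complex_of_real c else 0) +
      (iter_deriv vs (?H (a k)) x + (-1) * iter_deriv vs (?H (b k)) x)"
    if "vs \<in> lists Basis" for vs k x
    using that
    by (simp only: iter_deriv_add iter_deriv_cmult iter_deriv_const smooth_add smooth_const
        smooth_cmult smooth_logistic[OF l])
  have "bounded_derivs W ?G"
    unfolding bounded_derivs_def
  proof (intro conjI allI ballI sm)
    fix vs :: "'a list" assume vs: "vs \<in> lists Basis"
    show "\<exists>C\<ge>0. \<forall>k x. cmod (iter_deriv vs (?G k) x) \<le> C * W k x"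
    proof (cases "vs = []")
      case True
      have "?G k x = complex_of_real (c + logistic (l x + a k) - logistic (l x + b k))" for k x
        by simp
      then have "cmod (?G k x) \<le> C0 * W k x" for k x
        using W0[of x k] by (simp only: norm_of_real)
      with True C(1) show ?thesis by auto
    next
      case False
      obtain D where D: "D \<ge> 0"
        "\<And>y. cmod (poly (logistic_poly l vs) (complex_of_real (logistic y))) \<le> D * logistic_slope y"
        using logistic_poly_bound[OF False] by blast
      have "cmod (iter_deriv vs (?G k) x) \<le> (D * C1 + D * C1) * W k x" for k x
      proof -
        have "cmod (iter_deriv vs (?H s) x) \<le> D * logistic_slope (l x + s)" for s
          unfolding iter_deriv_logistic[OF l vs] by (rule D)
        then have "cmod (iter_deriv vs (?H (a k)) x) \<le> D * (C1 * W k x)"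
          "cmod (iter_deriv vs (?H (b k)) x) \<le> D * (C1 * W k x)"
          by (meson order_trans mult_left_mono Wa Wb D(1))+
        moreover have "cmod (iter_deriv vs (?G k) x) \<le>
            cmod (iter_deriv vs (?H (a k)) x) + cmod (iter_deriv vs (?H (b k)) x)"
          unfolding it[OF vs] using False
          by (simp add: norm_triangle_ineq4)
        ultimately show ?thesis unfolding distrib_right mult.assoc by linarith
      qed
      with D(1) C(2) show ?thesis by (intro exI[of _ "D * C1 + D * C1"]) auto
    qed
  qed
  then show ?thesis by (simp add: algebra_simps)
qed

text \<open>The factors of \<open>bump\<close> are differences of the logistic function at unit distance, so sums of
  integer translates of \<open>bump\<close> telescope to \<open>plateau\<close>.\<close>

definition plateau :: "('i::finite \<Rightarrow> 'a \<Rightarrow> real) \<Rightarrow> nat \<Rightarrow> 'a \<Rightarrow> real" where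
  "plateau l N x = (\<Prod>i\<in>UNIV. logistic (l i x + (real N + 1)) - logistic (l i x + - real N))"

definition bump :: "('i::finite \<Rightarrow> 'a \<Rightarrow> real) \<Rightarrow> 'a \<Rightarrow> real" where
  "bump l x = (\<Prod>i\<in>UNIV. logistic (l i x + 1) - logistic (l i x + 0))"

text \<open>In the application \<open>c = N + 1\<close>, \<open>s\<close> is a coordinate of the
  point and \<open>y\<close> its signed distance from an edge of the plateau. Up to the summand 1,
  these two distances add up to at least \<open>c\<close>, so either the slope is small or the point
  is far out.\<close>

lemma far_logistic_slope:
  fixes s y :: real
  assumes "c > 0" "c \<le> \<bar>y\<bar> + \<bar>s\<bar> + 1"
  shows "logistic_slope y \<le> 2 * ((1 + \<bar>s\<bar>) / c)"
proof -
  have "\<bar>y\<bar> \<le> exp \<bar>y\<bar>" using exp_ge_add_one_self[of "\<bar>y\<bar>"] by linarith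
  then have y: "\<bar>y\<bar> * exp (- \<bar>y\<bar>) \<le> 1" by (simp add: exp_minus field_simps)
  have "c * logistic_slope y \<le> (\<bar>y\<bar> + (\<bar>s\<bar> + 1)) * logistic_slope y"
    using assms by (intro mult_right_mono logistic_slope_nonneg) auto
  also have "\<dots> \<le> \<bar>y\<bar> * exp (- \<bar>y\<bar>) + (\<bar>s\<bar> + 1) * 1"
    unfolding distrib_right[of "\<bar>y\<bar>"]
    by (intro add_mono mult_left_mono logistic_slope_le_exp logistic_slope_le_1) auto
  also have "\<dots> \<le> 2 * (1 + \<bar>s\<bar>)" using y by simp
  finally show ?thesis using assms(1) by (simp add: field_simps)
qed

lemma far_logistic:
  fixes s y :: real
  assumes "c > 0" "c \<le> y + \<bar>s\<bar> + 1"
  shows "logistic (- y) \<le> 2 * ((1 + \<bar>s\<bar>) / c)"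
proof (cases "y \<ge> 0")
  case True
  have "\<bar>y\<bar> \<le> exp \<bar>y\<bar>" using exp_ge_add_one_self[of "\<bar>y\<bar>"] by linarith
  then have y: "y * exp (- y) \<le> 1" using True by (simp add: exp_minus field_simps)
  have "c * logistic (- y) \<le> (y + (\<bar>s\<bar> + 1)) * logistic (- y)"
    using assms logistic_pos[of "-y"] by (intro mult_right_mono) auto
  also have "\<dots> \<le> y * exp (- y) + (\<bar>s\<bar> + 1) * 1"
    unfolding distrib_right[of y]
    using True logistic_less_1[of "-y"] by (intro add_mono mult_left_mono logistic_le_exp) auto
  also have "\<dots> \<le> 2 * (1 + \<bar>s\<bar>)" using y by simp
  finally show ?thesis using assms(1) by (simp add: field_simps)
next
  case False
  then have "c \<le> 1 + \<bar>s\<bar>" using assms(2) by linarith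
  then have "1 \<le> (1 + \<bar>s\<bar>) / c" using assms(1) by simp
  with logistic_less_1[of "- y"] show ?thesis by linarith
qed

section \<open>Derivative bounds for plateau and bump\<close>

lemma bounded_derivs_plateau:
  fixes l :: "'i::finite \<Rightarrow> 'a::euclidean_space \<Rightarrow> real"
  assumes l: "\<And>i. bounded_linear (l i)"
  shows "bounded_derivs (\<lambda>_ _. 1) (\<lambda>N x. complex_of_real (plateau l N x))"
proof -
  have "bounded_derivs (\<lambda>_ _. 1) (\<lambda>N x. complex_of_real
      (0 + logistic (l i x + (real N + 1)) - logistic (l i x + - real N)))" for i
  proof (rule bounded_derivs_logistic_diff[where ?C0.0 = 1 and ?C1.0 = 1])
    fix N x
    show "\<bar>0 + logistic (l i x + (real N + 1)) - logistic (l i x + - real N)\<bar> \<le> 1 * 1"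
      using logistic_pos[of "l i x + (real N + 1)"] logistic_less_1[of "l i x + (real N + 1)"]
        logistic_pos[of "l i x + - real N"] logistic_less_1[of "l i x + - real N"]
      by linarith
  qed (use l logistic_slope_le_1 in auto)
  then have "bounded_derivs (\<lambda>_ _. \<Prod>i\<in>(UNIV :: 'i set). 1) (\<lambda>N x. \<Prod>i\<in>UNIV. complex_of_real
      (0 + logistic (l i x + (real N + 1)) - logistic (l i x + - real N)))"
    by (rule bounded_derivs_prod[where W = "\<lambda>i k x. 1" and F = "\<lambda>i N x. complex_of_real
      (0 + logistic (l i x + (real N + 1)) - logistic (l i x + - real N))", OF finite])
  then show ?thesis by (simp add: plateau_def)
qed

text \<open>The complement of the plateau is not uniformly small, but it gains
  \<open>1 / (N + 1)\<close> at the price of one factor \<open>1 + norm x\<close>, which a Schwartz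
  function absorbs. Hence plateau times \<open>f\<close> converges to \<open>f\<close> in every
  seminorm.\<close>

lemma bounded_derivs_one_minus_plateau:
  fixes l :: "'i::finite \<Rightarrow> 'a::euclidean_space \<Rightarrow> real"
  assumes l: "\<And>i. bounded_linear (l i)"
  shows "bounded_derivs (\<lambda>N x. (1 + norm x) / (real N + 1))
           (\<lambda>N x. complex_of_real (1 - plateau l N x))"
proof -
  let ?u = "\<lambda>i N x. logistic (l i x + (real N + 1)) - logistic (l i x + - real N)"
  have one: "bounded_derivs (\<lambda>N x. (1 + norm x) / (real N + 1)) (\<lambda>N x. complex_of_real (1 - ?u i N x))"
    for i
  proof -
    have b: "bounded_derivs (\<lambda>N x. (1 + \<bar>l i x\<bar>) / (real N + 1)) (\<lambda>N x. complex_of_real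
        (1 + logistic (l i x + - real N) - logistic (l i x + (real N + 1))))"
    proof (rule bounded_derivs_logistic_diff[where ?C0.0 = 4 and ?C1.0 = 2])
      fix N x
      let ?W = "(1 + \<bar>l i x\<bar>) / (real N + 1)"
      have "1 + logistic (l i x + - real N) - logistic (l i x + (real N + 1)) =
          logistic (- (real N - l i x)) + logistic (- (l i x + (real N + 1)))"
        using one_minus_logistic[of "l i x + (real N + 1)"] by simp
      moreover have "logistic (- (real N - l i x)) \<le> 2 * ?W"
        "logistic (- (l i x + (real N + 1))) \<le> 2 * ?W"
        by (rule far_logistic; linarith)+
      ultimately show "\<bar>1 + logistic (l i x + - real N) - logistic (l i x + (real N + 1))\<bar> \<le> 4 * ?W"
        using logistic_pos[of "- (real N - l i x)"] logistic_pos[of "- (l i x + (real N + 1))"]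
        by linarith
      show "logistic_slope (l i x + - real N) \<le> 2 * ?W"
        "logistic_slope (l i x + (real N + 1)) \<le> 2 * ?W"
        by (rule far_logistic_slope; linarith)+
    qed (use l in auto)
    obtain K where K: "\<And>x. \<bar>l i x\<bar> \<le> norm x * K" "K > 0"
      using bounded_linear.pos_bounded[OF l[of i]] by auto
    have le: "(1 + \<bar>l i x\<bar>) / (real N + 1) \<le> (1 + K) * ((1 + norm x) / (real N + 1))" for N x
    proof -
      have "1 + \<bar>l i x\<bar> \<le> (1 + K) * (1 + norm x)"
        using K(1)[of x] K(2) norm_ge_zero[of x] unfolding distrib_left distrib_right mult_1 mult_1_right
          mult.commute[of "norm x"] by linarith
      from divide_right_mono[OF this, of "real N + 1"] show ?thesis by simp
    qed
    have K0: "0 \<le> 1 + K" using K(2) by simp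
    have "bounded_derivs (\<lambda>N x. (1 + norm x) / (real N + 1)) (\<lambda>N x. complex_of_real
        (1 + logistic (l i x + - real N) - logistic (l i x + (real N + 1))))"
      by (rule bounded_derivs_mono[OF b K0 le])
    moreover have "1 + logistic (l i x + - real N) - logistic (l i x + (real N + 1)) = 1 - ?u i N x"
      for N x by simp
    ultimately show ?thesis by (simp only:)
  qed
  have u1: "bounded_derivs (\<lambda>_ _. 1) (\<lambda>N x. complex_of_real (?u i N x))" for i
  proof -
    have "bounded_derivs (\<lambda>_ _. 1) (\<lambda>N x. complex_of_real
        (plateau (\<lambda>_::unit. l i) N x))"
      by (intro bounded_derivs_plateau l)
    then show ?thesis by (simp add: plateau_def UNIV_unit)
  qed
  have "bounded_derivs (\<lambda>N x. (1 + norm x) / (real N + 1))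
      (\<lambda>N x. complex_of_real (1 - (\<Prod>i\<in>I. ?u i N x)))" if "finite I" for I
    using that
  proof (induction I)
    case empty
    have "bounded_derivs (\<lambda>N x. (1 + norm (x::'a)) / (real N + 1)) (\<lambda>N x. complex_of_real 0)"
      unfolding bounded_derivs_def
      by (auto simp: smooth_const iter_deriv_const simp del: in_lists_conv_set intro!: exI[of _ 0])
    then show ?case by simp
  next
    case (insert i I)
    \<comment> \<open>Uses \<open>1 - u q = (1 - u) + u (1 - q)\<close> with bounded
      \<open>u\<close>, so the gain survives the product over the coordinates.\<close>
    have "bounded_derivs (\<lambda>N x. (1 + norm x) / (real N + 1))
      (\<lambda>N x. complex_of_real (1 - ?u i N x) +
        complex_of_real (?u i N x) * complex_of_real (1 - (\<Prod>i\<in>I. ?u i N x)))"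
      by (rule bounded_derivs_add[OF one bounded_derivs_mult[OF u1 insert.IH, unfolded mult_1]])
    then show ?case using insert.hyps by (simp add: algebra_simps)
  qed
  from this[of UNIV] show ?thesis by (simp add: plateau_def)
qed

text \<open>Both tails of each factor are exponential, so they beat any prescribed power
  \<open>K\<close>. The weight stays a product over coordinates because integrability over space is
  later read off coordinatewise.\<close>

lemma bounded_derivs_bump:
  assumes l: "\<And>i. bounded_linear (l i)"
  shows "bounded_derivs (\<lambda>_ x. \<Prod>i\<in>UNIV. inverse ((1 + \<bar>l i x\<bar>) ^ K)) (\<lambda>_::unit. \<lambda>x. complex_of_real (bump l x))"
proof -
  obtain C where C: "\<And>y::real. (1 + \<bar>y\<bar>) ^ K * exp (- \<bar>y\<bar>) \<le> C"
    using power_exp_bounded by blast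
  then have C0: "C \<ge> 1" using C[of 0] by simp
  have e: "exp (- \<bar>y\<bar>) \<le> C * inverse ((1 + \<bar>y\<bar>) ^ K)" for y
    using C[of y] by (simp add: divide_inverse [symmetric] pos_le_divide_eq mult.commute add_pos_nonneg)
  \<comment> \<open>The two logistic terms are centred one unit apart; moving the weight by that
    unit costs \<open>2 ^ K\<close>.\<close>
  have shift: "inverse ((1 + \<bar>y + 1\<bar>) ^ K) \<le> 2 ^ K * inverse ((1 + \<bar>y\<bar>) ^ K)" for y :: real
  proof -
    have "1 + \<bar>y\<bar> \<le> 2 * (1 + \<bar>y + 1\<bar>)"
    proof -
      have "\<bar>y\<bar> \<le> \<bar>y + 1\<bar> + 1" using abs_triangle_ineq[of "y + 1" "- 1"] by simp
      then have "1 + \<bar>y\<bar> \<le> 2 + \<bar>y + 1\<bar>" by simp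
      also have "\<dots> \<le> 2 + (\<bar>y + 1\<bar> + \<bar>y + 1\<bar>)"
        by (intro add_left_mono) simp
      finally show ?thesis by simp
    qed
    then have "(1 + \<bar>y\<bar>) ^ K \<le> (2 * (1 + \<bar>y + 1\<bar>)) ^ K" by (intro power_mono) auto
    then show ?thesis unfolding power_mult_distrib by (simp add: field_simps add_pos_nonneg)
  qed
  let ?C = "C * 2 ^ K"
  have le: "C * inverse ((1 + \<bar>y\<bar>) ^ K) \<le> ?C * inverse ((1 + \<bar>y\<bar>) ^ K)" for y :: real
    using C0 by (intro mult_right_mono) auto
  have s0: "logistic_slope (y + 0) \<le> ?C * inverse ((1 + \<bar>y\<bar>) ^ K)" for y
    using order_trans[OF logistic_slope_le_exp[of y] order_trans[OF e le]] by simp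
  have e1: "exp (- \<bar>y + 1\<bar>) \<le> ?C * inverse ((1 + \<bar>y\<bar>) ^ K)" for y :: real
    using order_trans[OF e[of "y + 1"] mult_left_mono[OF shift[of y]]] C0 by (simp add: mult.assoc)
  have s1: "logistic_slope (y + 1) \<le> ?C * inverse ((1 + \<bar>y\<bar>) ^ K)" for y
    using order_trans[OF logistic_slope_le_exp e1] by simp
  \<comment> \<open>To the right of 0 the difference is at most the upper tail
    \<open>1 - logistic y\<close>, to the left of -1 at most the lower tail at \<open>y + 1\<close>,
    and in the gap between them at most 1, where the weight is bounded by
    \<open>2 ^ K\<close>.\<close>
  have d: "\<bar>0 + logistic (y + 1) - logistic (y + 0)\<bar> \<le> ?C * inverse ((1 + \<bar>y\<bar>) ^ K)" for y
  proof (cases "y \<ge> 0")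
    case True
    have "\<bar>0 + logistic (y + 1) - logistic (y + 0)\<bar> \<le> 1 - logistic y"
      using logistic_mono[of y "y + 1"] logistic_less_1[of "y + 1"] by simp
    also have "\<dots> \<le> exp (- \<bar>y\<bar>)"
      unfolding one_minus_logistic using logistic_le_exp[of "- y"] True by simp
    finally show ?thesis using order_trans[OF e le] order_trans by blast
  next
    case False
    show ?thesis
    proof (cases "y + 1 \<le> 0")
      case True
      have "\<bar>0 + logistic (y + 1) - logistic (y + 0)\<bar> \<le> logistic (y + 1)"
        using logistic_mono[of y "y + 1"] logistic_pos[of y] by simp
      also have "\<dots> \<le> exp (- \<bar>y + 1\<bar>)"
        using logistic_le_exp[of "y + 1"] unfolding abs_of_nonpos[OF True] minus_minus .
      finally show ?thesis using e1 order_trans by blast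
    next
      case F: False
      have "\<bar>0 + logistic (y + 1) - logistic (y + 0)\<bar> \<le> 1"
        using logistic_mono[of y "y + 1"] logistic_pos[of y] logistic_less_1[of "y + 1"] by simp
      moreover have "(1 + \<bar>y\<bar>) ^ K \<le> 2 ^ K" using F False by (intro power_mono) auto
      moreover have "1 * 2 ^ K \<le> C * 2 ^ K" using C0 by (intro mult_right_mono) auto
      ultimately have "(1 + \<bar>y\<bar>) ^ K \<le> C * 2 ^ K"
        "\<bar>0 + logistic (y + 1) - logistic (y + 0)\<bar> \<le> 1" by linarith+
      moreover from this(1) have "1 \<le> ?C * inverse ((1 + \<bar>y\<bar>) ^ K)"
        by (simp add: divide_inverse [symmetric] pos_le_divide_eq add_pos_nonneg)
      ultimately show ?thesis by linarith
    qed
  qed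
  have "bounded_derivs (\<lambda>_ x. inverse ((1 + \<bar>l i x\<bar>) ^ K))
      (\<lambda>_::unit. \<lambda>x. complex_of_real (0 + logistic (l i x + 1) - logistic (l i x + 0)))" for i
    using C0 by (intro bounded_derivs_logistic_diff[where ?C0.0 = ?C and ?C1.0 = ?C] l d s0 s1) auto
  then have "bounded_derivs (\<lambda>_ x. \<Prod>i\<in>UNIV. inverse ((1 + \<bar>l i x\<bar>) ^ K)) (\<lambda>_::unit. \<lambda>x.
      \<Prod>i\<in>UNIV. complex_of_real (0 + logistic (l i x + 1) - logistic (l i x + 0)))"
    by (rule bounded_derivs_prod[where W = "\<lambda>i _ x. inverse ((1 + \<bar>l i x\<bar>) ^ K)"
        and F = "\<lambda>i _ x. complex_of_real (0 + logistic (l i x + 1) - logistic (l i x + 0))", OF finite])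
  then show ?thesis by (simp add: bump_def)
qed

section \<open>Lattice sums and a summable weight\<close>

lemma bij_axis_Basis: "bij_betw (\<lambda>i. axis i (1::real)) UNIV (Basis :: (real ^ 'n) set)"
  by (auto simp: bij_betw_def inj_on_def Basis_vec_def axis_eq_axis)

lemma has_bochner_integral_lborel_prod:
  fixes f :: "'n::finite \<Rightarrow> real \<Rightarrow> real"
  assumes int: "\<And>i. integrable lborel (f i)" and nn: "\<And>i x. 0 \<le> f i x"
  shows "has_bochner_integral lborel (\<lambda>y::real ^ 'n. \<Prod>i\<in>UNIV. f i (y $ i)) (\<Prod>i\<in>UNIV. integral\<^sup>L lborel (f i))"
proof (rule has_bochner_integral_nn_integral)
  have [measurable]: "f i \<in> borel_measurable borel" for i
    using borel_measurable_integrable[OF int[of i]] by simp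
  show "(\<lambda>y::real ^ 'n. \<Prod>i\<in>UNIV. f i (y $ i)) \<in> borel_measurable lborel"
    by measurable
  show "AE y in lborel. 0 \<le> (\<Prod>i\<in>UNIV. f i (y $ i))" using nn by (simp add: prod_nonneg)
  show "0 \<le> (\<Prod>i\<in>UNIV. integral\<^sup>L lborel (f i))" using nn by (intro prod_nonneg) simp
  let ?e = "\<lambda>i. axis i (1::real) :: real ^ 'n"
  \<comment> \<open>Tonelli's theorem over \<open>lborel\<close> is indexed by basis vectors;
    \<open>the_inv_into\<close> leads back to the index type.\<close>
  let ?g = "\<lambda>b. \<lambda>x. ennreal (f (the_inv_into UNIV ?e b) x)"
  have inv: "the_inv_into UNIV ?e (?e i) = i" for i
    using bij_axis_Basis[where 'n='n] by (auto simp: bij_betw_def intro: the_inv_into_f_f)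
  have "(\<integral>\<^sup>+y. ennreal (\<Prod>i\<in>UNIV. f i (y $ i)) \<partial>(lborel :: (real ^ 'n) measure)) =
      (\<integral>\<^sup>+y. (\<Prod>b\<in>Basis. ?g b (y \<bullet> b)) \<partial>lborel)"
  proof (rule nn_integral_cong)
    fix y :: "real ^ 'n"
    have "(\<Prod>b\<in>Basis. ?g b (y \<bullet> b)) = (\<Prod>i\<in>UNIV. ?g (?e i) (y \<bullet> ?e i))"
      by (rule prod.reindex_bij_betw[OF bij_axis_Basis, symmetric])
    also have "\<dots> = (\<Prod>i\<in>UNIV. ennreal (f i (y $ i)))" by (simp add: inv inner_axis)
    also have "\<dots> = ennreal (\<Prod>i\<in>UNIV. f i (y $ i))" using nn by (rule prod_ennreal)
    finally show "ennreal (\<Prod>i\<in>UNIV. f i (y $ i)) = (\<Prod>b\<in>Basis. ?g b (y \<bullet> b))" ..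
  qed
  also have "\<dots> = (\<Prod>b\<in>Basis. (\<integral>\<^sup>+x. ?g b x \<partial>lborel))"
    by (rule nn_integral_lborel_prod) auto
  also have "\<dots> = (\<Prod>i\<in>UNIV. (\<integral>\<^sup>+x. ?g (?e i) x \<partial>lborel))"
    by (rule prod.reindex_bij_betw[OF bij_axis_Basis, symmetric])
  also have "\<dots> = (\<Prod>i\<in>UNIV. ennreal (integral\<^sup>L lborel (f i)))"
    unfolding inv using int nn by (simp add: nn_integral_eq_integral)
  also have "\<dots> = ennreal (\<Prod>i\<in>UNIV. integral\<^sup>L lborel (f i))"
    using nn by (intro prod_ennreal) simp
  finally show "(\<integral>\<^sup>+y. ennreal (\<Prod>i\<in>UNIV. f i (y $ i)) \<partial>(lborel :: (real ^ 'n) measure)) =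
      ennreal (\<Prod>i\<in>UNIV. integral\<^sup>L lborel (f i))" .
qed

lemma integrable_inverse_one_plus_square: "integrable lborel (\<lambda>x::real. inverse (1 + x\<^sup>2))"
proof (rule integrableI_nonneg)
  let ?f = "\<lambda>x::real. inverse (1 + x\<^sup>2)"
  have D: "DERIV arctan x :> ?f x" for x by (rule DERIV_arctan)
  have half: "(\<integral>\<^sup>+x. ennreal (?f x) * indicator {0..} x \<partial>lborel) = ennreal (pi / 2 - arctan 0)"
    by (rule nn_integral_FTC_atLeast[OF _ D _ tendsto_arctan_at_top]) (auto simp: add_nonneg_nonneg)
  have half': "(\<integral>\<^sup>+x. ennreal (?f x) * indicator {..0} x \<partial>lborel) = ennreal (pi / 2 - arctan 0)"
  proof -
    have "(\<integral>\<^sup>+x. ennreal (?f x) * indicator {..0} x \<partial>lborel) =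
        ennreal \<bar>-1\<bar> * (\<integral>\<^sup>+x. ennreal (?f (0 + (-1) * x)) * indicator {..0} (0 + (-1) * x) \<partial>lborel)"
      by (rule nn_integral_real_affine) auto
    also have "(\<lambda>x::real. ennreal (?f (0 + (-1) * x)) * indicator {..0} (0 + (-1) * x)) =
        (\<lambda>x. ennreal (?f x) * indicator {0..} x)"
      by (auto split: split_indicator)
    finally show ?thesis using half by simp
  qed
  have "(\<integral>\<^sup>+x. ennreal (?f x) \<partial>lborel) \<le>
      (\<integral>\<^sup>+x. ennreal (?f x) * indicator {0..} x + ennreal (?f x) * indicator {..0} x \<partial>lborel)"
    by (rule nn_integral_mono) (auto split: split_indicator)
  also have "\<dots> = ennreal (pi / 2 - arctan 0) + ennreal (pi / 2 - arctan 0)"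
    unfolding half[symmetric] by (subst nn_integral_add) (simp_all only: half half', auto)
  also have "\<dots> < \<infinity>" by simp
  finally show "(\<integral>\<^sup>+x. ennreal (?f x) \<partial>lborel) < \<infinity>" .
qed (auto simp: add_nonneg_nonneg)

text \<open>A weight integrable over space and summable over the lattice. The product form reduces
  both facts to one dimension.\<close>

definition wt :: "real ^ 'n::finite \<Rightarrow> real" where
  "wt y = (\<Prod>i\<in>UNIV. inverse (1 + (y $ i)\<^sup>2))"

lemma wt_pos: "0 < wt y"
  unfolding wt_def by (rule prod_pos) (simp add: add_pos_nonneg)

lemma wt_nonneg: "0 \<le> wt y"
  using wt_pos by (rule less_imp_le)

lemma wt_le_1: "wt y \<le> 1"
  unfolding wt_def by (rule prod_le_1) (simp add: inverse_le_1_iff)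

lemma integrable_wt: "integrable lborel (wt :: real ^ 'n::finite \<Rightarrow> real)"
  using has_bochner_integral_lborel_prod[OF integrable_inverse_one_plus_square]
  unfolding wt_def[abs_def] has_bochner_integral_iff by auto

text \<open>Peetre's inequality for \<open>wt\<close>: one additional weight factor recentres a
  translate, with a constant that does not depend on the translation.\<close>

lemma wt_shift: "wt (x + y) * wt x \<le> 2 ^ CARD('n) * wt (y :: real ^ 'n::finite)"
proof -
  have "inverse (1 + (x $ i + y $ i)\<^sup>2) * inverse (1 + (x $ i)\<^sup>2) \<le> 2 * inverse (1 + (y $ i)\<^sup>2)" for i
  proof -
    let ?u = "x $ i + y $ i" and ?v = "x $ i"
    have "(?u - ?v)\<^sup>2 \<le> 2 * ?u\<^sup>2 + 2 * ?v\<^sup>2"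
      using sum_squares_bound[of ?u "- ?v"] by (simp only: power2_diff power2_minus)
    also have "1 + \<dots> \<le> 2 * ((1 + ?u\<^sup>2) * (1 + ?v\<^sup>2))"
      by (simp add: algebra_simps)
    finally have *: "1 + (y $ i)\<^sup>2 \<le> 2 * ((1 + ?u\<^sup>2) * (1 + ?v\<^sup>2))" by simp
    have "0 < 1 + ?u\<^sup>2" "0 < 1 + ?v\<^sup>2" "0 < 1 + (y $ i)\<^sup>2"
      by (simp_all add: add_pos_nonneg)
    with * show ?thesis by (simp add: field_simps)
  qed
  then have "(\<Prod>i\<in>UNIV. inverse (1 + (x $ i + y $ i)\<^sup>2) * inverse (1 + (x $ i)\<^sup>2)) \<le>
      (\<Prod>i\<in>(UNIV :: 'n set). 2 * inverse (1 + (y $ i)\<^sup>2))"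
    by (intro prod_mono) (auto simp: add_nonneg_nonneg)
  then show ?thesis by (simp add: wt_def prod.distrib)
qed

text \<open>The source of the exponent \<open>2 * CARD('n)\<close> that recurs below: each of the
  coordinate factors \<open>1 + (y $ i)^2\<close> is at most \<open>(1 + norm y)^2\<close>.\<close>

lemma inverse_power_le_wt: "inverse ((1 + norm y) ^ (2 * CARD('n))) \<le> wt (y :: real ^ 'n::finite)"
proof -
  have "1 + (y $ i)\<^sup>2 \<le> (1 + norm y)\<^sup>2" for i
  proof -
    have "(y $ i)\<^sup>2 \<le> (norm y)\<^sup>2" using component_le_norm_cart[of y i] by (metis abs_le_square_iff abs_norm_cancel)
    then have "1 + (y $ i)\<^sup>2 \<le> 1 + (norm y)\<^sup>2" by simp
    also have "\<dots> \<le> (1 + norm y)\<^sup>2" unfolding power2_sum by simp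
    finally show ?thesis .
  qed
  then have "(\<Prod>i\<in>UNIV. 1 + (y $ i)\<^sup>2) \<le> (\<Prod>i\<in>(UNIV :: 'n set). (1 + norm y)\<^sup>2)"
    by (intro prod_mono) (auto simp: add_nonneg_nonneg)
  then have *: "(\<Prod>i\<in>UNIV. 1 + (y $ i)\<^sup>2) \<le> (1 + norm y) ^ (2 * CARD('n))"
    by (simp add: power_mult)
  have "0 < (\<Prod>i\<in>UNIV. 1 + (y $ i)\<^sup>2)" by (rule prod_pos) (simp add: add_pos_nonneg)
  from le_imp_inverse_le[OF * this] show ?thesis
    by (simp add: wt_def prod_inversef[symmetric] comp_def)
qed

section \<open>Exhaustion of the lattice by cubes\<close>

definition lattice_box :: "nat \<Rightarrow> (int ^ 'n::finite) set" where
  "lattice_box N = {a. \<forall>i. a $ i \<in> {- int N..int N}}"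

lemma bij_lattice_box: "bij_betw vec_lambda (PiE UNIV (\<lambda>_. {- int N..int N})) (lattice_box N)"
  by (rule bij_betw_byWitness[where f' = vec_nth]) (auto simp: lattice_box_def PiE_def)

lemma finite_lattice_box: "finite (lattice_box N :: (int ^ 'n::finite) set)"
proof -
  have "finite (PiE (UNIV :: 'n set) (\<lambda>_. {- int N..int N}))"
    by (rule finite_PiE) auto
  moreover have "bij_betw vec_lambda (PiE (UNIV :: 'n set) (\<lambda>_. {- int N..int N})) (lattice_box N)"
    by (rule bij_lattice_box)
  ultimately show ?thesis using bij_betw_finite by blast
qed

lemma sum_lattice_box:
  fixes f :: "'n::finite \<Rightarrow> int \<Rightarrow> 'c::comm_semiring_1"
  shows "(\<Sum>a\<in>lattice_box N. \<Prod>i\<in>UNIV. f i (a $ i)) = (\<Prod>i\<in>UNIV. \<Sum>k\<in>{- int N..int N}. f i k)"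
  using sum.reindex_bij_betw[OF bij_lattice_box, of "\<lambda>a. \<Prod>i\<in>UNIV. f i (a $ i)" N]
  by (simp add: prod_sum_PiE)

lemma lattice_box_mono: "M \<le> N \<Longrightarrow> lattice_box M \<subseteq> (lattice_box N :: (int ^ 'a::finite) set)"
proof
  fix a :: "int ^ 'a" assume MN: "M \<le> N" and a: "a \<in> lattice_box M"
  have "a $ i \<in> {- int N..int N}" for i
  proof -
    have "a $ i \<in> {- int M..int M}" using a by (simp add: lattice_box_def)
    with MN show ?thesis by auto
  qed
  then show "a \<in> lattice_box N" by (simp add: lattice_box_def)
qed

lemma finite_subset_lattice_box:
  assumes "finite (F :: (int ^ 'n::finite) set)"
  shows "\<exists>N. F \<subseteq> lattice_box N"
  using assms
proof (induction F)
  case empty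
  then show ?case by simp
next
  case (insert a F)
  then obtain N where N: "F \<subseteq> lattice_box N" by blast
  define M where "M = max N (Max (range (\<lambda>i. nat \<bar>a $ i\<bar>)))"
  have "\<bar>a $ i\<bar> \<le> int M" for i
  proof -
    have "nat \<bar>a $ i\<bar> \<le> Max (range (\<lambda>i. nat \<bar>a $ i\<bar>))" by (rule Max_ge) auto
    then show ?thesis unfolding M_def by linarith
  qed
  then have "a \<in> lattice_box M" by (simp add: lattice_box_def abs_le_iff minus_le_iff)
  moreover have "F \<subseteq> lattice_box M"
    using N lattice_box_mono[of N M] by (auto simp: M_def)
  ultimately show ?case by blast
qed

lemma summable_on_wt: "(\<lambda>a. wt (int_vec a)) summable_on (UNIV :: (int ^ 'n::finite) set)"
proof (rule nonneg_bdd_above_summable_on)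
  \<comment> \<open>The explicit right-hand side makes the induction close: with
    \<open>m = N + 1\<close> the two new terms add at most
    \<open>4 / (m (m + 1)) = 4 / m - 4 / (m + 1)\<close>. The value 5 gives equality at
    \<open>N = 0\<close>.\<close>
  have s1: "(\<Sum>k\<in>{- int N..int N}. inverse (1 + (real_of_int k)\<^sup>2)) \<le> 5 - 4 / (real N + 1)" for N
  proof (induction N)
    case 0
    then show ?case by simp
  next
    case (Suc N)
    let ?m = "real N + 1"
    have "inverse (1 + ?m\<^sup>2) \<le> 2 / (?m * (?m + 1))"
    proof -
      have p: "0 < ?m * (?m + 1)" "0 < 1 + ?m\<^sup>2" by (simp_all add: add_pos_nonneg)
      have "?m * (?m + 1) \<le> 2 * (1 + ?m\<^sup>2)"
        by (simp add: power2_eq_square algebra_simps)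
      with p show ?thesis by (simp add: field_simps)
    qed
    moreover have "4 / ?m - 4 / (?m + 1) = 2 * (2 / (?m * (?m + 1)))"
      by (simp add: field_simps)
    ultimately have m: "2 * inverse (1 + ?m\<^sup>2) \<le> 4 / ?m - 4 / (?m + 1)" by linarith
    have "{- int (Suc N)..int (Suc N)} = insert (int N + 1) (insert (- int N - 1) {- int N..int N})"
      by auto
    then have "(\<Sum>k\<in>{- int (Suc N)..int (Suc N)}. inverse (1 + (real_of_int k)\<^sup>2)) =
        inverse (1 + ?m\<^sup>2) + inverse (1 + (- real N - 1)\<^sup>2) +
        (\<Sum>k\<in>{- int N..int N}. inverse (1 + (real_of_int k)\<^sup>2))"
      by simp
    also have "(- real N - 1)\<^sup>2 = ?m\<^sup>2" by (simp add: power2_eq_square algebra_simps)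
    finally show ?case using Suc m by (simp add: add.commute)
  qed
  have s1: "(\<Sum>k\<in>{- int N..int N}. inverse (1 + (real_of_int k)\<^sup>2)) \<le> 5" for N
    using s1[of N] by (rule order_trans) simp
  show "bdd_above (sum (\<lambda>a. wt (int_vec a)) ` {F. F \<subseteq> (UNIV :: (int ^ 'n) set) \<and> finite F})"
  proof (rule bdd_aboveI2)
    fix F :: "(int ^ 'n) set" assume "F \<in> {F. F \<subseteq> UNIV \<and> finite F}"
    then obtain N where N: "F \<subseteq> lattice_box N" using finite_subset_lattice_box by blast
    have "(\<Sum>a\<in>F. wt (int_vec a)) \<le> (\<Sum>a\<in>(lattice_box N :: (int ^ 'n) set). wt (int_vec a))"
      by (intro sum_mono2 finite_lattice_box N wt_nonneg)
    also have "\<dots> = (\<Prod>i\<in>(UNIV :: 'n set). \<Sum>k\<in>{- int N..int N}. inverse (1 + (real_of_int k)\<^sup>2))"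
      unfolding wt_def int_vec_def vec_lambda_beta by (rule sum_lattice_box)
    also have "\<dots> \<le> (\<Prod>i\<in>(UNIV :: 'n set). 5)"
      by (intro prod_mono conjI s1 sum_nonneg) (auto simp: add_nonneg_nonneg)
    finally show "(\<Sum>a\<in>F. wt (int_vec a)) \<le> 5 ^ CARD('n)" by simp
  qed
qed (rule wt_nonneg)

lemma sum_wt_bounded:
  obtains W where "W > 0" "\<And>F. finite F \<Longrightarrow> (\<Sum>a\<in>F. wt (int_vec (a :: int ^ 'n::finite))) \<le> W"
proof
  let ?W = "infsum (\<lambda>a. wt (int_vec a)) (UNIV :: (int ^ 'n) set)"
  show "0 < \<bar>?W\<bar> + 1" by simp
  fix F :: "(int ^ 'n) set" assume "finite F"
  then have "(\<Sum>a\<in>F. wt (int_vec a)) \<le> ?W"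
    by (intro finite_sum_le_infsum summable_on_wt) (auto intro: wt_nonneg)
  then show "(\<Sum>a\<in>F. wt (int_vec a)) \<le> \<bar>?W\<bar> + 1" by linarith
qed

text \<open>Stated for all finite sets off the cube, since it is applied to differences of cubes
  whose outer size is not controlled.\<close>

lemma wt_tail:
  assumes "\<epsilon> > 0"
  obtains N where "\<And>F. finite F \<Longrightarrow> F \<inter> lattice_box N = {} \<Longrightarrow> (\<Sum>a\<in>F. wt (int_vec (a :: int ^ 'n::finite))) < \<epsilon>"
proof -
  let ?w = "\<lambda>a :: int ^ 'n. wt (int_vec a)"
  let ?W = "infsum ?w UNIV"
  have "(sum ?w \<longlongrightarrow> ?W) (finite_subsets_at_top UNIV)"
    using summable_on_wt has_sum_infsum has_sum_def by blast
  then have "\<forall>\<^sub>F F in finite_subsets_at_top UNIV. dist (sum ?w F) ?W < \<epsilon>"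
    using assms by (rule tendstoD)
  then obtain F0 where F0: "finite F0" "dist (sum ?w F0) ?W < \<epsilon>"
    unfolding eventually_finite_subsets_at_top by blast
  obtain N where N: "F0 \<subseteq> lattice_box N" using finite_subset_lattice_box[OF F0(1)] by blast
  show thesis
  proof (rule that)
    fix F :: "(int ^ 'n) set" assume F: "finite F" "F \<inter> lattice_box N = {}"
    have "sum ?w F0 + sum ?w F = sum ?w (F0 \<union> F)"
      using F F0 N by (intro sum.union_disjoint[symmetric]) auto
    also have "\<dots> \<le> ?W"
      using F F0 by (intro finite_sum_le_infsum summable_on_wt) (auto intro: wt_nonneg)
    finally show "sum ?w F < \<epsilon>" using F0(2) by (simp add: dist_real_def)
  qed
qed

section \<open>A Poisson summation inequality\<close>

definition lattice_char :: "int ^ 'n::finite \<Rightarrow> real ^ 'n \<Rightarrow> complex" where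
  "lattice_char \<xi> y = cis (2 * pi * (int_vec \<xi> \<bullet> y))"

text \<open>The plus sign in the character suits transposition: minus a space derivative of a test
  function then acts on its coefficients as multiplication by a component of \<open>iB\<xi>\<close>,
  the very point at which the symbol is factored.\<close>

definition fourier :: "(real ^ 'n::finite \<Rightarrow> complex) \<Rightarrow> int ^ 'n \<Rightarrow> complex" where
  "fourier \<psi> \<xi> = (\<integral>y. \<psi> y * lattice_char \<xi> y \<partial>lborel)"

lemma norm_lattice_char [simp]: "cmod (lattice_char \<xi> y) = 1"
  by (simp add: lattice_char_def)

lemma continuous_lattice_char: "continuous_on S (lattice_char \<xi>)"
  unfolding lattice_char_def[abs_def] by (intro continuous_intros)

lemma lattice_char_add: "lattice_char \<xi> (x + y) = lattice_char \<xi> x * lattice_char \<xi> y"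
  by (simp add: lattice_char_def inner_add_right cis_mult algebra_simps)

lemma lattice_char_int: "lattice_char \<xi> (int_vec a) = 1"
proof -
  have "int_vec \<xi> \<bullet> int_vec a = real_of_int (\<Sum>i\<in>UNIV. \<xi> $ i * a $ i)"
    by (simp add: inner_vec_def int_vec_def)
  then show ?thesis unfolding lattice_char_def by (simp only: cis_multiple_2pi Ints_of_int)
qed

lemma lattice_char_prod:
  "lattice_char \<xi> y = (\<Prod>i\<in>UNIV. cis (2 * pi * (real_of_int (\<xi> $ i) * y $ i)))"
proof -
  have "(\<Prod>i\<in>I. cis (f i)) = cis (\<Sum>i\<in>I. f i)" if "finite I" for I and f :: "'a \<Rightarrow> real"
    using that by (induction I) (auto simp: cis_mult)
  then show ?thesis
    by (simp add: lattice_char_def inner_vec_def int_vec_def sum_distrib_left)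
qed

text \<open>A positive trigonometric kernel that is easier to handle than Fejer's: its coefficients are
  quotients of binomial coefficients, hence at most 1, and the recursion for \<open>cos_mean\<close> says that
  \<open>sin\<^sup>2 (\<pi> s)\<close> has integral \<open>1/(2M + 2)\<close> against it, which is how it concentrates at 0.\<close>

definition cos_mean :: "nat \<Rightarrow> real" where
  "cos_mean M = real ((2 * M) choose M) / 4 ^ M"

lemma cos_mean_pos: "0 < cos_mean M"
  by (simp add: cos_mean_def)

lemma cos_mean_Suc: "cos_mean (Suc M) * (2 * real M + 2) = cos_mean M * (2 * real M + 1)"
proof -
  have 1: "Suc M * ((2 * Suc M) choose Suc M) = (2 * M + 2) * ((2 * M + 1) choose M)"
    using Suc_times_binomial[of M "2 * M + 1"] by simp
  have 2: "Suc M * ((2 * M + 1) choose Suc M) = (2 * M + 1) * ((2 * M) choose M)"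
    using Suc_times_binomial[of M "2 * M"] by simp
  have 3: "(2 * M + 1) choose M = (2 * M + 1) choose Suc M"
    using binomial_symmetric[of M "2 * M + 1"] by simp
  have "Suc M * ((2 * Suc M) choose Suc M) = 2 * ((2 * M + 1) * ((2 * M) choose M))"
    unfolding 2[symmetric] 1 3 by simp
  from arg_cong[OF this, of real]
  have "real (Suc M) * real ((2 * Suc M) choose Suc M) = 2 * ((2 * real M + 1) * real ((2 * M) choose M))"
    by (simp only: of_nat_mult of_nat_add of_nat_numeral of_nat_1)
  moreover have "(X / 4 ^ Suc M) * (2 * real M + 2) = (Y / 4 ^ M) * (2 * real M + 1)"
    if "real (Suc M) * X = 2 * ((2 * real M + 1) * Y)" for X Y
  proof -
    have "(X / 4 ^ Suc M) * (2 * real M + 2) = (real (Suc M) * X) * (2 / (4 * 4 ^ M))"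
      by (simp add: field_simps)
    also have "\<dots> = (Y / 4 ^ M) * (2 * real M + 1)"
      unfolding that by (simp add: field_simps)
    finally show ?thesis .
  qed
  ultimately show ?thesis unfolding cos_mean_def by blast
qed

definition kernel_coeff :: "nat \<Rightarrow> int \<Rightarrow> real" where
  "kernel_coeff M j = real ((2 * M) choose nat (j + int M)) / real ((2 * M) choose M)"

lemma kernel_coeff_bounds: "0 \<le> kernel_coeff M j" "kernel_coeff M j \<le> 1"
  unfolding kernel_coeff_def
  using binomial_maximum'[of M "nat (j + int M)"] by (auto simp: divide_le_eq_1 simp del: binomial_eq_0_iff)

definition cos_kernel :: "nat \<Rightarrow> real \<Rightarrow> real" where
  "cos_kernel M s = cos (pi * s) ^ (2 * M) / cos_mean M"

lemma cos_kernel_nonneg: "0 \<le> cos_kernel M s"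
  using cos_mean_pos[of M] by (simp add: cos_kernel_def)

lemma cos_kernel_le: "cos_kernel M s \<le> 1 / cos_mean M"
proof -
  have "cos (pi * s) ^ (2 * M) = ((cos (pi * s))\<^sup>2) ^ M" by (simp add: power_mult)
  also have "\<dots> \<le> 1" using abs_cos_le_one[of "pi * s"] by (intro power_le_one[of "(cos (pi * s))\<^sup>2"]) (simp_all only: abs_square_le_1 zero_le_power2)
  finally show ?thesis using cos_mean_pos[of M] by (simp add: cos_kernel_def divide_right_mono)
qed

lemma cos_kernel_add_int: "cos_kernel M (s + real_of_int k) = cos_kernel M s"
proof -
  have "cos (pi * (s + real_of_int k)) ^ 2 = cos (pi * s) ^ 2"
  proof (cases "even k")
    case True
    then obtain j where "k = 2 * j" by (elim evenE)
    then have "cos (pi * (s + real_of_int k)) = cos (pi * s + 2 * pi * real_of_int j)"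
      by (simp add: algebra_simps)
    then show ?thesis by (simp add: cos_add)
  next
    case False
    then obtain j where "k = 2 * j + 1" by (elim oddE)
    then have "cos (pi * (s + real_of_int k)) = cos ((pi * s + pi) + 2 * pi * real_of_int j)"
      by (simp add: algebra_simps)
    also have "\<dots> = cos (pi * s + pi)" by (simp only: cos_add[of "_ + _" "_ * _ * _"] cos_int_2pin sin_int_2pin)
    finally show ?thesis by simp
  qed
  then show ?thesis by (simp add: cos_kernel_def power_mult)
qed

text \<open>The two exponentials in \<open>cos (pi * s)\<close> have frequencies that differ by 1,
  so the even power, expanded by the binomial theorem, contains integer frequencies only.\<close>

lemma cos_kernel_eq:
  "complex_of_real (cos_kernel M s) =
    (\<Sum>j\<in>{- int M..int M}. complex_of_real (kernel_coeff M j) * cis (2 * pi * (real_of_int j * s)))"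
proof -
  let ?z = "pi * s"
  have c: "complex_of_real (cos ?z) = (cis ?z + cis (- ?z)) / 2"
    by (simp add: complex_eq_iff)
  have "(2 :: complex) ^ (2 * M) = 4 ^ M" by (simp add: power_mult)
  then have "complex_of_real (cos ?z ^ (2 * M)) = (cis ?z + cis (- ?z)) ^ (2 * M) / 4 ^ M"
    by (simp only: of_real_power c power_divide)
  also have "(cis ?z + cis (- ?z)) ^ (2 * M) =
      (\<Sum>k\<le>2 * M. of_nat ((2 * M) choose k) * cis ?z ^ k * cis (- ?z) ^ (2 * M - k))"
    by (rule binomial_ring)
  also have "\<dots> = (\<Sum>k\<le>2 * M. of_nat ((2 * M) choose k) * cis (2 * pi * (real_of_int (int k - int M) * s)))"
  proof (rule sum.cong[OF refl])
    fix k assume "k \<in> {..2 * M}"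
    then have k: "k \<le> 2 * M" by simp
    have "cis ?z ^ k * cis (- ?z) ^ (2 * M - k) = cis (real k * ?z + real (2 * M - k) * (- ?z))"
      by (simp only: Complex.DeMoivre cis_mult)
    also have "real k * ?z + real (2 * M - k) * (- ?z) = 2 * pi * (real_of_int (int k - int M) * s)"
      using k by (simp add: of_nat_diff algebra_simps)
    finally show "of_nat ((2 * M) choose k) * cis ?z ^ k * cis (- ?z) ^ (2 * M - k) =
        of_nat ((2 * M) choose k) * cis (2 * pi * (real_of_int (int k - int M) * s))"
      by (simp add: mult.assoc)
  qed
  also have "\<dots> = (\<Sum>j\<in>{- int M..int M}. of_nat ((2 * M) choose nat (j + int M)) * cis (2 * pi * (real_of_int j * s)))"
    by (rule sum.reindex_bij_witness[where j = "\<lambda>k. int k - int M" and i = "\<lambda>j. nat (j + int M)"]) auto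
  finally have "complex_of_real (cos ?z ^ (2 * M)) / complex_of_real (cos_mean M) =
      (\<Sum>j\<in>{- int M..int M}. of_nat ((2 * M) choose nat (j + int M)) * cis (2 * pi * (real_of_int j * s))) /
      4 ^ M / complex_of_real (cos_mean M)" by simp
  also have "\<dots> = (\<Sum>j\<in>{- int M..int M}. complex_of_real (kernel_coeff M j) * cis (2 * pi * (real_of_int j * s)))"
  proof -
    have e: "S / 4 ^ M / complex_of_real (cos_mean M) = S / of_nat ((2 * M) choose M)" for S
      by (simp add: cos_mean_def)
    show ?thesis unfolding e kernel_coeff_def by (simp add: sum_divide_distrib)
  qed
  finally show ?thesis by (simp add: cos_kernel_def)
qed

text \<open>Half-open, so that the integer translates tile the line without overlap.\<close>

definition unit_cell :: "real set" where "unit_cell = {-1/2..<1/2}"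

lemma cell_integral:
  fixes f :: "real \<Rightarrow> real"
  assumes "\<And>x. isCont f x"
  shows "integrable lborel (\<lambda>s. f s * indicator unit_cell s)"
    and "(\<And>x. DERIV F x :> f x) \<Longrightarrow> (\<integral>s. f s * indicator unit_cell s \<partial>lborel) = F (1/2) - F (-1/2)"
proof -
  have [measurable]: "f \<in> borel_measurable borel"
    using assms by (intro borel_measurable_continuous_onI continuous_at_imp_continuous_on) auto
  have [measurable]: "unit_cell \<in> sets borel" by (simp add: unit_cell_def)
  have ae: "AE s in lborel. f s * indicator {-1/2..1/2} s = f s * indicator unit_cell s"
    using AE_lborel_singleton[of "1/2"]
    by eventually_elim (auto simp: unit_cell_def split: split_indicator)
  have "integrable lborel (\<lambda>s. f s * indicator {-1/2..1/2} s)"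
    using borel_integrable_atLeastAtMost[of "-1/2" "1/2" f] assms by (simp add: mult.commute)
  with ae show "integrable lborel (\<lambda>s. f s * indicator unit_cell s)"
    by (subst integrable_cong_AE[symmetric]) auto
  assume D: "\<And>x. DERIV F x :> f x"
  have "(\<integral>s. f s * indicator unit_cell s \<partial>lborel) = (\<integral>s. f s * indicator {-1/2..1/2} s \<partial>lborel)"
    using ae by (intro integral_cong_AE) auto
  also have "\<dots> = F (1/2) - F (-1/2)"
    by (rule integral_FTC_Icc_real) (use D assms in auto)
  finally show "(\<integral>s. f s * indicator unit_cell s \<partial>lborel) = F (1/2) - F (-1/2)" .
qed

section \<open>Mass and first moment of the one-dimensional kernel\<close>

lemma isCont_cos_power: "isCont (\<lambda>s. cos (pi * s) ^ m) x"
  by (intro continuous_intros)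

lemma cell_integral_cos: "(\<integral>s. cos (pi * s) ^ (2 * M) * indicator unit_cell s \<partial>lborel) = cos_mean M"
proof (induction M)
  case 0
  have "(\<integral>s. 1 * indicator unit_cell s \<partial>lborel) = 1/2 - (-1/2 :: real)"
    by (rule cell_integral(2)[where F = "\<lambda>x. x"]) (auto intro!: derivative_eq_intros)
  then show ?case by (simp add: cos_mean_def)
next
  case (Suc M)
  let ?J = "\<lambda>M. (\<integral>s. cos (pi * s) ^ (2 * M) * indicator unit_cell s \<partial>lborel)"
  \<comment> \<open>This is the derivative of
    \<open>sin (pi * s) * cos (pi * s) ^ (2 * M + 1) / pi\<close>, which vanishes at both ends of
    the cell. Its integral being 0 is the recursion of \<open>cos_mean_Suc\<close>, as for Wallis
    integrals.\<close>
  let ?f = "\<lambda>s. (2 * real M + 2) * cos (pi * s) ^ (2 * Suc M) - (2 * real M + 1) * cos (pi * s) ^ (2 * M)"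
  have "(\<integral>s. ?f s * indicator unit_cell s \<partial>lborel) =
      sin (pi * (1/2)) * cos (pi * (1/2)) ^ (2 * M + 1) / pi -
      sin (pi * (-1/2)) * cos (pi * (-1/2)) ^ (2 * M + 1) / pi"
  proof (rule cell_integral(2)[where F = "\<lambda>s. sin (pi * s) * cos (pi * s) ^ (2 * M + 1) / pi"])
    show "isCont ?f x" for x by (intro continuous_intros)
    show "DERIV (\<lambda>s. sin (pi * s) * cos (pi * s) ^ (2 * M + 1) / pi) x :> ?f x" for x
    proof -
      let ?c = "cos (pi * x)" and ?s = "sin (pi * x)"
      have "DERIV (\<lambda>s. cos (pi * s) ^ Suc (2 * M)) x :> (1 + real (2 * M)) * ((- ?s * pi) * ?c ^ (2 * M))"
        by (rule DERIV_power_Suc) (auto intro!: derivative_eq_intros)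
      then have "DERIV (\<lambda>s. sin (pi * s) * cos (pi * s) ^ (2 * M + 1) / pi) x :>
          ((?c * pi) * ?c ^ (2 * M + 1) + (1 + real (2 * M)) * ((- ?s * pi) * ?c ^ (2 * M)) * ?s) / pi"
        by (intro DERIV_cdivide DERIV_mult) (auto intro!: derivative_eq_intros)
      moreover have "((?c * pi) * ?c ^ (2 * M + 1) + (1 + real (2 * M)) * ((- ?s * pi) * ?c ^ (2 * M)) * ?s) / pi =
          ?c ^ (2 * M) * ?c\<^sup>2 - (1 + 2 * real M) * (?c ^ (2 * M) * ?s\<^sup>2)"
        by (simp add: field_simps power2_eq_square)
      moreover have "\<dots> = ?f x"
        unfolding sin_squared_eq by (simp add: algebra_simps power2_eq_square)
      ultimately show ?thesis by simp
    qed
  qed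
  also have "\<dots> = 0" by (simp add: cos_pi_half)
  finally have "(\<integral>s. ?f s * indicator unit_cell s \<partial>lborel) = 0" .
  moreover have "(\<integral>s. ?f s * indicator unit_cell s \<partial>lborel) = (2 * real M + 2) * ?J (Suc M) - (2 * real M + 1) * ?J M"
  proof -
    have i: "integrable lborel (\<lambda>s. cos (pi * s) ^ m * indicator unit_cell s)" for m
      by (rule cell_integral(1)) (rule isCont_cos_power)
    have "(\<lambda>s. ?f s * indicator unit_cell s) =
        (\<lambda>s. (2 * real M + 2) * (cos (pi * s) ^ (2 * Suc M) * indicator unit_cell s) -
             (2 * real M + 1) * (cos (pi * s) ^ (2 * M) * indicator unit_cell s))"
      by (simp add: left_diff_distrib mult.assoc)
    then show ?thesis
      by (simp only:) (subst Bochner_Integration.integral_diff, (intro integrable_mult_right i)+, simp)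
  qed
  ultimately have "(2 * real M + 2) * ?J (Suc M) = (2 * real M + 2) * cos_mean (Suc M)"
    unfolding Suc.IH using cos_mean_Suc[of M] by (simp add: mult.commute)
  then show ?case by (subst (asm) mult_cancel_left) auto
qed

lemma cell_integral_kernel:
  "integrable lborel (\<lambda>s. cos_kernel M s * indicator unit_cell s)"
  "(\<integral>s. cos_kernel M s * indicator unit_cell s \<partial>lborel) = 1"
proof -
  have e: "(\<lambda>s. cos_kernel M s * indicator unit_cell s) =
      (\<lambda>s. (cos (pi * s) ^ (2 * M) * indicator unit_cell s) / cos_mean M)"
    by (simp add: cos_kernel_def)
  show "integrable lborel (\<lambda>s. cos_kernel M s * indicator unit_cell s)"
    unfolding e by (intro integrable_divide cell_integral(1) isCont_cos_power)
  show "(\<integral>s. cos_kernel M s * indicator unit_cell s \<partial>lborel) = 1"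
    unfolding e using cell_integral_cos[of M] cos_mean_pos[of M] by simp
qed

lemma abs_le_abs_sin: "\<bar>s\<bar> \<le> 1/2 \<Longrightarrow> \<bar>s\<bar> \<le> \<bar>sin (pi * s)\<bar>"
proof -
  \<comment> \<open>Up to 1/6 the derivative \<open>pi * cos (pi * s)\<close> is at least 1; beyond
    that, monotonicity gives at least \<open>sin (pi / 6) = 1/2\<close>.\<close>
  have pos: "s \<le> sin (pi * s)" if s: "0 \<le> s" "s \<le> 1/2" for s
  proof (cases "s \<le> 1/6")
    case True
    show ?thesis
    proof (cases "s = 0")
      case False
      then have x: "0 < pi * s" using s by simp
      obtain z where z: "0 < z" "z < pi * s" "sin (pi * s) - sin 0 = (pi * s - 0) * cos z"
        using MVT2[OF x, of sin cos] by auto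
      have "pi * s \<le> pi / 3" using True pi_gt_zero by simp
      with z(2) have "z \<le> pi / 3" by linarith
      then have "cos (pi / 3) \<le> cos z" using z(1) by (intro cos_monotone_0_pi_le) auto
      then have c: "1/2 \<le> cos z" by (simp add: cos_60)
      have "s = (2 * s) * (1/2)" by simp
      also have "\<dots> \<le> (pi * s) * cos z"
        using c s pi_ge_two by (intro mult_mono) auto
      finally show ?thesis using z(3) by simp
    qed simp
  next
    case False
    have "sin (pi / 6) \<le> sin (pi * s)"
      using False s pi_gt_zero by (intro sin_monotone_2pi_le) (auto simp: field_simps)
    then show ?thesis using s by (simp add: sin_30)
  qed
  assume "\<bar>s\<bar> \<le> 1/2"
  then show ?thesis using pos[of s] pos[of "- s"] by (cases "s \<ge> 0") (auto simp: abs_if)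
qed

text \<open>The integral of \<open>sin^2\<close> against the kernel is
  \<open>1 - cos_mean (Suc M) / cos_mean M = 1 / (2M + 2)\<close>. The first moment follows from
  \<open>x \<le> \<eta> + x^2 / (4 \<eta>)\<close> with \<open>x = \<bar>sin (pi * s)\<bar>\<close>,
  which dominates \<open>\<bar>s\<bar>\<close> on the cell.\<close>

lemma cell_integral_abs:
  "integrable lborel (\<lambda>s. \<bar>s\<bar> * (cos_kernel M s * indicator unit_cell s))"
  "\<eta> > 0 \<Longrightarrow> (\<integral>s. \<bar>s\<bar> * (cos_kernel M s * indicator unit_cell s) \<partial>lborel) \<le> \<eta> + 1 / (4 * \<eta> * (2 * real M + 2))"
proof -
  have ck: "isCont (cos_kernel M) x" for x
    unfolding cos_kernel_def[abs_def] using cos_mean_pos[of M] by (intro continuous_intros) auto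
  have i: "integrable lborel (\<lambda>s. (\<bar>s\<bar> * cos_kernel M s) * indicator unit_cell s)"
    by (rule cell_integral(1)) (intro continuous_intros ck)
  then show i': "integrable lborel (\<lambda>s. \<bar>s\<bar> * (cos_kernel M s * indicator unit_cell s))"
    by (simp add: mult.assoc)
  assume \<eta>: "\<eta> > 0"
  let ?K = "\<lambda>s. cos_kernel M s * indicator unit_cell s"
  let ?C = "\<lambda>M s. cos (pi * s) ^ (2 * M) * indicator unit_cell s"
  have iC: "integrable lborel (?C M)" for M
    by (intro cell_integral(1) isCont_cos_power)
  let ?g = "\<lambda>s. \<eta> * ?K s + (?C M s - ?C (Suc M) s) / (4 * \<eta> * cos_mean M)"
  have "(\<integral>s. \<bar>s\<bar> * ?K s \<partial>lborel) \<le> (\<integral>s. ?g s \<partial>lborel)"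
  proof (rule integral_mono[OF i'])
    show "integrable lborel ?g"
      by (intro Bochner_Integration.integrable_add integrable_mult_right cell_integral_kernel
          integrable_divide Bochner_Integration.integrable_diff iC)
    fix s
    show "\<bar>s\<bar> * ?K s \<le> ?g s"
    proof (cases "s \<in> unit_cell")
      case True
      let ?x = "\<bar>sin (pi * s)\<bar>"
      have "\<bar>s\<bar> \<le> ?x" using True by (intro abs_le_abs_sin) (auto simp: unit_cell_def)
      also have "?x \<le> \<eta> + ?x\<^sup>2 / (4 * \<eta>)"
        using sum_squares_bound[of "2 * \<eta>" ?x] \<eta> by (simp add: field_simps power2_eq_square)
      finally have le: "\<bar>s\<bar> * ?K s \<le> (\<eta> + ?x\<^sup>2 / (4 * \<eta>)) * ?K s"
        using cos_kernel_nonneg[of M s] by (intro mult_right_mono) auto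
      have "cos (pi * s) ^ (2 * M) - cos (pi * s) ^ (2 * Suc M) = cos (pi * s) ^ (2 * M) * ?x\<^sup>2"
        unfolding power2_abs sin_squared_eq by (simp add: algebra_simps power2_eq_square)
      then have "(\<eta> + ?x\<^sup>2 / (4 * \<eta>)) * ?K s = ?g s"
        using True \<eta> cos_mean_pos[of M]
        by (simp add: cos_kernel_def field_simps del: mult_Suc_right power_Suc)
      with le show ?thesis by simp
    qed simp
  qed
  also have "\<dots> = \<eta> * 1 + (cos_mean M - cos_mean (Suc M)) / (4 * \<eta> * cos_mean M)"
    using cell_integral_kernel[of M] cell_integral_cos[of M] cell_integral_cos[of "Suc M"] iC[of M] iC[of "Suc M"]
    by (simp del: mult_Suc_right power_Suc)
  also have "cos_mean M - cos_mean (Suc M) = cos_mean M / (2 * real M + 2)"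
    using cos_mean_Suc[of M] by (simp add: field_simps)
  also have "cos_mean M / (2 * real M + 2) / (4 * \<eta> * cos_mean M) = 1 / (4 * \<eta> * (2 * real M + 2))"
    using cos_mean_pos[of M] by (simp add: mult.commute)
  finally show "(\<integral>s. \<bar>s\<bar> * (cos_kernel M s * indicator unit_cell s) \<partial>lborel) \<le> \<eta> + 1 / (4 * \<eta> * (2 * real M + 2))"
    by simp
qed


section \<open>The kernel in several dimensions and the summation inequality\<close>

lemma lborel_integral_translate:
  fixes f :: "'a::euclidean_space \<Rightarrow> 'b::{banach, second_countable_topology}"
  assumes [measurable]: "f \<in> borel_measurable borel"
  shows "(\<integral>x. f (c + x) \<partial>lborel) = (\<integral>x. f x \<partial>lborel)"
  by (subst (2) lborel_distr_plus[of c, symmetric]) (subst integral_distr, auto)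

definition cell_ind :: "real ^ 'n::finite \<Rightarrow> real" where
  "cell_ind y = (\<Prod>i\<in>UNIV. indicator unit_cell (y $ i))"

definition kernel :: "nat \<Rightarrow> real ^ 'n::finite \<Rightarrow> real" where
  "kernel M y = (\<Prod>i\<in>UNIV. cos_kernel M (y $ i))"

lemma measurable_cell_ind [measurable]: "cell_ind \<in> borel_measurable borel"
proof -
  have [measurable]: "unit_cell \<in> sets borel" by (simp add: unit_cell_def)
  show ?thesis unfolding cell_ind_def[abs_def] by measurable
qed

lemma continuous_kernel: "continuous_on S (kernel M)"
  unfolding kernel_def[abs_def] cos_kernel_def[abs_def]
  using cos_mean_pos[of M] by (intro continuous_intros) auto

lemma measurable_kernel [measurable]: "kernel M \<in> borel_measurable borel"
  by (intro borel_measurable_continuous_onI continuous_kernel)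

lemma kernel_nonneg: "0 \<le> kernel M y"
  unfolding kernel_def by (intro prod_nonneg cos_kernel_nonneg)

lemma kernel_bounded: "\<exists>D\<ge>0. \<forall>y::real ^ 'n::finite. kernel M y \<le> D"
proof (intro exI conjI allI)
  show "0 \<le> (1 / cos_mean M) ^ CARD('n)" using cos_mean_pos[of M] by simp
  fix y :: "real ^ 'n"
  have "kernel M y \<le> (\<Prod>i\<in>(UNIV :: 'n set). 1 / cos_mean M)"
    unfolding kernel_def by (intro prod_mono conjI cos_kernel_nonneg cos_kernel_le)
  then show "kernel M y \<le> (1 / cos_mean M) ^ CARD('n)" by simp
qed

lemma kernel_periodic: "kernel M (int_vec a + y) = kernel M y"
  by (simp add: kernel_def int_vec_def add.commute[of "real_of_int _"] cos_kernel_add_int)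

lemma kernel_eq:
  "complex_of_real (kernel M y) =
    (\<Sum>\<xi>\<in>lattice_box M. complex_of_real (\<Prod>i\<in>UNIV. kernel_coeff M (\<xi> $ i)) * lattice_char \<xi> y)"
proof -
  have "complex_of_real (kernel M y) = (\<Prod>i\<in>UNIV. \<Sum>k\<in>{- int M..int M}.
      complex_of_real (kernel_coeff M k) * cis (2 * pi * (real_of_int k * y $ i)))"
    by (simp add: kernel_def cos_kernel_eq)
  also have "\<dots> = (\<Sum>\<xi>\<in>lattice_box M. \<Prod>i\<in>UNIV.
      complex_of_real (kernel_coeff M (\<xi> $ i)) * cis (2 * pi * (real_of_int (\<xi> $ i) * y $ i)))"
    by (rule sum_lattice_box[symmetric])
  finally show ?thesis by (simp add: prod.distrib lattice_char_prod)
qed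

lemma cell_ind_nonneg: "0 \<le> cell_ind y" and cell_ind_le_1: "cell_ind y \<le> 1"
  unfolding cell_ind_def by (auto intro!: prod_nonneg prod_le_1 simp: indicator_def)

lemma cell_ind_nonzero:
  assumes "cell_ind y \<noteq> 0" shows "\<bar>y $ i\<bar> \<le> 1/2"
proof -
  have "y $ i \<in> unit_cell"
    using assms by (auto simp: cell_ind_def indicator_def prod_zero_iff split: if_splits)
  then show ?thesis by (auto simp: unit_cell_def)
qed

text \<open>Because the cells tile, only the lattice point with coordinates
  \<open>\<lfloor>y $ i + 1/2\<rfloor>\<close> can contribute.\<close>

lemma sum_cell_ind:
  "(\<Sum>a\<in>lattice_box N. cell_ind (y - int_vec a)) = (if \<forall>i. \<lfloor>y $ i + 1/2\<rfloor> \<in> {- int N..int N} then 1 else 0)"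
proof -
  have "(\<Sum>k\<in>{- int N..int N}. indicator unit_cell (s - real_of_int k)) =
      (if \<lfloor>s + 1/2\<rfloor> \<in> {- int N..int N} then 1 else (0::real))" for s
  proof -
    have "indicator unit_cell (s - real_of_int k) = (if k = \<lfloor>s + 1/2\<rfloor> then 1 else (0::real))" for k
      unfolding eq_commute[of k] floor_eq_iff by (auto simp: unit_cell_def indicator_def)
    then show ?thesis by simp
  qed
  then have "(\<Sum>a\<in>lattice_box N. cell_ind (y - int_vec a)) =
      (\<Prod>i\<in>UNIV. if \<lfloor>y $ i + 1/2\<rfloor> \<in> {- int N..int N} then 1 else (0::real))"
    unfolding cell_ind_def int_vec_def
    using sum_lattice_box[of "\<lambda>i k. indicator unit_cell (y $ i - real_of_int k) :: real" N] by simp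
  also have "\<dots> = (if \<forall>i. \<lfloor>y $ i + 1/2\<rfloor> \<in> {- int N..int N} then 1 else 0)"
    by (auto simp: prod_zero_iff)
  finally show ?thesis .
qed

lemma cell_kernel_integral:
  "has_bochner_integral lborel (\<lambda>y::real ^ 'n::finite. cell_ind y * kernel M y) 1"
proof -
  have "has_bochner_integral lborel (\<lambda>y::real ^ 'n. \<Prod>i\<in>UNIV. cos_kernel M (y $ i) * indicator unit_cell (y $ i))
      (\<Prod>i\<in>(UNIV :: 'n set). \<integral>s. cos_kernel M s * indicator unit_cell s \<partial>lborel)"
    by (rule has_bochner_integral_lborel_prod) (auto simp: cell_integral_kernel cos_kernel_nonneg)
  then show ?thesis
    unfolding cell_integral_kernel(2) prod.distrib cell_ind_def kernel_def
    by (simp add: mult.commute)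
qed

text \<open>The factor \<open>\<bar>y $ j\<bar>\<close> joins the one-dimensional integral in
  coordinate \<open>j\<close>, and all other coordinates have mass 1. The bound therefore does not
  depend on the dimension.\<close>

lemma cell_kernel_moment:
  fixes j :: "'n::finite"
  assumes "\<eta> > 0"
  shows "integrable lborel (\<lambda>y::real ^ 'n. \<bar>y $ j\<bar> * (cell_ind y * kernel M y))"
    "(\<integral>y. \<bar>y $ j\<bar> * (cell_ind y * kernel M (y::real ^ 'n)) \<partial>lborel) \<le> \<eta> + 1 / (4 * \<eta> * (2 * real M + 2))"
proof -
  let ?k = "\<lambda>s. cos_kernel M s * indicator unit_cell s"
  let ?f = "\<lambda>i s. (if i = j then \<bar>s\<bar> else 1) * ?k s"
  have int: "integrable lborel (?f i)" for i
    by (cases "i = j") (simp_all add: cell_integral_kernel cell_integral_abs)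
  have val: "integral\<^sup>L lborel (?f i) = (if i = j then (\<integral>s. \<bar>s\<bar> * ?k s \<partial>lborel) else 1)" for i
    by (simp add: cell_integral_kernel)
  have "has_bochner_integral lborel (\<lambda>y::real ^ 'n. \<Prod>i\<in>UNIV. ?f i (y $ i))
      (\<Prod>i\<in>(UNIV :: 'n set). integral\<^sup>L lborel (?f i))"
    by (rule has_bochner_integral_lborel_prod[OF int]) (auto simp: cos_kernel_nonneg)
  moreover have "(\<Prod>i\<in>UNIV. ?f i (y $ i)) = \<bar>y $ j\<bar> * (cell_ind y * kernel M y)" for y
    by (simp add: cell_ind_def kernel_def prod.distrib prod.delta mult_ac)
  ultimately have *: "has_bochner_integral lborel (\<lambda>y::real ^ 'n. \<bar>y $ j\<bar> * (cell_ind y * kernel M y))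
      (\<integral>s. \<bar>s\<bar> * ?k s \<partial>lborel)"
    unfolding val by (simp add: prod.delta)
  then show "integrable lborel (\<lambda>y::real ^ 'n. \<bar>y $ j\<bar> * (cell_ind y * kernel M y))"
    unfolding has_bochner_integral_iff by blast
  show "(\<integral>y. \<bar>y $ j\<bar> * (cell_ind y * kernel M (y::real ^ 'n)) \<partial>lborel) \<le> \<eta> + 1 / (4 * \<eta> * (2 * real M + 2))"
    unfolding has_bochner_integral_integral_eq[OF *] by (rule cell_integral_abs(2)[OF assms])
qed

lemma integrable_wt_bound:
  fixes f :: "real ^ 'n::finite \<Rightarrow> complex"
  assumes "f \<in> borel_measurable borel" "\<And>y. cmod (f y) \<le> C * wt y"
  shows "integrable lborel f"
proof (rule Bochner_Integration.integrable_bound)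
  show "integrable lborel (\<lambda>y::real ^ 'n. C * wt y)" by (intro integrable_mult_right integrable_wt)
  show "f \<in> borel_measurable lborel" using assms(1) by simp
  show "AE y in lborel. cmod (f y) \<le> norm (C * wt y)"
    using assms(2) by (auto intro!: AE_I2 intro: order_trans abs_ge_self)
qed

text \<open>The integral of \<open>\<psi>\<close> against the periodic kernel is read in two ways.
  Expanded into characters it is a combination of Fourier coefficients with factors between 0 and 1,
  hence at most \<open>B\<close>. Cut along unit cells it is close to the lattice sum, because the
  kernel has mass 1 on each cell and concentrates at the lattice point. The constant
  \<open>C\<close> influences how close, but does not enter the bound.\<close>

lemma poisson_inequality:
  fixes \<psi> :: "real ^ 'n::finite \<Rightarrow> complex"
  assumes cont: "continuous_on UNIV \<psi>" and C: "C \<ge> 0"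
    and bound: "\<And>y. cmod (\<psi> y) \<le> C * wt y"
    and lip: "\<And>a x. (\<And>i. \<bar>x $ i\<bar> \<le> 1/2) \<Longrightarrow>
       cmod (\<psi> (int_vec a + x) - \<psi> (int_vec a)) \<le> C * wt (int_vec a) * (\<Sum>i\<in>UNIV. \<bar>x $ i\<bar>)"
    and B: "\<And>F. finite F \<Longrightarrow> (\<Sum>\<xi>\<in>F. cmod (fourier \<psi> \<xi>)) \<le> B"
    and \<epsilon>: "\<epsilon> > 0"
  shows "\<exists>N0. \<forall>N\<ge>N0. cmod (\<Sum>a\<in>lattice_box N. \<psi> (int_vec a)) \<le> B + \<epsilon>"
proof -
  obtain W where W: "W > 0" "\<And>F. finite F \<Longrightarrow> (\<Sum>a\<in>F. wt (int_vec (a :: int ^ 'n))) \<le> W"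
    using sum_wt_bounded by blast
  \<comment> \<open>With moments at most \<open>\<delta>\<close>, the errors of all cells add up to
    at most \<open>C * W * CARD('n) * \<delta>\<close>, which is to stay below
    \<open>\<epsilon> / 2\<close>.\<close>
  define \<delta> where "\<delta> = \<epsilon> / (2 * (C * W * CARD('n) + 1))"
  have den: "C * W * CARD('n) + 1 > 0" using C W(1) by (simp add: add_nonneg_pos)
  then have \<delta>: "\<delta> > 0" using \<epsilon> by (simp add: \<delta>_def)
  \<comment> \<open>\<open>M\<close> is so large that the moment bound with
    \<open>\<eta> = \<delta> / 2\<close> is at most \<open>\<delta>\<close>.\<close>
  obtain M :: nat where "1 / (4 * (\<delta> / 2) * (\<delta> / 2)) < real M"
    using reals_Archimedean2 by blast
  then have "1 / (4 * (\<delta> / 2)) \<le> (\<delta> / 2) * real M"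
    using \<delta> by (simp add: field_simps)
  also have "\<dots> \<le> (\<delta> / 2) * (2 * real M + 2)" using \<delta> by (intro mult_left_mono) auto
  finally have M: "1 / (4 * (\<delta> / 2) * (2 * real M + 2)) \<le> \<delta> / 2"
    using \<delta> by (simp add: field_simps add_pos_nonneg)
  have [measurable]: "\<psi> \<in> borel_measurable borel"
    using cont by (rule borel_measurable_continuous_onI)
  obtain D where D: "D \<ge> 0" "\<And>y::real ^ 'n. kernel M y \<le> D" using kernel_bounded by blast
  let ?K = "kernel M" and ?q = cell_ind
  let ?\<rho> = "\<lambda>N y. \<Sum>a\<in>lattice_box N. ?q (y - int_vec a)"
  have \<rho>: "0 \<le> ?\<rho> N y" "?\<rho> N y \<le> 1" for N and y :: "real ^ 'n" by (simp_all add: sum_cell_ind)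
  have K\<psi>: "cmod (complex_of_real (r * ?K y) * \<psi> y) \<le> (D * C) * wt y" if "0 \<le> r" "r \<le> 1" for r y
  proof -
    have "cmod (complex_of_real (r * ?K y) * \<psi> y) = (r * ?K y) * cmod (\<psi> y)"
      using that kernel_nonneg[of M y] by (simp add: norm_mult)
    also have "\<dots> \<le> (1 * D) * (C * wt y)"
      using that D kernel_nonneg[of M y] bound[of y] by (intro mult_mono) auto
    finally show ?thesis by simp
  qed
  have iK: "integrable lborel (\<lambda>y. complex_of_real (?\<rho> N y * ?K y) * \<psi> y)" for N
    by (rule integrable_wt_bound[OF _ K\<psi>[OF \<rho>]]) measurable
  have ichar: "integrable lborel (\<lambda>y. \<psi> y * lattice_char \<xi> y)" for \<xi>
  proof (rule integrable_wt_bound[where C = C])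
    have [measurable]: "lattice_char \<xi> \<in> borel_measurable borel"
      by (intro borel_measurable_continuous_onI continuous_lattice_char)
    show "(\<lambda>y. \<psi> y * lattice_char \<xi> y) \<in> borel_measurable borel" by measurable
    show "cmod (\<psi> y * lattice_char \<xi> y) \<le> C * wt y" for y using bound[of y] by (simp add: norm_mult)
  qed
  \<comment> \<open>The cells belonging to the cubes exhaust space, and each point is covered from
    some \<open>N\<close> on; \<open>wt\<close> provides the integrable majorant.\<close>
  have lim: "(\<lambda>N. \<integral>y. complex_of_real (?\<rho> N y * ?K y) * \<psi> y \<partial>lborel) \<longlonglongrightarrow>
      (\<integral>y. complex_of_real (?K y) * \<psi> y \<partial>lborel)"
  proof (rule integral_dominated_convergence)
    show "integrable lborel (\<lambda>y::real ^ 'n. (D * C) * wt y)" by (intro integrable_mult_right integrable_wt)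
    show "AE y in lborel. cmod (complex_of_real (?\<rho> N y * ?K y) * \<psi> y) \<le> (D * C) * wt y" for N
      by (intro AE_I2 K\<psi> \<rho>)
    show "AE y in lborel. (\<lambda>N. complex_of_real (?\<rho> N y * ?K y) * \<psi> y) \<longlonglongrightarrow> complex_of_real (?K y) * \<psi> y"
    proof (intro AE_I2 tendsto_eventually)
      fix y :: "real ^ 'n"
      let ?N = "nat (Max (range (\<lambda>i. \<bar>\<lfloor>y $ i + 1/2\<rfloor>\<bar>)))"
      have "?\<rho> N y = 1" if "N \<ge> ?N" for N
      proof -
        have "\<bar>\<lfloor>y $ i + 1/2\<rfloor>\<bar> \<le> int N" for i
        proof -
          have "\<bar>\<lfloor>y $ i + 1/2\<rfloor>\<bar> \<le> Max (range (\<lambda>i. \<bar>\<lfloor>y $ i + 1/2\<rfloor>\<bar>))" by (rule Max_ge) auto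
          with that show ?thesis by linarith
        qed
        then have "\<forall>i. \<lfloor>y $ i + 1/2\<rfloor> \<in> {- int N..int N}"
          unfolding atLeastAtMost_iff abs_le_iff by (simp add: minus_le_iff)
        then show ?thesis unfolding sum_cell_ind by (rule if_P)
      qed
      then show "\<forall>\<^sub>F N in sequentially. complex_of_real (?\<rho> N y * ?K y) * \<psi> y = complex_of_real (?K y) * \<psi> y"
        unfolding eventually_sequentially by (intro exI[of _ ?N] allI impI) simp
    qed
  qed measurable
  have total: "cmod (\<integral>y. complex_of_real (?K y) * \<psi> y \<partial>lborel) \<le> B"
  proof -
    let ?k = "\<lambda>\<xi>::int ^ 'n. \<Prod>i\<in>UNIV. kernel_coeff M (\<xi> $ i)"
    have k: "0 \<le> ?k \<xi>" "?k \<xi> \<le> 1" for \<xi>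
      by (auto intro!: prod_nonneg prod_le_1 simp: kernel_coeff_bounds)
    have "(\<lambda>y. complex_of_real (?K y) * \<psi> y) =
        (\<lambda>y. \<Sum>\<xi>\<in>lattice_box M. complex_of_real (?k \<xi>) * (\<psi> y * lattice_char \<xi> y))"
      unfolding kernel_eq by (simp add: sum_distrib_left mult_ac)
    then have "(\<integral>y. complex_of_real (?K y) * \<psi> y \<partial>lborel) =
        (\<Sum>\<xi>\<in>lattice_box M. complex_of_real (?k \<xi>) * fourier \<psi> \<xi>)"
      by (simp only: fourier_def Bochner_Integration.integral_sum[OF integrable_mult_right[OF ichar]]
          integral_mult_right_zero)
    then have "cmod (\<integral>y. complex_of_real (?K y) * \<psi> y \<partial>lborel) \<le>
        (\<Sum>\<xi>\<in>lattice_box M. cmod (complex_of_real (?k \<xi>) * fourier \<psi> \<xi>))"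
      by (simp only:) (rule norm_sum)
    also have "\<dots> \<le> (\<Sum>\<xi>\<in>lattice_box M. cmod (fourier \<psi> \<xi>))"
    proof (rule sum_mono)
      fix \<xi>
      have "cmod (complex_of_real (?k \<xi>) * fourier \<psi> \<xi>) = ?k \<xi> * cmod (fourier \<psi> \<xi>)"
        unfolding norm_mult norm_of_real using k by simp
      also have "\<dots> \<le> 1 * cmod (fourier \<psi> \<xi>)" using k by (intro mult_right_mono) auto
      finally show "cmod (complex_of_real (?k \<xi>) * fourier \<psi> \<xi>) \<le> cmod (fourier \<psi> \<xi>)" by simp
    qed
    also have "\<dots> \<le> B" by (rule B[OF finite_lattice_box])
    finally show ?thesis .
  qed
  have diff: "cmod ((\<Sum>a\<in>lattice_box N. \<psi> (int_vec a)) -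
      (\<integral>y. complex_of_real (?\<rho> N y * ?K y) * \<psi> y \<partial>lborel)) \<le> \<epsilon> / 2" for N
  proof -
    let ?g = "\<lambda>a x. complex_of_real (?q x * ?K x) * \<psi> (int_vec a + x)"
    have iq: "integrable lborel (\<lambda>x::real ^ 'n. complex_of_real (?q x * ?K x))"
      using cell_kernel_integral[of M, where 'n='n]
      by (intro integrable_of_real) (simp add: has_bochner_integral_iff)
    have ig0: "integrable lborel (\<lambda>y. complex_of_real (?q (y - int_vec a) * ?K y) * \<psi> y)" for a
      by (rule integrable_wt_bound[OF _ K\<psi>[OF cell_ind_nonneg cell_ind_le_1]]) measurable
    have gshift: "(\<lambda>x. complex_of_real (?q (int_vec a + x - int_vec a) * ?K (int_vec a + x)) * \<psi> (int_vec a + x)) = ?g a" for a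
      by (simp add: kernel_periodic)
    have ig: "integrable lborel (?g a)" for a
    proof -
      have "integrable (distr lborel borel ((+) (int_vec a))) (\<lambda>y. complex_of_real (?q (y - int_vec a) * ?K y) * \<psi> y)"
        unfolding lborel_distr_plus by (rule ig0)
      then show ?thesis
        by (subst (asm) integrable_distr_eq) (auto simp: kernel_periodic)
    qed
    have "(\<integral>y. complex_of_real (?\<rho> N y * ?K y) * \<psi> y \<partial>lborel) =
        (\<integral>y. (\<Sum>a\<in>lattice_box N. complex_of_real (?q (y - int_vec a) * ?K y) * \<psi> y) \<partial>lborel)"
      by (simp add: sum_distrib_right)
    also have "\<dots> = (\<Sum>a\<in>lattice_box N. \<integral>y. complex_of_real (?q (y - int_vec a) * ?K y) * \<psi> y \<partial>lborel)"
      by (intro Bochner_Integration.integral_sum ig0)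
    also have "\<dots> = (\<Sum>a\<in>lattice_box N. \<integral>x. ?g a x \<partial>lborel)"
    proof (rule sum.cong[OF refl])
      fix a
      show "(\<integral>y. complex_of_real (?q (y - int_vec a) * ?K y) * \<psi> y \<partial>lborel) = (\<integral>x. ?g a x \<partial>lborel)"
        unfolding gshift[symmetric] by (rule lborel_integral_translate[symmetric]) measurable
    qed
    finally have e1: "(\<integral>y. complex_of_real (?\<rho> N y * ?K y) * \<psi> y \<partial>lborel) = (\<Sum>a\<in>lattice_box N. \<integral>x. ?g a x \<partial>lborel)" .
    \<comment> \<open>\<open>\<psi> (int_vec a)\<close> is its own mean against this density, so the
      error is the mean of a difference, bounded by the Lipschitz hypothesis and the first moments
      in all coordinates.\<close>
    have one: "cmod (\<psi> (int_vec a) - (\<integral>x. ?g a x \<partial>lborel)) \<le> C * wt (int_vec a) * (CARD('n) * \<delta>)" for a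
    proof -
      let ?h = "\<lambda>x. complex_of_real (?q x * ?K x) * (\<psi> (int_vec a) - \<psi> (int_vec a + x))"
      let ?b = "\<lambda>x::real ^ 'n. \<Sum>i\<in>UNIV. (C * wt (int_vec a)) * (\<bar>x $ i\<bar> * (?q x * ?K x))"
      have heq: "?h = (\<lambda>x. complex_of_real (?q x * ?K x) * \<psi> (int_vec a) - ?g a x)"
        by (simp add: right_diff_distrib)
      have "(\<integral>x. complex_of_real (?q x * ?K x) \<partial>(lborel :: (real ^ 'n) measure)) = 1"
        using cell_kernel_integral[of M, where 'n='n]
        by (simp only: integral_complex_of_real has_bochner_integral_integral_eq of_real_1)
      then have "\<psi> (int_vec a) = (\<integral>x. complex_of_real (?q x * ?K x) * \<psi> (int_vec a) \<partial>(lborel :: (real ^ 'n) measure))"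
        by (simp only: integral_mult_left_zero mult_1)
      then have "\<psi> (int_vec a) - (\<integral>x. ?g a x \<partial>lborel) = (\<integral>x. ?h x \<partial>lborel)"
        unfolding heq by (subst Bochner_Integration.integral_diff[OF integrable_mult_left[OF iq] ig]) simp
      also have "cmod \<dots> \<le> (\<integral>x. ?b x \<partial>lborel)"
      proof (rule Bochner_Integration.integral_norm_bound_integral)
        show "integrable lborel ?h"
          unfolding heq by (intro Bochner_Integration.integrable_diff integrable_mult_left iq ig)
        show "integrable lborel ?b"
          using \<delta> by (intro Bochner_Integration.integrable_sum integrable_mult_right cell_kernel_moment(1)[of "\<delta> / 2"]) simp
        fix x :: "real ^ 'n"
        show "norm (?h x) \<le> ?b x"
        proof (cases "?q x = 0")
          case False
          have "norm (?h x) = (?q x * ?K x) * cmod (\<psi> (int_vec a + x) - \<psi> (int_vec a))"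
            unfolding norm_mult norm_of_real using cell_ind_nonneg[of x] kernel_nonneg[of M x]
            by (simp add: abs_mult norm_minus_commute)
          also have "\<dots> \<le> (?q x * ?K x) * (C * wt (int_vec a) * (\<Sum>i\<in>UNIV. \<bar>x $ i\<bar>))"
            using cell_ind_nonneg[of x] kernel_nonneg[of M x] cell_ind_nonzero[OF False]
            by (intro mult_left_mono lip) auto
          also have "\<dots> = ?b x" by (simp add: sum_distrib_left sum_distrib_right mult_ac)
          finally show ?thesis .
        qed simp
      qed
      also have "\<dots> = (\<Sum>i\<in>UNIV. (C * wt (int_vec a)) * (\<integral>x. \<bar>x $ i\<bar> * (?q x * ?K (x :: real ^ 'n)) \<partial>lborel))"
        using \<delta> cell_kernel_moment(1)[of "\<delta> / 2", where 'n='n]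
        by (subst Bochner_Integration.integral_sum) (auto intro!: integrable_mult_right)
      also have "\<dots> \<le> (\<Sum>i\<in>(UNIV :: 'n set). (C * wt (int_vec a)) * \<delta>)"
      proof (intro sum_mono mult_left_mono)
        fix i :: 'n
        have "(\<integral>x. \<bar>x $ i\<bar> * (?q x * ?K (x :: real ^ 'n)) \<partial>lborel) \<le> \<delta> / 2 + 1 / (4 * (\<delta> / 2) * (2 * real M + 2))"
          using \<delta> by (intro cell_kernel_moment(2)) simp
        also have "\<dots> \<le> \<delta>" using M by linarith
        finally show "(\<integral>x. \<bar>x $ i\<bar> * (?q x * ?K (x :: real ^ 'n)) \<partial>lborel) \<le> \<delta>" .
        show "0 \<le> C * wt (int_vec a)" by (intro mult_nonneg_nonneg C wt_nonneg)
      qed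
      finally show ?thesis by (simp add: mult_ac)
    qed
    have "cmod ((\<Sum>a\<in>lattice_box N. \<psi> (int_vec a)) - (\<Sum>a\<in>lattice_box N. \<integral>x. ?g a x \<partial>lborel)) \<le>
        (\<Sum>a\<in>(lattice_box N :: (int ^ 'n) set). C * wt (int_vec a) * (CARD('n) * \<delta>))"
      unfolding sum_subtractf[symmetric] by (intro sum_norm_le one)
    also have "\<dots> = (C * (CARD('n) * \<delta>)) * (\<Sum>a\<in>(lattice_box N :: (int ^ 'n) set). wt (int_vec a))"
      by (simp add: sum_distrib_left mult_ac)
    also have "\<dots> \<le> (C * (CARD('n) * \<delta>)) * W"
      using C \<delta> by (intro mult_left_mono W(2) finite_lattice_box) auto
    also have "\<dots> = (C * W * CARD('n)) * \<delta>" by simp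
    also have "\<dots> \<le> (C * W * CARD('n) + 1) * \<delta>" using \<delta> by (intro mult_right_mono) auto
    also have "\<dots> = \<epsilon> / 2"
    proof -
      have "k * (\<epsilon> / (2 * k)) = \<epsilon> / 2" if "k > 0" for k :: real using that by simp
      from this[OF den] show ?thesis unfolding \<delta>_def .
    qed
    finally show ?thesis unfolding e1 .
  qed
  have "\<forall>\<^sub>F N in sequentially. dist (\<integral>y. complex_of_real (?\<rho> N y * ?K y) * \<psi> y \<partial>lborel)
      (\<integral>y. complex_of_real (?K y) * \<psi> y \<partial>lborel) < \<epsilon> / 2"
    using \<epsilon> by (intro tendstoD[OF lim]) simp
  then obtain N0 where N0: "\<And>N. N \<ge> N0 \<Longrightarrow> cmod ((\<integral>y. complex_of_real (?\<rho> N y * ?K y) * \<psi> y \<partial>lborel) -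
      (\<integral>y. complex_of_real (?K y) * \<psi> y \<partial>lborel)) < \<epsilon> / 2"
    unfolding eventually_sequentially dist_norm by blast
  show ?thesis
  proof (intro exI[of _ N0] allI impI)
    fix N assume "N \<ge> N0"
    have tri: "cmod s \<le> B + \<epsilon>" if "cmod (s - i) \<le> \<epsilon> / 2" "cmod (i - t) < \<epsilon> / 2" "cmod t \<le> B" for s i t
      using norm_triangle_ineq[of "(s - i) + (i - t)" t] norm_triangle_ineq[of "s - i" "i - t"] that by simp
    show "cmod (\<Sum>a\<in>lattice_box N. \<psi> (int_vec a)) \<le> B + \<epsilon>"
      by (rule tri[OF diff N0[OF \<open>N \<ge> N0\<close>] total])
  qed
qed

section \<open>A priori estimates on the time axis\<close>

text \<open>A qualitative condition: it ensures limits at infinity and attained maxima, while its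
  constants never enter the estimates.\<close>

definition rapid :: "(real \<Rightarrow> complex) \<Rightarrow> bool" where
  "rapid g \<longleftrightarrow> (\<forall>m::nat. \<exists>C. \<forall>t. (1 + \<bar>t\<bar>) ^ m * cmod (g t) \<le> C)"

lemma rapid_tendsto_0:
  assumes "rapid g"
  shows "((\<lambda>t. (1 + \<bar>t\<bar>) ^ m * cmod (g t)) \<longlongrightarrow> 0) at_infinity"
proof -
  obtain C where C: "\<And>t. (1 + \<bar>t\<bar>) ^ Suc m * cmod (g t) \<le> C"
    using assms unfolding rapid_def by metis
  have "((\<lambda>t::real. C / (1 + \<bar>t\<bar>)) \<longlongrightarrow> 0) at_infinity"
  proof (rule tendsto_divide_0[OF tendsto_const])
    show "filterlim (\<lambda>t::real. 1 + \<bar>t\<bar>) at_infinity at_infinity"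
      by (rule filterlim_at_top_imp_at_infinity,
          rule filterlim_tendsto_add_at_top[OF tendsto_const])
        (use filterlim_norm_at_top[where 'a=real] in \<open>simp only: real_norm_def[abs_def]\<close>)
  qed
  then show ?thesis
  proof (rule Lim_null_comparison[rotated], intro always_eventually allI)
    fix t :: real
    show "norm ((1 + \<bar>t\<bar>) ^ m * cmod (g t)) \<le> C / (1 + \<bar>t\<bar>)"
      using C[of t] by (simp add: field_simps abs_mult)
  qed
qed

text \<open>The equation reads \<open>f = -g' - l g\<close>. The integrating factor
  \<open>exp (l t)\<close> has modulus 1, so \<open>g\<close> is recovered from \<open>f\<close> by
  integration from infinity, where \<open>g\<close> vanishes.\<close>

lemma decay_oscillating_right:
  fixes g f :: "real \<Rightarrow> complex"
  assumes g: "\<And>t. (g has_vector_derivative - l * g t - f t) (at t)" and l: "Re l = 0"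
    and rapid: "rapid g"
    and f: "\<And>t. (1 + \<bar>t\<bar>) ^ (k + 2) * cmod (f t) \<le> B" and t: "t \<ge> 0"
  shows "(1 + t) ^ k * cmod (g t) \<le> B"
proof -
  have B: "B \<ge> 0" using order_trans[OF norm_ge_zero[of "f 0"]] f[of 0] by simp
  define G where "G s = exp (l * complex_of_real s) * g s" for s
  have ncis: "cmod (exp (l * complex_of_real s)) = 1" for s using l by simp
  have nG: "cmod (G s) = cmod (g s)" for s
    unfolding G_def by (simp only: norm_mult ncis mult_1)
  have G: "(G has_vector_derivative - exp (l * complex_of_real s) * f s) (at s)" for s
  proof -
    have "((\<lambda>s. exp (l * complex_of_real s)) has_vector_derivative l * exp (l * complex_of_real s)) (at s)"
      by (rule has_vector_derivative_real_field) (auto intro!: derivative_eq_intros)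
    from has_vector_derivative_mult[OF this g]
    show ?thesis unfolding G_def by (simp add: algebra_simps)
  qed
  \<comment> \<open>An increasing function whose derivative dominates \<open>\<bar>f\<bar>\<close>.
    Comparing \<open>G\<close> with it by the mean value inequality stands in for an integral over
    the half line.\<close>
  let ?\<phi> = "\<lambda>s. - B * inverse (1 + s) ^ (k + 1)"
  have \<phi>: "(?\<phi> has_vector_derivative (B * (k + 1) * inverse (1 + s) ^ (k + 2))) (at s)" if "s \<ge> 0" for s
  proof -
    have "(?\<phi> has_real_derivative (B * (k + 1) * inverse (1 + s) ^ (k + 2))) (at s)"
    proof -
      have "((\<lambda>s. inverse (1 + s)) has_real_derivative - (inverse (1 + s) * inverse (1 + s))) (at s)"
        using that by (auto intro!: derivative_eq_intros)
      from DERIV_cmult[OF DERIV_power_Suc[OF this, of k], of "- B"] show ?thesis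
        by (simp add: mult_ac add.commute)
    qed
    then show ?thesis by (simp add: has_real_derivative_iff_has_vector_derivative)
  qed
  have "cmod (G t) \<le> cmod (G s) + B * inverse (1 + t) ^ (k + 1)" if s: "s > t" for s
  proof -
    have "cmod (G s - G t) \<le> ?\<phi> s - ?\<phi> t"
    proof (rule differentiable_bound_general[OF s])
      show "continuous_on {t..s} G"
        by (intro continuous_at_imp_continuous_on ballI) (rule has_vector_derivative_continuous[OF G])
      show "continuous_on {t..s} ?\<phi>"
        using t by (intro continuous_at_imp_continuous_on ballI has_vector_derivative_continuous[OF \<phi>]) auto
      fix x assume x: "t < x" "x < s"
      show "(G has_vector_derivative - exp (l * complex_of_real x) * f x) (at x)" by (rule G)
      show "(?\<phi> has_vector_derivative (B * (k + 1) * inverse (1 + x) ^ (k + 2))) (at x)"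
        using x t by (intro \<phi>) auto
      have "cmod (f x) \<le> B * inverse (1 + x) ^ (k + 2)"
        using f[of x] x t
        unfolding power_inverse divide_inverse[symmetric] by (subst pos_le_divide_eq) (auto simp: mult.commute)
      also have "\<dots> \<le> B * (k + 1) * inverse (1 + x) ^ (k + 2)"
        using mult_left_mono[OF _ B, of 1 "1 + real k"] x t by (intro mult_right_mono) auto
      finally show "cmod (- exp (l * complex_of_real x) * f x) \<le> B * (k + 1) * inverse (1 + x) ^ (k + 2)"
        by (simp only: mult_minus_left norm_minus_cancel norm_mult ncis mult_1)
    qed
    moreover have "?\<phi> s \<le> 0" using B s t by simp
    ultimately show ?thesis using norm_triangle_ineq2[of "G t" "G s"] by (simp add: norm_minus_commute)
  qed
  moreover have "((\<lambda>s. cmod (G s)) \<longlongrightarrow> 0) at_top"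
  proof -
    have "((\<lambda>s. cmod (G s)) \<longlongrightarrow> 0) at_infinity"
      using rapid_tendsto_0[OF rapid, of 0] by (simp add: nG)
    then show ?thesis by (rule tendsto_mono[OF at_top_le_at_infinity])
  qed
  then have "((\<lambda>s. cmod (G s) + B * inverse (1 + t) ^ (k + 1)) \<longlongrightarrow> 0 + B * inverse (1 + t) ^ (k + 1)) at_top"
    by (intro tendsto_add tendsto_const)
  ultimately have "cmod (G t) \<le> 0 + B * inverse (1 + t) ^ (k + 1)"
    by (intro tendsto_lowerbound[where F = at_top])
       (auto intro: eventually_mono[OF eventually_gt_at_top])
  then have "cmod (g t) \<le> B * inverse (1 + t) ^ (k + 1)" by (simp add: nG)
  then have "(1 + t) * ((1 + t) ^ k * cmod (g t)) \<le> B"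
    using t unfolding power_inverse divide_inverse[symmetric]
    by (subst (asm) pos_le_divide_eq) (auto simp: mult_ac)
  moreover have "1 * ((1 + t) ^ k * cmod (g t)) \<le> (1 + t) * ((1 + t) ^ k * cmod (g t))"
    using t by (intro mult_right_mono) auto
  ultimately show ?thesis by simp
qed

lemma decay_oscillating:
  fixes g f :: "real \<Rightarrow> complex"
  assumes g: "\<And>t. (g has_vector_derivative - l * g t - f t) (at t)" and l: "Re l = 0"
    and rapid: "rapid g"
    and f: "\<And>t. (1 + \<bar>t\<bar>) ^ (k + 2) * cmod (f t) \<le> B"
  shows "(1 + \<bar>t\<bar>) ^ k * cmod (g t) \<le> B"
proof (cases "t \<ge> 0")
  case True
  then show ?thesis using decay_oscillating_right[OF g l rapid f True] by simp
next
  case False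
  \<comment> \<open>Time reversal maps the left half line to the right one; the equation keeps its
    form with \<open>l\<close> negated and \<open>f\<close> reflected and negated.\<close>
  have g': "((\<lambda>t. g (- t)) has_vector_derivative - (- l) * g (- s) - (- f (- s))) (at s)" for s
  proof -
    have "(uminus has_vector_derivative - 1) (at s)"
      by (auto intro!: derivative_eq_intros simp: has_real_derivative_iff_has_vector_derivative[symmetric])
    from vector_diff_chain_at[OF this g] show ?thesis by (simp add: comp_def add.commute)
  qed
  have r': "rapid (\<lambda>t. g (- t))"
    using rapid unfolding rapid_def by (metis abs_minus_cancel)
  have f': "(1 + \<bar>s\<bar>) ^ (k + 2) * cmod (- f (- s)) \<le> B" for s
    using f[of "- s"] by simp
  have "Re (- l) = 0" "- t \<ge> 0" using l False by simp_all
  from decay_oscillating_right[OF g' this(1) r' f' this(2)]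
  have "(1 + (- t)) ^ k * cmod (g (- (- t))) \<le> B" .
  then show ?thesis using False by simp
qed

text \<open>At a maximum of \<open>(1 + \<epsilon>\<^sup>2 t\<^sup>2)\<^sup>k |g|\<^sup>2\<close> its derivative vanishes, and \<open>\<epsilon>\<close> is so small that the
  derivative of the weight absorbs at most half of \<open>|Re l|\<close>.\<close>

lemma decay_hyperbolic:
  fixes g f :: "real \<Rightarrow> complex"
  assumes g: "\<And>t. (g has_vector_derivative - l * g t - f t) (at t)"
    and D: "D \<ge> 1" and l: "\<bar>Re l\<bar> \<ge> 1 / D"
    and rapid: "rapid g"
    and f: "\<And>t. (1 + \<bar>t\<bar>) ^ k * cmod (f t) \<le> B"
  shows "(1 + \<bar>t\<bar>) ^ k * cmod (g t) \<le> 2 ^ (k + 1) * real (k + 1) ^ k * D ^ (k + 1) * B"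
proof -
  have B: "B \<ge> 0" using order_trans[OF norm_ge_zero[of "f 0"]] f[of 0] by simp
  \<comment> \<open>The weight \<open>w\<close> satisfies
    \<open>\<bar>w'\<bar> \<le> \<epsilon> w\<close>, so \<open>w^k\<close> contributes at most
    \<open>k \<epsilon> < 1/D\<close> to the logarithmic derivative, against
    \<open>2 \<bar>Re l\<bar> \<ge> 2/D\<close> from the equation.\<close>
  define \<epsilon> where "\<epsilon> = 1 / (D * (k + 1))"
  have D1: "D * (real k + 1) \<ge> 1" using mult_mono[of 1 D 1 "real k + 1"] D by simp
  have \<epsilon>: "0 < \<epsilon>" "\<epsilon> \<le> 1" using D1 D by (simp_all add: \<epsilon>_def add.commute)
  define w where "w s = 1 + \<epsilon>\<^sup>2 * s\<^sup>2" for s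
  have w1: "w s \<ge> 1" for s by (simp add: w_def)
  have wle: "w s \<le> (1 + \<bar>s\<bar>)\<^sup>2" for s
  proof -
    have "\<epsilon>\<^sup>2 * s\<^sup>2 \<le> 1 * s\<^sup>2" using \<epsilon> by (intro mult_right_mono) (simp_all add: power_le_one)
    then have "w s \<le> 1 + \<bar>s\<bar>\<^sup>2" by (simp add: w_def)
    also have "\<dots> \<le> (1 + \<bar>s\<bar>)\<^sup>2" unfolding power2_sum by simp
    finally show ?thesis .
  qed
  have wge: "\<epsilon>\<^sup>2 * (1 + \<bar>s\<bar>)\<^sup>2 \<le> 2 * w s" for s
  proof -
    have "(1 + \<bar>s\<bar>)\<^sup>2 \<le> 2 * (1 + s\<^sup>2)"
      using sum_squares_bound[of 1 "\<bar>s\<bar>"] by (simp add: power2_sum)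
    then have "\<epsilon>\<^sup>2 * (1 + \<bar>s\<bar>)\<^sup>2 \<le> \<epsilon>\<^sup>2 * (2 * (1 + s\<^sup>2))" by (intro mult_left_mono) auto
    also have "\<dots> \<le> 2 * w s" using \<epsilon> by (simp add: w_def algebra_simps power_le_one)
    finally show ?thesis .
  qed
  define F where "F s = w s ^ k * (g s \<bullet> g s)" for s
  have Fnn: "F s \<ge> 0" for s unfolding F_def using w1[of s] by simp
  have F': "(F has_real_derivative
      k * w s ^ (k - 1) * (\<epsilon>\<^sup>2 * (2 * s)) * (g s \<bullet> g s) + w s ^ k * (2 * (g s \<bullet> (- l * g s - f s)))) (at s)" for s
  proof -
    have "((\<lambda>s. g s \<bullet> g s) has_vector_derivative g s \<bullet> (- l * g s - f s) + (- l * g s - f s) \<bullet> g s) (at s)"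
      using has_derivative_inner[OF g[of s, unfolded has_vector_derivative_def] g[of s, unfolded has_vector_derivative_def]]
      unfolding has_vector_derivative_def by (simp add: algebra_simps)
    then have "((\<lambda>s. g s \<bullet> g s) has_real_derivative 2 * (g s \<bullet> (- l * g s - f s))) (at s)"
      by (simp add: has_real_derivative_iff_has_vector_derivative inner_commute)
    moreover have "((\<lambda>s. w s ^ k) has_real_derivative k * w s ^ (k - 1) * (\<epsilon>\<^sup>2 * (2 * s))) (at s)"
      unfolding w_def by (auto intro!: derivative_eq_intros)
    ultimately show ?thesis
      unfolding F_def by (intro DERIV_cong[OF DERIV_mult]) (assumption+, simp only: mult_ac)
  qed
  have Flim: "(F \<longlongrightarrow> 0) at_infinity"
  proof (rule Lim_null_comparison)
    have "((\<lambda>t. ((1 + \<bar>t\<bar>) ^ k * cmod (g t))\<^sup>2) \<longlongrightarrow> 0\<^sup>2) at_infinity"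
      by (intro tendsto_power rapid_tendsto_0 rapid)
    then show "((\<lambda>t. ((1 + \<bar>t\<bar>) ^ k * cmod (g t))\<^sup>2) \<longlongrightarrow> 0) at_infinity" by simp
    show "\<forall>\<^sub>F s in at_infinity. norm (F s) \<le> ((1 + \<bar>s\<bar>) ^ k * cmod (g s))\<^sup>2"
    proof (intro always_eventually allI)
      fix s
      have "norm (F s) = w s ^ k * (cmod (g s))\<^sup>2"
        using Fnn[of s] by (simp add: F_def power2_norm_eq_inner)
      also have "\<dots> \<le> ((1 + \<bar>s\<bar>)\<^sup>2) ^ k * (cmod (g s))\<^sup>2"
        using wle[of s] w1[of s] by (intro mult_right_mono power_mono) auto
      finally show "norm (F s) \<le> ((1 + \<bar>s\<bar>) ^ k * cmod (g s))\<^sup>2"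
        by (simp add: power_mult_distrib power_mult[symmetric] mult.commute)
    qed
  qed
  have F_le: "F s \<le> 4 * D\<^sup>2 * B\<^sup>2" for s
  proof (rule ccontr)
    assume neg: "\<not> ?thesis"
    then have pos: "F s > 0" using Fnn[of s] B by (meson le_less_trans mult_nonneg_nonneg not_le zero_le_numeral zero_le_power2)
    \<comment> \<open>Outside \<open>[-R, R]\<close> the function \<open>F\<close> stays below
      \<open>F s\<close>, so a maximum over the compact interval is a global one.\<close>
    obtain R where R: "\<And>u. \<bar>u\<bar> \<ge> R \<Longrightarrow> F u < F s"
    proof -
      have "\<forall>\<^sub>F u in at_infinity. dist (F u) 0 < F s" using Flim pos by (rule tendstoD)
      then show ?thesis using that unfolding eventually_at_infinity by (auto simp: dist_norm) (metis abs_less_iff)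
    qed
    then have Rs: "\<bar>s\<bar> < R" by (meson less_irrefl not_le)
    have "continuous_on {-R..R} F"
      by (intro continuous_at_imp_continuous_on ballI DERIV_isCont[OF F'])
    then obtain u where u: "u \<in> {-R..R}" "\<And>v. v \<in> {-R..R} \<Longrightarrow> F v \<le> F u"
      using continuous_attains_sup[of "{-R..R}" F] Rs by fastforce
    have Fsu: "F s \<le> F u" using Rs by (intro u(2)) auto
    have max: "F v \<le> F u" for v
    proof (cases "\<bar>v\<bar> \<ge> R")
      case True
      then show ?thesis using R[OF True] Fsu by simp
    next
      case False
      then show ?thesis by (intro u(2)) (simp add: abs_if split: if_splits)
    qed
    have "k * w u ^ (k - 1) * (\<epsilon>\<^sup>2 * (2 * u)) * (g u \<bullet> g u) + w u ^ k * (2 * (g u \<bullet> (- l * g u - f u))) = 0"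
      by (rule DERIV_local_max[OF F', of 1]) (auto intro: max)
    moreover have "g u \<bullet> (- l * g u - f u) = - Re l * (g u \<bullet> g u) - g u \<bullet> f u"
      by (simp add: inner_complex_def algebra_simps)
    ultimately have e: "2 * Re l * (w u ^ k * (g u \<bullet> g u)) =
        k * w u ^ (k - 1) * (\<epsilon>\<^sup>2 * (2 * u)) * (g u \<bullet> g u) - 2 * (w u ^ k * (g u \<bullet> f u))"
      by (simp add: algebra_simps)
    have b1: "\<bar>k * w u ^ (k - 1) * (\<epsilon>\<^sup>2 * (2 * u)) * (g u \<bullet> g u)\<bar> \<le> (1 / D) * (w u ^ k * (g u \<bullet> g u))"
    proof (cases k)
      case 0
      then show ?thesis using D by simp
    next
      case (Suc j)
      have "2 * \<epsilon> * \<bar>u\<bar> \<le> w u"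
        using sum_squares_bound[of 1 "\<epsilon> * \<bar>u\<bar>"] by (simp add: w_def power_mult_distrib)
      then have "\<epsilon> * (2 * \<epsilon> * \<bar>u\<bar>) \<le> \<epsilon> * w u" using \<epsilon> by (intro mult_left_mono) auto
      then have "\<bar>\<epsilon>\<^sup>2 * (2 * u)\<bar> \<le> \<epsilon> * w u" using \<epsilon> by (simp add: power2_eq_square abs_mult mult_ac)
      then have "real k * \<bar>\<epsilon>\<^sup>2 * (2 * u)\<bar> \<le> real k * (\<epsilon> * w u)" by (rule mult_left_mono) simp
      also have "\<dots> = (real k * \<epsilon>) * w u" by simp
      also have "real k * \<epsilon> = (real k / (real k + 1)) * (1 / D)"
        by (simp add: \<epsilon>_def add.commute)
      also have "(real k / (real k + 1)) * (1 / D) * w u \<le> 1 * (1 / D) * w u"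
        using w1[of u] D by (intro mult_right_mono) auto
      also have "\<dots> = (1 / D) * w u" by simp
      finally have "(w u ^ j * (g u \<bullet> g u)) * (real k * \<bar>\<epsilon>\<^sup>2 * (2 * u)\<bar>) \<le> (w u ^ j * (g u \<bullet> g u)) * ((1 / D) * w u)"
        using w1[of u] by (intro mult_left_mono) auto
      then show ?thesis using w1[of u] by (simp add: Suc abs_mult mult_ac)
    qed
    have wp: "w u ^ k > 0" using w1[of u] by (simp add: less_le_trans[OF zero_less_one])
    have gu: "cmod (g u) > 0" using pos Fsu by (auto simp: F_def)
    have b2: "\<bar>g u \<bullet> f u\<bar> \<le> cmod (g u) * cmod (f u)" by (rule Cauchy_Schwarz_ineq2)
    have "2 * \<bar>Re l\<bar> * (w u ^ k * (g u \<bullet> g u)) = \<bar>2 * Re l * (w u ^ k * (g u \<bullet> g u))\<bar>"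
      using wp by (simp add: abs_mult)
    also have "\<dots> \<le> (1 / D) * (w u ^ k * (g u \<bullet> g u)) + 2 * (w u ^ k * (cmod (g u) * cmod (f u)))"
    proof -
      have "\<bar>2 * (w u ^ k * (g u \<bullet> f u))\<bar> \<le> 2 * (w u ^ k * (cmod (g u) * cmod (f u)))"
        using b2 wp by (simp add: abs_mult)
      with b1 show ?thesis unfolding e by linarith
    qed
    finally have "2 * \<bar>Re l\<bar> * (w u ^ k * (g u \<bullet> g u)) \<le>
      (1 / D) * (w u ^ k * (g u \<bullet> g u)) + 2 * (w u ^ k * (cmod (g u) * cmod (f u)))" .
    moreover have "2 * (1 / D) * (w u ^ k * (g u \<bullet> g u)) \<le> 2 * \<bar>Re l\<bar> * (w u ^ k * (g u \<bullet> g u))"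
      using l wp by (intro mult_right_mono) auto
    ultimately have "(1 / D) * (w u ^ k * (g u \<bullet> g u)) \<le> 2 * (w u ^ k * (cmod (g u) * cmod (f u)))"
      by linarith
    then have "(w u ^ k * cmod (g u)) * cmod (g u) \<le> (w u ^ k * cmod (g u)) * (2 * D * cmod (f u))"
      using D by (simp add: power2_norm_eq_inner[symmetric] power2_eq_square field_simps)
    then have gf: "cmod (g u) \<le> 2 * D * cmod (f u)"
      using wp gu by (subst (asm) mult_le_cancel_left_pos) auto
    have "F u = w u ^ k * (cmod (g u))\<^sup>2" by (simp add: F_def power2_norm_eq_inner)
    also have "\<dots> \<le> ((1 + \<bar>u\<bar>)\<^sup>2) ^ k * (2 * D * cmod (f u))\<^sup>2"
      using wle[of u] w1[of u] gf by (intro mult_mono power_mono) auto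
    also have "\<dots> = 4 * D\<^sup>2 * ((1 + \<bar>u\<bar>) ^ k * cmod (f u))\<^sup>2"
      by (simp add: power_mult_distrib power_mult[symmetric] mult_ac)
    also have "\<dots> \<le> 4 * D\<^sup>2 * B\<^sup>2"
      using f[of u] by (intro mult_left_mono power_mono) auto
    finally show False using neg Fsu by linarith
  qed
  \<comment> \<open>Returning from \<open>w\<close> to \<open>(1 + \<bar>t\<bar>)^2\<close> costs a
    factor \<open>2 / \<epsilon>^2\<close>; this is the origin of \<open>(k + 1)^k\<close> and of
    \<open>k\<close> of the powers of \<open>D\<close>.\<close>
  have "(\<epsilon> ^ k * ((1 + \<bar>t\<bar>) ^ k * cmod (g t)))\<^sup>2 = (\<epsilon>\<^sup>2 * (1 + \<bar>t\<bar>)\<^sup>2) ^ k * (cmod (g t))\<^sup>2"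
    by (simp add: power_mult_distrib power_mult[symmetric] mult_ac)
  also have "\<dots> \<le> (2 * w t) ^ k * (cmod (g t))\<^sup>2"
    using wge[of t] by (intro mult_right_mono power_mono) auto
  also have "\<dots> = 2 ^ k * F t" by (simp add: F_def power_mult_distrib power2_norm_eq_inner)
  also have "\<dots> \<le> 2 ^ k * (4 * D\<^sup>2 * B\<^sup>2)" by (intro mult_left_mono F_le) auto
  also have "\<dots> \<le> (2 ^ k)\<^sup>2 * (4 * D\<^sup>2 * B\<^sup>2)"
    by (intro mult_right_mono) (auto simp: power2_eq_square)
  also have "\<dots> = (2 ^ k * (2 * D * B))\<^sup>2" by (simp add: power_mult_distrib)
  finally have "\<epsilon> ^ k * ((1 + \<bar>t\<bar>) ^ k * cmod (g t)) \<le> 2 ^ k * (2 * D * B)"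
    by (rule power2_le_imp_le) (use D B in auto)
  then have "(1 + \<bar>t\<bar>) ^ k * cmod (g t) \<le> (2 ^ k * (2 * D * B)) * inverse (\<epsilon> ^ k)"
    using \<epsilon>(1) by (simp add: field_simps)
  also have "inverse (\<epsilon> ^ k) = (D * (k + 1)) ^ k" by (simp add: \<epsilon>_def power_divide power_inverse)
  finally show ?thesis by (simp add: power_mult_distrib mult_ac)
qed

text \<open>Both kinds of roots under one bound with the losses of both: two powers of the time
  weight from imaginary roots, \<open>D ^ (k + 1)\<close> from the others. Factors can then be
  removed without knowing their kind.\<close>

lemma decay_step:
  fixes g f :: "real \<Rightarrow> complex"
  assumes g: "\<And>t. (g has_vector_derivative - l * g t - f t) (at t)"
    and D: "D \<ge> 1" and l: "Re l = 0 \<or> \<bar>Re l\<bar> \<ge> 1 / D"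
    and rapid: "rapid g"
    and f: "\<And>t. (1 + \<bar>t\<bar>) ^ (k + 2) * cmod (f t) \<le> B"
  shows "(1 + \<bar>t\<bar>) ^ k * cmod (g t) \<le> (2 ^ (k + 1) * real (k + 1) ^ k) * D ^ (k + 1) * B"
  using l
proof
  assume "Re l = 0"
  then have "(1 + \<bar>t\<bar>) ^ k * cmod (g t) \<le> B" by (rule decay_oscillating[OF g _ rapid f])
  moreover have "B \<ge> 0" using order_trans[OF norm_ge_zero[of "f 0"]] f[of 0] by simp
  moreover have "(1::real) \<le> 2 ^ (k + 1) * real (k + 1) ^ k"
    using mult_mono[OF one_le_power[of 2 "k + 1"] one_le_power[of "real (k + 1)" k]] by simp
  then have "1 \<le> (2 ^ (k + 1) * real (k + 1) ^ k) * D ^ (k + 1)"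
    using mult_mono[OF _ one_le_power[OF D, of "k + 1"]] by force
  ultimately show ?thesis using mult_right_mono by fastforce
next
  assume *: "\<bar>Re l\<bar> \<ge> 1 / D"
  have "(1 + \<bar>s\<bar>) ^ k * cmod (f s) \<le> B" for s
  proof -
    have "(1 + \<bar>s\<bar>) ^ k * cmod (f s) \<le> (1 + \<bar>s\<bar>) ^ (k + 2) * cmod (f s)"
      by (intro mult_right_mono power_increasing) auto
    then show ?thesis using f[of s] by linarith
  qed
  from decay_hyperbolic[OF g D * rapid this] show ?thesis by simp
qed

text \<open>\<open>g i\<close> plays the role of \<open>(-\<partial>\<^sub>t)\<^sup>i g\<close>.\<close>

definition deriv_chain :: "(nat \<Rightarrow> real \<Rightarrow> complex) \<Rightarrow> bool" where
  "deriv_chain g \<longleftrightarrow> (\<forall>i t. (g i has_vector_derivative - g (Suc i) t) (at t)) \<and> (\<forall>i. rapid (g i))"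

text \<open>The operator \<open>q (-d/dt)\<close> applied to the member \<open>i\<close> of the
  chain; multiplication of polynomials becomes composition of operators.\<close>

definition poly_op :: "complex poly \<Rightarrow> (nat \<Rightarrow> real \<Rightarrow> complex) \<Rightarrow> nat \<Rightarrow> real \<Rightarrow> complex" where
  "poly_op q g i t = (\<Sum>j\<le>degree q. coeff q j * g (i + j) t)"

lemma poly_op_eq: "degree q \<le> n \<Longrightarrow> poly_op q g i t = (\<Sum>j\<le>n. coeff q j * g (i + j) t)"
  unfolding poly_op_def by (rule sum.mono_neutral_left) (auto simp: coeff_eq_0)

lemma poly_op_linear_factor:
  "poly_op ([:- l, 1:] * q) g i t = poly_op q g (Suc i) t - l * poly_op q g i t"
proof -
  let ?n = "Suc (degree q)"
  have d: "degree ([:- l, 1:] * q) \<le> ?n"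
    using degree_mult_le[of "[:- l, 1:]" q] by simp
  have c: "coeff ([:- l, 1:] * q) j = (case j of 0 \<Rightarrow> 0 | Suc i \<Rightarrow> coeff q i) - l * coeff q j" for j
    by (cases j) simp_all
  have "poly_op ([:- l, 1:] * q) g i t =
      (\<Sum>j\<le>?n. (case j of 0 \<Rightarrow> 0 | Suc i \<Rightarrow> coeff q i) * g (i + j) t) -
      (\<Sum>j\<le>?n. l * coeff q j * g (i + j) t)"
    unfolding poly_op_eq[OF d] c by (simp add: left_diff_distrib sum_subtractf)
  also have "(\<Sum>j\<le>?n. (case j of 0 \<Rightarrow> 0 | Suc i \<Rightarrow> coeff q i) * g (i + j) t) = poly_op q g (Suc i) t"
    by (subst sum.atMost_Suc_shift) (simp add: poly_op_def)
  also have "(\<Sum>j\<le>?n. l * coeff q j * g (i + j) t) = l * poly_op q g i t"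
    by (simp add: poly_op_eq[of q ?n] sum_distrib_left mult.assoc del: sum.atMost_Suc)
  finally show ?thesis .
qed

lemma rapid_0: "rapid (\<lambda>t. 0)"
  unfolding rapid_def by auto

lemma rapid_add:
  assumes "rapid f" "rapid g" shows "rapid (\<lambda>t. f t + g t)"
  unfolding rapid_def
proof
  fix m
  obtain C where C: "\<And>t. (1 + \<bar>t\<bar>) ^ m * cmod (f t) \<le> C"
    using assms(1) unfolding rapid_def by metis
  obtain C' where C': "\<And>t. (1 + \<bar>t\<bar>) ^ m * cmod (g t) \<le> C'"
    using assms(2) unfolding rapid_def by metis
  have "(1 + \<bar>t\<bar>) ^ m * cmod (f t + g t) \<le> C + C'" for t
  proof -
    have "(1 + \<bar>t\<bar>) ^ m * cmod (f t + g t) \<le> (1 + \<bar>t\<bar>) ^ m * (cmod (f t) + cmod (g t))"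
      by (intro mult_left_mono norm_triangle_ineq) auto
    then show ?thesis using C[of t] C'[of t] unfolding distrib_left by linarith
  qed
  then show "\<exists>C. \<forall>t. (1 + \<bar>t\<bar>) ^ m * cmod (f t + g t) \<le> C" by blast
qed

lemma rapid_cmult:
  assumes "rapid f" shows "rapid (\<lambda>t. c * f t)"
  unfolding rapid_def
proof
  fix m
  obtain C where C: "\<And>t. (1 + \<bar>t\<bar>) ^ m * cmod (f t) \<le> C"
    using assms(1) unfolding rapid_def by metis
  have "(1 + \<bar>t\<bar>) ^ m * cmod (c * f t) \<le> cmod c * C" for t
    using mult_left_mono[OF C, of "cmod c" t] by (simp add: norm_mult mult_ac)
  then show "\<exists>C. \<forall>t. (1 + \<bar>t\<bar>) ^ m * cmod (c * f t) \<le> C" by blast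
qed

lemma deriv_chain_poly_op:
  assumes "deriv_chain g"
  shows "deriv_chain (poly_op q g)"
proof -
  have g: "(g i has_vector_derivative - g (Suc i) t) (at t)" "rapid (g i)" for i t
    using assms by (auto simp: deriv_chain_def)
  have "rapid (\<lambda>t. \<Sum>j\<in>J. coeff q j * g (i + j) t)" if "finite J" for i J
    using that by (induction J) (auto intro!: rapid_0 rapid_add rapid_cmult g)
  moreover have "((\<lambda>t. \<Sum>j\<le>degree q. coeff q j * g (i + j) t) has_vector_derivative
      (\<Sum>j\<le>degree q. coeff q j * (- g (Suc (i + j)) t))) (at t)" for i t
    by (intro has_vector_derivative_sum has_vector_derivative_mult_right g)
  ultimately show ?thesis
    unfolding deriv_chain_def poly_op_def[abs_def] by (simp add: sum_negf)
qed

text \<open>The factors are removed one at a time. \<open>K\<close> and \<open>e\<close> depend only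
  on \<open>m\<close> and \<open>k\<close>, not on the roots, the function or the level
  \<open>i\<close>, so they can be used for all frequencies together.\<close>

lemma decay_product:
  "\<exists>K\<ge>0. \<exists>e. \<forall>(D::real) l g i B. D \<ge> 1 \<longrightarrow>
     (\<forall>j\<in>{1..m}. Re (l j) = 0 \<or> \<bar>Re (l j)\<bar> \<ge> 1 / D) \<longrightarrow> deriv_chain g \<longrightarrow>
     (\<forall>t. (1 + \<bar>t\<bar>) ^ (k + 2 * m) * cmod (poly_op (\<Prod>j\<in>{1..m}. [:- l j, 1:]) g i t) \<le> B) \<longrightarrow>
     (\<forall>t. (1 + \<bar>t\<bar>) ^ k * cmod (g i t) \<le> K * D ^ e * B)"
proof (induction m)
  case 0
  show ?case by (intro exI[of _ 1] conjI exI[of _ 0]) (simp_all add: poly_op_def)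
next
  case (Suc m)
  then obtain K e where K: "K \<ge> 0" "\<And>(D::real) l g i B t. D \<ge> 1 \<Longrightarrow>
     (\<forall>j\<in>{1..m}. Re (l j) = 0 \<or> \<bar>Re (l j)\<bar> \<ge> 1 / D) \<Longrightarrow> deriv_chain g \<Longrightarrow>
     (\<forall>t. (1 + \<bar>t\<bar>) ^ (k + 2 * m) * cmod (poly_op (\<Prod>j\<in>{1..m}. [:- l j, 1:]) g i t) \<le> B) \<Longrightarrow>
     (1 + \<bar>t\<bar>) ^ k * cmod (g i t) \<le> K * D ^ e * B"
    by blast
  let ?k = "k + 2 * m"
  let ?K = "2 ^ (?k + 1) * real (?k + 1) ^ ?k"
  show ?case
  proof (intro exI[of _ "K * ?K"] conjI exI[of _ "e + (?k + 1)"] allI impI)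
    show "0 \<le> K * ?K" using K(1) by simp
    fix D :: real and l g i B t
    assume D: "D \<ge> 1" and l: "\<forall>j\<in>{1..Suc m}. Re (l j) = 0 \<or> \<bar>Re (l j)\<bar> \<ge> 1 / D"
      and g: "deriv_chain g"
      and B: "\<forall>t. (1 + \<bar>t\<bar>) ^ (k + 2 * Suc m) *
        cmod (poly_op (\<Prod>j\<in>{1..Suc m}. [:- l j, 1:]) g i t) \<le> B"
    let ?h = "poly_op (\<Prod>j\<in>{1..m}. [:- l j, 1:]) g"
    let ?f = "\<lambda>t. ?h (Suc i) t - l (Suc m) * ?h i t"
    \<comment> \<open>The outermost factor is removed first: the product of the others, applied to
      \<open>g\<close>, solves a first-order equation whose right-hand side is the full product
      applied to \<open>g\<close>.\<close>
    have q: "(\<Prod>j\<in>{1..Suc m}. [:- l j, 1:]) = [:- l (Suc m), 1:] * (\<Prod>j\<in>{1..m}. [:- l j, 1:])"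
      by (subst prod.cl_ivl_Suc) simp
    have h: "deriv_chain ?h" using g by (rule deriv_chain_poly_op)
    have "(1 + \<bar>t\<bar>) ^ ?k * cmod (?h i t) \<le> ?K * D ^ (?k + 1) * B" for t
    proof (rule decay_step[where f = ?f and l = "l (Suc m)"])
      show "(?h i has_vector_derivative - l (Suc m) * ?h i t - ?f t) (at t)" for t
        using h unfolding deriv_chain_def by simp
      show "rapid (?h i)" using h unfolding deriv_chain_def by simp
      show "(1 + \<bar>t\<bar>) ^ (?k + 2) * cmod (?f t) \<le> B" for t
        using B unfolding q poly_op_linear_factor by simp
      show "Re (l (Suc m)) = 0 \<or> 1 / D \<le> \<bar>Re (l (Suc m))\<bar>" using l by simp
    qed (rule D)
    then have "(1 + \<bar>t\<bar>) ^ k * cmod (g i t) \<le> K * D ^ e * (?K * D ^ (?k + 1) * B)"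
      using l by (intro K(2)[OF D _ g, of l] allI) simp_all
    then show "(1 + \<bar>t\<bar>) ^ k * cmod (g i t) \<le> K * ?K * D ^ (e + (?k + 1)) * B"
      by (simp add: power_add mult_ac)
  qed
qed

section \<open>The Hahn--Banach theorem for function spaces\<close>

text \<open>Only real scalars: the extension is carried out over the reals, and complex linearity is
  restored afterwards.\<close>

definition fun_space :: "('b \<Rightarrow> complex) set \<Rightarrow> bool" where
  "fun_space E \<longleftrightarrow> (\<lambda>x. 0) \<in> E \<and> (\<forall>f\<in>E. \<forall>g\<in>E. (\<lambda>x. f x + g x) \<in> E) \<and>
     (\<forall>r. \<forall>f\<in>E. (\<lambda>x. complex_of_real r * f x) \<in> E)"

text \<open>Partial real-linear functionals dominated by \<open>p\<close> are represented by their graphs, so that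
  extension is inclusion.\<close>

definition dominated_graph ::
  "('b \<Rightarrow> complex) set \<Rightarrow> (('b \<Rightarrow> complex) \<Rightarrow> real) \<Rightarrow> (('b \<Rightarrow> complex) \<times> real) set \<Rightarrow> bool" where
  "dominated_graph E p G \<longleftrightarrow> fst ` G \<subseteq> E \<and> ((\<lambda>x. 0), 0) \<in> G \<and>
     (\<forall>f a g b. (f, a) \<in> G \<longrightarrow> (g, b) \<in> G \<longrightarrow> ((\<lambda>x. f x + g x), a + b) \<in> G) \<and>
     (\<forall>r f a. (f, a) \<in> G \<longrightarrow> ((\<lambda>x. complex_of_real r * f x), r * a) \<in> G) \<and>
     (\<forall>f a. (f, a) \<in> G \<longrightarrow> a \<le> p f)"

locale sublinear =
  fixes E :: "('b \<Rightarrow> complex) set" and p :: "('b \<Rightarrow> complex) \<Rightarrow> real"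
  assumes E: "fun_space E"
    and p_add: "f \<in> E \<Longrightarrow> g \<in> E \<Longrightarrow> p (\<lambda>x. f x + g x) \<le> p f + p g"
    and p_scale: "f \<in> E \<Longrightarrow> r > 0 \<Longrightarrow> p (\<lambda>x. complex_of_real r * f x) = r * p f"
    and p_0: "p (\<lambda>x. 0) = 0"
begin

lemma E_add: "f \<in> E \<Longrightarrow> g \<in> E \<Longrightarrow> (\<lambda>x. f x + g x) \<in> E"
  and E_scale: "f \<in> E \<Longrightarrow> (\<lambda>x. complex_of_real r * f x) \<in> E"
  using E by (auto simp: fun_space_def)

lemma dominated_graphD:
  assumes "dominated_graph E p G"
  shows "(f, a) \<in> G \<Longrightarrow> f \<in> E" "((\<lambda>x. 0), 0) \<in> G"
    "(f, a) \<in> G \<Longrightarrow> (g, b) \<in> G \<Longrightarrow> ((\<lambda>x. f x + g x), a + b) \<in> G"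
    "(f, a) \<in> G \<Longrightarrow> ((\<lambda>x. complex_of_real r * f x), r * a) \<in> G"
    "(f, a) \<in> G \<Longrightarrow> a \<le> p f"
  using assms unfolding dominated_graph_def by (force, blast+)

text \<open>Single-valuedness is a consequence of domination: two values at \<open>f\<close> would
  put the pair of 0 and their difference into the graph, and \<open>p\<close> vanishes at 0.\<close>

lemma dominated_graph_unique:
  assumes G: "dominated_graph E p G" and "(f, a) \<in> G" "(f, b) \<in> G"
  shows "a = b"
proof -
  have le: "a \<le> b" if "(f, a) \<in> G" "(f, b) \<in> G" for a b
  proof -
    have "((\<lambda>x. f x + complex_of_real (-1) * f x), a + (-1) * b) \<in> G"
      using dominated_graphD[OF G] that by blast
    then have "a + (-1) * b \<le> p (\<lambda>x. f x + complex_of_real (-1) * f x)"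
      by (rule dominated_graphD(5)[OF G])
    then show ?thesis using p_0 by simp
  qed
  show ?thesis using le assms(2,3) by (meson antisym)
qed

lemma dominated_graph_extend:
  assumes G: "dominated_graph E p G" and h: "h \<in> E" "h \<notin> fst ` G"
  shows "\<exists>G'. dominated_graph E p G' \<and> G \<subset> G'"
proof -
  note D = dominated_graphD[OF G]
  define L where "L = {a - p (\<lambda>x. f x + complex_of_real (-1) * h x) | f a. (f, a) \<in> G}"
  \<comment> \<open>Every lower bound for an admissible value at \<open>h\<close> lies below every
    upper bound; the supremum \<open>c\<close> of the lower bounds is therefore a possible
    value.\<close>
  have gap: "a - p (\<lambda>x. f x + complex_of_real (-1) * h x) \<le> p (\<lambda>x. g x + h x) - b"
    if "(f, a) \<in> G" "(g, b) \<in> G" for f a g b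
  proof -
    have "a + b \<le> p (\<lambda>x. f x + g x)" using D(5)[OF D(3)[OF that]] .
    also have "(\<lambda>x. f x + g x) = (\<lambda>x. (f x + complex_of_real (-1) * h x) + (g x + h x))"
      by auto
    also have "p \<dots> \<le> p (\<lambda>x. f x + complex_of_real (-1) * h x) + p (\<lambda>x. g x + h x)"
      using that D(1) h(1) by (intro p_add E_add E_scale) auto
    finally show ?thesis by simp
  qed
  define c where "c = Sup L"
  have Lne: "L \<noteq> {}" unfolding L_def using D(2) by blast
  have c_le: "c \<le> p (\<lambda>x. g x + h x) - b" if "(g, b) \<in> G" for g b
    unfolding c_def
  proof (rule cSup_least[OF Lne])
    fix z assume "z \<in> L"
    then show "z \<le> p (\<lambda>x. g x + h x) - b" unfolding L_def using gap[OF _ that] by blast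
  qed
  have Lbdd: "bdd_above L"
    unfolding bdd_above_def L_def using gap[OF _ D(2)]
    by (intro exI[of _ "p (\<lambda>x. 0 + h x) - 0"] ballI) (elim CollectE exE conjE, simp only:)
  have c_ge: "a - p (\<lambda>x. f x + complex_of_real (-1) * h x) \<le> c" if "(f, a) \<in> G" for f a
    unfolding c_def using that by (intro cSup_upper Lbdd) (auto simp: L_def)
  define G' where "G' = {((\<lambda>x. f x + complex_of_real r * h x), a + r * c) | f a r. (f, a) \<in> G}"
  have dom: "a + r * c \<le> p (\<lambda>x. f x + complex_of_real r * h x)" if f: "(f, a) \<in> G" for f a r
  proof -
    consider "r = 0" | "r > 0" | "r < 0" by linarith
    then show ?thesis
    proof cases
      case 1
      then show ?thesis using D(5)[OF f] by simp
    next
      case 2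
      have "c \<le> p (\<lambda>x. complex_of_real (1/r) * f x + h x) - (1/r) * a"
        by (rule c_le[OF D(4)[OF f]])
      then have "a + r * c \<le> r * p (\<lambda>x. complex_of_real (1/r) * f x + h x)"
        using 2 by (simp add: field_simps)
      also have "\<dots> = p (\<lambda>x. complex_of_real r * (complex_of_real (1/r) * f x + h x))"
        using D(1)[OF f] h(1) 2 by (intro p_scale[symmetric] E_add E_scale) auto
      also have "(\<lambda>x. complex_of_real r * (complex_of_real (1/r) * f x + h x)) =
          (\<lambda>x. f x + complex_of_real r * h x)"
        using 2 by (auto simp: field_simps)
      finally show ?thesis .
    next
      case 3
      let ?s = "- r"
      have "(1/?s) * a - p (\<lambda>x. complex_of_real (1/?s) * f x + complex_of_real (-1) * h x) \<le> c"
        by (rule c_ge[OF D(4)[OF f]])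
      then have "a + r * c \<le> ?s * p (\<lambda>x. complex_of_real (1/?s) * f x + complex_of_real (-1) * h x)"
        using 3 by (simp add: field_simps)
      also have "\<dots> = p (\<lambda>x. complex_of_real ?s *
          (complex_of_real (1/?s) * f x + complex_of_real (-1) * h x))"
        using D(1)[OF f] h(1) 3 by (intro p_scale[symmetric] E_add E_scale) auto
      also have "(\<lambda>x. complex_of_real ?s *
          (complex_of_real (1/?s) * f x + complex_of_real (-1) * h x)) =
          (\<lambda>x. f x + complex_of_real r * h x)"
        using 3 by (auto simp: field_simps)
      finally show ?thesis .
    qed
  qed
  have "dominated_graph E p G'"
    unfolding dominated_graph_def
  proof (intro conjI allI impI)
    show "fst ` G' \<subseteq> E"
      unfolding G'_def using D(1) h(1) by (auto intro!: E_add E_scale)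
    show "((\<lambda>x. 0), 0) \<in> G'"
      unfolding G'_def using D(2) by (auto intro!: exI[of _ "\<lambda>x. 0"] exI[of _ 0])
  next
    fix f a g b assume "(f, a) \<in> G'" "(g, b) \<in> G'"
    then obtain f' a' r g' b' s where *: "(f', a') \<in> G" "(g', b') \<in> G"
      "f = (\<lambda>x. f' x + complex_of_real r * h x)" "a = a' + r * c"
      "g = (\<lambda>x. g' x + complex_of_real s * h x)" "b = b' + s * c"
      unfolding G'_def by blast
    have "(\<lambda>x. f x + g x) = (\<lambda>x. (f' x + g' x) + complex_of_real (r + s) * h x)"
      "a + b = (a' + b') + (r + s) * c"
      by (auto simp: * algebra_simps)
    then show "((\<lambda>x. f x + g x), a + b) \<in> G'"
      unfolding G'_def using D(3)[OF *(1,2)]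
      by (intro CollectI exI[of _ "\<lambda>x. f' x + g' x"] exI[of _ "a' + b'"] exI[of _ "r + s"]) simp
  next
    fix t f a assume "(f, a) \<in> G'"
    then obtain f' a' r where *: "(f', a') \<in> G"
      "f = (\<lambda>x. f' x + complex_of_real r * h x)" "a = a' + r * c"
      unfolding G'_def by blast
    have "(\<lambda>x. complex_of_real t * f x) =
        (\<lambda>x. complex_of_real t * f' x + complex_of_real (t * r) * h x)"
      "t * a = t * a' + (t * r) * c"
      by (auto simp: * algebra_simps)
    then show "((\<lambda>x. complex_of_real t * f x), t * a) \<in> G'"
      unfolding G'_def using D(4)[OF *(1), of t]
      by (intro CollectI exI[of _ "\<lambda>x. complex_of_real t * f' x"] exI[of _ "t * a'"] exI[of _ "t * r"]) simp
  next
    fix f a assume "(f, a) \<in> G'"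
    then show "a \<le> p f" unfolding G'_def using dom by blast
  qed
  moreover have "G \<subseteq> G'"
  proof
    fix z assume "z \<in> G"
    then show "z \<in> G'"
      unfolding G'_def
      by (intro CollectI exI[of _ "fst z"] exI[of _ "snd z"] exI[of _ 0]) simp
  qed
  moreover have "(h, c) \<in> G'"
    unfolding G'_def using D(2)
    by (intro CollectI exI[of _ "\<lambda>x. 0"] exI[of _ "0::real"] exI[of _ "1::real"]) simp
  then have "G \<noteq> G'" using h(2) by force
  ultimately show ?thesis by blast
qed

lemma real_hahn_banach:
  assumes G: "dominated_graph E p G"
  shows "\<exists>u. (\<forall>(f, a)\<in>G. u f = a) \<and>
     (\<forall>f\<in>E. \<forall>g\<in>E. u (\<lambda>x. f x + g x) = u f + u g) \<and>
     (\<forall>r. \<forall>f\<in>E. u (\<lambda>x. complex_of_real r * f x) = r * u f) \<and> (\<forall>f\<in>E. u f \<le> p f)"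
proof -
  let ?A = "{H. dominated_graph E p H \<and> G \<subseteq> H}"
  have "\<exists>M\<in>?A. \<forall>X\<in>?A. M \<subseteq> X \<longrightarrow> X = M"
  proof (rule subset_Zorn_nonempty)
    show "?A \<noteq> {}" using G by blast
  next
    fix C assume C: "C \<noteq> {}" "subset.chain ?A C"
    have CA: "C \<subseteq> ?A" and lin: "\<And>X Y. X \<in> C \<Longrightarrow> Y \<in> C \<Longrightarrow> X \<subseteq> Y \<or> Y \<subseteq> X"
      using C(2) by (auto simp: subset_chain_def)
    have dg: "dominated_graph E p X" if "X \<in> C" for X using CA that by blast
    have "dominated_graph E p (\<Union>C)"
      unfolding dominated_graph_def
    proof (intro conjI allI impI)
      show "fst ` \<Union>C \<subseteq> E" using dominated_graphD(1)[OF dg] by fastforce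
      show "((\<lambda>x. 0), 0) \<in> \<Union>C" using C(1) dominated_graphD(2)[OF dg] by blast
    next
      fix f a g b assume "(f, a) \<in> \<Union>C" "(g, b) \<in> \<Union>C"
      then obtain X Y where XY: "X \<in> C" "Y \<in> C" "(f, a) \<in> X" "(g, b) \<in> Y" by blast
      then obtain Z where "Z \<in> C" "(f, a) \<in> Z" "(g, b) \<in> Z" using lin[OF XY(1,2)] by blast
      then show "((\<lambda>x. f x + g x), a + b) \<in> \<Union>C" using dominated_graphD(3)[OF dg] by blast
    next
      fix r f a assume "(f, a) \<in> \<Union>C"
      then show "((\<lambda>x. complex_of_real r * f x), r * a) \<in> \<Union>C"
        using dominated_graphD(4)[OF dg] by blast
    next
      fix f a assume "(f, a) \<in> \<Union>C"
      then show "a \<le> p f" using dominated_graphD(5)[OF dg] by blast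
    qed
    moreover have "G \<subseteq> \<Union>C" using C(1) CA by blast
    ultimately show "\<Union>C \<in> ?A" by blast
  qed
  then obtain M where MA: "M \<in> ?A" and M_max: "\<forall>X\<in>?A. M \<subseteq> X \<longrightarrow> X = M" ..
  then have M: "dominated_graph E p M" "G \<subseteq> M" by simp_all
  have max: "X = M" if "dominated_graph E p X" "M \<subseteq> X" for X
    using that M(2) M_max by simp
  have full: "\<exists>a. (f, a) \<in> M" if "f \<in> E" for f
  proof (rule ccontr)
    assume "\<not> ?thesis"
    then have "f \<notin> fst ` M" by force
    from dominated_graph_extend[OF M(1) that this] max show False by blast
  qed
  define u where "u f = (THE a. (f, a) \<in> M)" for f
  have u: "u f = a" if "(f, a) \<in> M" for f a
    unfolding u_def using that dominated_graph_unique[OF M(1)] by blast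
  have uM: "(f, u f) \<in> M" if "f \<in> E" for f
    proof -
    obtain a where a: "(f, a) \<in> M" using full[OF \<open>f \<in> E\<close>] ..
    then show ?thesis using u[OF a] by simp
  qed
  show ?thesis
  proof (intro exI conjI ballI allI)
    show "case z of (f, a) \<Rightarrow> u f = a" if "z \<in> G" for z
      using that M(2) u by (cases z) auto
    show "u (\<lambda>x. f x + g x) = u f + u g" if "f \<in> E" "g \<in> E" for f g
      by (rule u[OF dominated_graphD(3)[OF M(1) uM uM]]) (rule that)+
    show "u (\<lambda>x. complex_of_real r * f x) = r * u f" if "f \<in> E" for f r
      by (rule u[OF dominated_graphD(4)[OF M(1) uM]]) (rule that)
    show "u f \<le> p f" if "f \<in> E" for f
      by (rule dominated_graphD(5)[OF M(1) uM[OF that]])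
  qed
qed

end

text \<open>The functional \<open>T\<close> is given on the range of a linear operator \<open>L\<close>, in the form \<open>T \<circ> L\<inverse>\<close>;
  the estimate makes it well defined.\<close>

lemma hahn_banach_range:
  fixes L :: "('b \<Rightarrow> complex) \<Rightarrow> ('b \<Rightarrow> complex)" and T :: "('b \<Rightarrow> complex) \<Rightarrow> complex"
  assumes E0: "(\<lambda>x. 0) \<in> E"
    and E_add: "\<And>f g. f \<in> E \<Longrightarrow> g \<in> E \<Longrightarrow> (\<lambda>x. f x + g x) \<in> E"
    and E_cmult: "\<And>c f. f \<in> E \<Longrightarrow> (\<lambda>x. c * f x) \<in> E"
    and p_add: "\<And>f g. f \<in> E \<Longrightarrow> g \<in> E \<Longrightarrow> p (\<lambda>x. f x + g x) \<le> p f + p g"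
    and p_cmult: "\<And>c f. f \<in> E \<Longrightarrow> p (\<lambda>x. c * f x) = cmod c * p f"
    and L_E: "\<And>f. f \<in> E \<Longrightarrow> L f \<in> E"
    and L_add: "\<And>f g. f \<in> E \<Longrightarrow> g \<in> E \<Longrightarrow> L (\<lambda>x. f x + g x) = (\<lambda>x. L f x + L g x)"
    and L_cmult: "\<And>c f. f \<in> E \<Longrightarrow> L (\<lambda>x. c * f x) = (\<lambda>x. c * L f x)"
    and T_add: "\<And>f g. f \<in> E \<Longrightarrow> g \<in> E \<Longrightarrow> T (\<lambda>x. f x + g x) = T f + T g"
    and T_cmult: "\<And>c f. f \<in> E \<Longrightarrow> T (\<lambda>x. c * f x) = c * T f"
    and bound: "\<And>f. f \<in> E \<Longrightarrow> cmod (T f) \<le> p (L f)"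
  obtains S where "\<And>f. f \<in> E \<Longrightarrow> S (L f) = T f"
    "\<And>f g. f \<in> E \<Longrightarrow> g \<in> E \<Longrightarrow> S (\<lambda>x. f x + g x) = S f + S g"
    "\<And>c f. f \<in> E \<Longrightarrow> S (\<lambda>x. c * f x) = c * S f"
    "\<And>f. f \<in> E \<Longrightarrow> cmod (S f) \<le> p f"
proof -
  have p0: "p (\<lambda>x. 0) = 0" using p_cmult[OF E0, of 0] by simp
  interpret sublinear E p
  proof
    show "fun_space E" unfolding fun_space_def using E0 E_add E_cmult by blast
    show "p (\<lambda>x. f x + g x) \<le> p f + p g" if "f \<in> E" "g \<in> E" for f g
      using that by (rule p_add)
    show "p (\<lambda>x. complex_of_real r * f x) = r * p f" if "f \<in> E" "r > 0" for r f
      using that(2) by (simp add: p_cmult[OF that(1)])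
    show "p (\<lambda>x. 0) = 0" by (rule p0)
  qed
  let ?G = "{(L f, Re (T f)) | f. f \<in> E}"
  have G: "dominated_graph E p ?G"
    unfolding dominated_graph_def
  proof (intro conjI allI impI)
    show "fst ` ?G \<subseteq> E" using L_E by auto
    have "L (\<lambda>x. 0) = (\<lambda>x. 0)" "T (\<lambda>x. 0) = 0"
      using L_cmult[OF E0, of 0] T_cmult[OF E0, of 0] by simp_all
    then show "((\<lambda>x. 0), 0) \<in> ?G" using E0 by (auto intro!: exI[of _ "\<lambda>x. 0"])
  next
    fix f a g b assume "(f, a) \<in> ?G" "(g, b) \<in> ?G"
    then obtain f' g' where *: "f' \<in> E" "g' \<in> E" "f = L f'" "g = L g'" "a = Re (T f')" "b = Re (T g')"
      by blast
    have "((\<lambda>x. f x + g x), a + b) = (L (\<lambda>x. f' x + g' x), Re (T (\<lambda>x. f' x + g' x)))"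
      by (simp add: * L_add T_add)
    then show "((\<lambda>x. f x + g x), a + b) \<in> ?G" using E_add[OF *(1,2)] by blast
  next
    fix r f a assume "(f, a) \<in> ?G"
    then obtain f' where *: "f' \<in> E" "f = L f'" "a = Re (T f')" by blast
    have "((\<lambda>x. complex_of_real r * f x), r * a) =
        (L (\<lambda>x. complex_of_real r * f' x), Re (T (\<lambda>x. complex_of_real r * f' x)))"
      by (simp add: * L_cmult T_cmult)
    then show "((\<lambda>x. complex_of_real r * f x), r * a) \<in> ?G" using E_cmult[OF *(1)] by blast
  next
    fix f a assume "(f, a) \<in> ?G"
    then obtain f' where *: "f' \<in> E" "f = L f'" "a = Re (T f')" by blast
    show "a \<le> p f" using bound[OF *(1)] complex_Re_le_cmod[of "T f'"] by (simp add: *)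
  qed
  obtain u where u: "\<And>f. f \<in> E \<Longrightarrow> u (L f) = Re (T f)"
    "\<And>f g. f \<in> E \<Longrightarrow> g \<in> E \<Longrightarrow> u (\<lambda>x. f x + g x) = u f + u g"
    "\<And>r f. f \<in> E \<Longrightarrow> u (\<lambda>x. complex_of_real r * f x) = r * u f"
    "\<And>f. f \<in> E \<Longrightarrow> u f \<le> p f"
  proof -
    from real_hahn_banach[OF G] obtain u where u: "\<forall>(f, a)\<in>?G. u f = a"
      "\<forall>f\<in>E. \<forall>g\<in>E. u (\<lambda>x. f x + g x) = u f + u g"
      "\<forall>r. \<forall>f\<in>E. u (\<lambda>x. complex_of_real r * f x) = r * u f" "\<forall>f\<in>E. u f \<le> p f"
      by (elim exE conjE)
    have "u (L f) = Re (T f)" if "f \<in> E" for f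
      using bspec[OF u(1), of "(L f, Re (T f))"] that by auto
    from that[of u, OF this] u(2-4) show thesis by simp
  qed
  \<comment> \<open>a complex-linear functional is determined by its real part\<close>
  define S where "S f = Complex (u f) (- u (\<lambda>x. \<i> * f x))" for f
  have S_add: "S (\<lambda>x. f x + g x) = S f + S g" if "f \<in> E" "g \<in> E" for f g
    using u(2)[OF E_cmult[OF that(1), of \<i>] E_cmult[OF that(2), of \<i>]]
    by (simp add: S_def u(2)[OF that] complex_eq_iff distrib_left)
  have S_real: "S (\<lambda>x. complex_of_real r * f x) = complex_of_real r * S f" if "f \<in> E" for f r
    using u(3)[OF E_cmult[OF that, of \<i>], of r]
    by (simp add: S_def u(3)[OF that] complex_eq_iff mult.left_commute)
  have S_i: "S (\<lambda>x. \<i> * f x) = \<i> * S f" if "f \<in> E" for f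
    using u(3)[OF that, of "-1"] by (simp add: S_def complex_eq_iff mult.assoc[symmetric])
  have S_cmult: "S (\<lambda>x. c * f x) = c * S f" if "f \<in> E" for c f
  proof -
    have "(\<lambda>x. c * f x) = (\<lambda>x. complex_of_real (Re c) * f x + \<i> * (complex_of_real (Im c) * f x))"
      by (rule ext) (subst complex_eq, simp add: algebra_simps)
    then have "S (\<lambda>x. c * f x) = complex_of_real (Re c) * S f + \<i> * (complex_of_real (Im c) * S f)"
      by (simp only: S_add S_real S_i E_cmult that)
    also have "\<dots> = c * S f" by (subst (3) complex_eq) (simp add: algebra_simps)
    finally show ?thesis .
  qed
  show thesis
  proof (rule that)
    show "S (L f) = T f" if "f \<in> E" for f
      using u(1)[OF that] u(1)[OF E_cmult[OF that, of \<i>]]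
      by (simp add: S_def L_cmult[OF that] T_cmult[OF that] complex_eq_iff)
    show "cmod (S f) \<le> p f" if f: "f \<in> E" for f
    proof (cases "S f = 0")
      case True
      \<comment> \<open>Nonnegativity of \<open>p\<close> is obtained from \<open>u \<le> p\<close>
        at \<open>f\<close> and at \<open>-f\<close>, where \<open>u\<close> changes sign and
        \<open>p\<close> does not.\<close>
      have "0 \<le> p f"
        using u(4)[OF f] u(4)[OF E_cmult[OF f, of "-1"]] u(3)[OF f, of "-1"] p_cmult[OF f, of "-1"]
        by simp
      with True show ?thesis by simp
    next
      case False
      \<comment> \<open>The phase that turns \<open>S f\<close> into its modulus, a real number, on
        which \<open>S\<close> and \<open>u\<close> agree.\<close>
      let ?c = "cnj (S f) / complex_of_real (cmod (S f))"
      have nc: "cmod ?c = 1" using False by (simp add: norm_divide)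
      have "?c * S f = complex_of_real (cmod (S f))"
        using False by (simp add: complex_norm_square[symmetric] power2_eq_square mult.commute[of "cnj _"])
      then have "cmod (S f) = Re (S (\<lambda>x. ?c * f x))"
        unfolding S_cmult[OF f] by simp
      also have "\<dots> = u (\<lambda>x. ?c * f x)" by (simp add: S_def)
      also have "\<dots> \<le> p (\<lambda>x. ?c * f x)" by (rule u(4)[OF E_cmult[OF f]])
      also have "\<dots> = p f" by (simp add: p_cmult[OF f] nc del: times_divide_eq_left)
      finally show ?thesis .
    qed
  qed (use S_add S_cmult in blast)+
qed

section \<open>Partial Fourier coefficients\<close>

text \<open>Used to differentiate under the integral sign: a quadratic remainder with an integrable
  constant can simply be integrated.\<close>

lemma has_vector_derivative_quadratic:
  fixes f :: "real \<Rightarrow> complex"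
  assumes "\<And>h. \<bar>h\<bar> \<le> 1 \<Longrightarrow> cmod (f h - f 0 - h *\<^sub>R d) \<le> C * h\<^sup>2"
  shows "(f has_vector_derivative d) (at 0)"
  unfolding has_vector_derivative_def
proof (rule has_derivativeI_sandwich[where e = 1 and H = "\<lambda>h. C * \<bar>h\<bar>"])
  show "bounded_linear (\<lambda>x. x *\<^sub>R d)" by (rule bounded_linear_scaleR_left)
  fix h :: real assume h: "h \<noteq> 0" "dist h 0 < 1"
  then have "cmod (f h - f 0 - h *\<^sub>R d) \<le> (C * \<bar>h\<bar>) * \<bar>h\<bar>"
    using assms[of h] by (simp add: power2_eq_square mult.assoc)
  then show "norm (f h - f 0 - (h - 0) *\<^sub>R d) / norm (h - 0) \<le> C * \<bar>h\<bar>"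
    using h by (simp add: divide_le_eq)
next
  have "((\<lambda>h::real. C * \<bar>h\<bar>) \<longlongrightarrow> C * \<bar>0\<bar>) (at 0)"
    by (intro tendsto_intros)
  then show "((\<lambda>h::real. C * \<bar>h\<bar>) \<longlongrightarrow> 0) (at 0)" by simp
qed simp

text \<open>The mean value inequality applied twice, first to \<open>g1\<close> and then to the
  difference of \<open>g\<close> and its tangent; the Taylor constant 1/2 is given away.\<close>

lemma second_order_bound:
  fixes g g1 g2 :: "real \<Rightarrow> complex"
  assumes g: "\<And>s. (g has_vector_derivative g1 s) (at s)"
    and g1: "\<And>s. (g1 has_vector_derivative g2 s) (at s)"
    and b: "\<And>s. \<bar>s\<bar> \<le> 1 \<Longrightarrow> cmod (g2 s) \<le> b" and h: "\<bar>h\<bar> \<le> 1"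
  shows "cmod (g h - g 0 - h *\<^sub>R g1 0) \<le> b * h\<^sup>2"
proof -
  have b0: "b \<ge> 0" using b[of 0] norm_ge_zero[of "g2 0"] by linarith
  have seg: "\<bar>s\<bar> \<le> \<bar>h\<bar>" if "s \<in> closed_segment 0 h" for s
    using that by (auto simp: closed_segment_eq_real_ivl split: if_splits)
  have 1: "cmod (g1 s - g1 0) \<le> b * \<bar>h\<bar>" if s: "s \<in> closed_segment 0 h" for s
  proof -
    have "norm (g1 s - g1 0) \<le> b * norm (s - 0)"
    proof (rule differentiable_bound[where f' = "\<lambda>s x. x *\<^sub>R g2 s" and S = "closed_segment 0 h"])
      show "(g1 has_derivative (\<lambda>x. x *\<^sub>R g2 u)) (at u within closed_segment 0 h)" for u
        using g1[of u] unfolding has_vector_derivative_def by (rule has_derivative_at_withinI)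
      show "onorm (\<lambda>x. x *\<^sub>R g2 u) \<le> b" if "u \<in> closed_segment 0 h" for u
      proof (rule onorm_bound[OF b0])
        fix x :: real
        have "cmod (g2 u) \<le> b" using seg[OF that] h by (intro b) simp
        from mult_right_mono[OF this norm_ge_zero[of x]] show "norm (x *\<^sub>R g2 u) \<le> b * norm x"
          by (simp add: mult.commute)
      qed
    qed (use s in auto)
    also have "\<dots> \<le> b * \<bar>h\<bar>" using seg[OF s] b0 by (simp add: mult_left_mono)
    finally show ?thesis .
  qed
  have "norm ((g h - h *\<^sub>R g1 0) - (g 0 - 0 *\<^sub>R g1 0)) \<le> (b * \<bar>h\<bar>) * norm (h - 0)"
  proof (rule differentiable_bound[where f' = "\<lambda>s x. x *\<^sub>R (g1 s - g1 0)" and S = "closed_segment 0 h" and f = "\<lambda>s. g s - s *\<^sub>R g1 0"])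
    show "((\<lambda>s. g s - s *\<^sub>R g1 0) has_derivative (\<lambda>x. x *\<^sub>R (g1 u - g1 0))) (at u within closed_segment 0 h)" for u
    proof -
      have "(g has_derivative (\<lambda>x. x *\<^sub>R g1 u)) (at u within closed_segment 0 h)"
        using g[of u] unfolding has_vector_derivative_def by (rule has_derivative_at_withinI)
      from has_derivative_diff[OF this has_derivative_scaleR_left[OF has_derivative_ident], of "g1 0"]
      show ?thesis by (simp add: scaleR_diff_right)
    qed
    show "onorm (\<lambda>x. x *\<^sub>R (g1 u - g1 0)) \<le> b * \<bar>h\<bar>" if "u \<in> closed_segment 0 h" for u
    proof (rule onorm_bound)
      show "0 \<le> b * \<bar>h\<bar>" using b0 by simp
      show "norm (x *\<^sub>R (g1 u - g1 0)) \<le> b * \<bar>h\<bar> * norm x" for x :: real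
        using mult_right_mono[OF 1[OF that] norm_ge_zero[of x]] by (simp add: mult.commute)
    qed
  qed auto
  then show ?thesis by (simp add: power2_eq_square mult.assoc algebra_simps)
qed

lemma schwartz_line_derivative:
  assumes "g \<in> schwartz" "v \<in> Basis"
  shows "((\<lambda>s. g (p + s *\<^sub>R v)) has_vector_derivative dir_deriv v g (p + s *\<^sub>R v)) (at s)"
proof -
  let ?q = "p + s *\<^sub>R v"
  have g: "(g has_derivative (\<lambda>w. dir_deriv w g ?q)) (at ?q)"
    using smooth_has_derivative[OF schwartz_smooth[OF assms(1)], of "[]" ?q] by simp
  have "((\<lambda>s. p + s *\<^sub>R v) has_derivative (\<lambda>s. s *\<^sub>R v)) (at s)"
    by (auto intro!: derivative_eq_intros)
  from has_derivative_compose[OF this g]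
  show ?thesis
    unfolding has_vector_derivative_def
    by (simp add: linear_cmul[OF has_derivative_linear[OF g]])
qed

locale lattice =
  fixes A B :: "real ^ 'n::finite ^ 'n"
  assumes A: "invertible A" and B: "B = (2 * pi) *\<^sub>R transpose (matrix_inv A)"
begin

abbreviation inv_A :: "real ^ 'n \<Rightarrow> real ^ 'n" where "inv_A x \<equiv> matrix_inv A *v x"

lemma matrix_inv_mult: "A ** matrix_inv A = mat 1" "matrix_inv A ** A = mat 1"
proof -
  have "A ** matrix_inv A = mat 1 \<and> matrix_inv A ** A = mat 1"
    using A unfolding invertible_def matrix_inv_def by (rule someI_ex)
  then show "A ** matrix_inv A = mat 1" "matrix_inv A ** A = mat 1" by auto
qed

lemma A_inv_A: "A *v inv_A x = x" and inv_A_A: "inv_A (A *v x) = x"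
  by (simp_all add: matrix_vector_mul_assoc matrix_inv_mult)

text \<open>In the coordinates \<open>y = inv_A x\<close> the lattice becomes the integer lattice.
  The Jacobian of this change is left out, which rescales all coefficients by the same
  constant.\<close>

definition FC :: "(real \<times> (real ^ 'n) \<Rightarrow> complex) \<Rightarrow> int ^ 'n \<Rightarrow> real \<Rightarrow> complex" where
  "FC g \<xi> t = fourier (\<lambda>y. g (t, A *v y)) \<xi>"

text \<open>Of the decay of \<open>g\<close>, \<open>k\<close> powers are spent on time and
  \<open>2 * CARD('n)\<close> on the integrable space weight. The constant \<open>K\<close> stems
  from the change of coordinates alone.\<close>

lemma schwartz_lattice_decay:
  obtains K where "K \<ge> 0"
    "\<And>k vs g t y. g \<in> schwartz \<Longrightarrow> vs \<in> lists Basis \<Longrightarrow>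
      (1 + \<bar>t\<bar>) ^ k * cmod (iter_deriv vs g (t, A *v y)) \<le> K * schwartz_seminorm (k + 2 * CARD('n), vs) g * wt y"
proof -
  have "bounded_linear inv_A" by (simp add: linear_linear matrix_vector_mul_linear)
  then obtain L where L: "\<And>x. norm (inv_A x) \<le> norm x * L" "L > 0"
    using bounded_linear.pos_bounded by metis
  let ?L = "1 + L"
  have y: "1 + norm y \<le> ?L * (1 + norm (t, A *v y))" for t :: real and y
  proof -
    have "norm y \<le> norm (A *v y) * L" using L(1)[of "A *v y"] by (simp add: inv_A_A)
    also have "\<dots> \<le> norm (t, A *v y) * L"
      using L(2) norm_snd_le[of "A *v y" t] by (intro mult_right_mono) auto
    finally show ?thesis using L(2) norm_ge_zero[of "(t, A *v y)"]
      unfolding distrib_left distrib_right mult_1 mult_1_right mult.commute[of L] by linarith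
  qed
  show thesis
  proof (rule that)
    show "0 \<le> ?L ^ (2 * CARD('n))" using L(2) by simp
    fix k and vs :: "(real \<times> (real ^ 'n)) list" and g :: "real \<times> (real ^ 'n) \<Rightarrow> complex" and t y
    assume g: "g \<in> schwartz" "vs \<in> lists Basis"
    let ?N = "1 + norm (t, A *v y)" and ?f = "cmod (iter_deriv vs g (t, A *v y))"
    have "(1 + \<bar>t\<bar>) ^ k * (1 + norm y) ^ (2 * CARD('n)) \<le> ?N ^ k * (?L * ?N) ^ (2 * CARD('n))"
      using norm_fst_le[of t "A *v y"] y by (intro mult_mono power_mono) auto
    also have "\<dots> = ?L ^ (2 * CARD('n)) * ?N ^ (k + 2 * CARD('n))"
      by (simp add: power_mult_distrib power_add mult_ac)
    finally have "((1 + \<bar>t\<bar>) ^ k * (1 + norm y) ^ (2 * CARD('n))) * ?f \<le> (?L ^ (2 * CARD('n)) * ?N ^ (k + 2 * CARD('n))) * ?f"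
      by (rule mult_right_mono) simp
    also have "\<dots> \<le> ?L ^ (2 * CARD('n)) * schwartz_seminorm (k + 2 * CARD('n), vs) g"
      unfolding mult.assoc using L(2) by (intro mult_left_mono schwartz_seminorm_upper g) auto
    finally have "(1 + \<bar>t\<bar>) ^ k * ?f \<le>
        ?L ^ (2 * CARD('n)) * schwartz_seminorm (k + 2 * CARD('n), vs) g * inverse ((1 + norm y) ^ (2 * CARD('n)))"
      unfolding divide_inverse[symmetric] by (subst pos_le_divide_eq) (auto simp: mult_ac add_pos_nonneg)
    also have "\<dots> \<le> ?L ^ (2 * CARD('n)) * schwartz_seminorm (k + 2 * CARD('n), vs) g * wt y"
      using L(2) schwartz_seminorm_nonneg[OF g] by (intro mult_left_mono inverse_power_le_wt) auto
    finally show "(1 + \<bar>t\<bar>) ^ k * ?f \<le> ?L ^ (2 * CARD('n)) * schwartz_seminorm (k + 2 * CARD('n), vs) g * wt y" .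
  qed
qed

lemma measurable_slice:
  fixes t :: real
  shows "g \<in> schwartz \<Longrightarrow> (\<lambda>y. g (t, A *v y)) \<in> borel_measurable borel"
proof (rule borel_measurable_continuous_onI)
  assume "g \<in> schwartz"
  then have g: "continuous_on UNIV g"
    using smooth_continuous_iter_deriv[of g "[]" UNIV] by (simp add: schwartz_smooth)
  have "continuous_on UNIV (\<lambda>y. (t, A *v y))"
    by (intro continuous_intros)
  from continuous_on_compose2[OF g this] show "continuous_on UNIV (\<lambda>y. g (t, A *v y))" by simp
qed

lemma measurable_char: "lattice_char \<xi> \<in> borel_measurable borel"
  by (intro borel_measurable_continuous_onI continuous_lattice_char)

lemma integrable_slice:
  fixes t :: real
  assumes "g \<in> schwartz"
  shows "integrable lborel (\<lambda>y. g (t, A *v y) * lattice_char \<xi> y)"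
proof -
  obtain K where K: "K \<ge> 0" "\<And>k vs g t y. g \<in> schwartz \<Longrightarrow> vs \<in> lists Basis \<Longrightarrow>
      (1 + \<bar>t\<bar>) ^ k * cmod (iter_deriv vs g (t, A *v y)) \<le> K * schwartz_seminorm (k + 2 * CARD('n), vs) g * wt y"
    using schwartz_lattice_decay by blast
  show ?thesis
  proof (rule integrable_wt_bound[where C = "K * schwartz_seminorm (0 + 2 * CARD('n), []) g"])
    show "(\<lambda>y. g (t, A *v y) * lattice_char \<xi> y) \<in> borel_measurable borel"
      by (intro borel_measurable_times measurable_slice measurable_char assms)
    show "cmod (g (t, A *v y) * lattice_char \<xi> y) \<le> K * schwartz_seminorm (0 + 2 * CARD('n), []) g * wt y" for y
      using K(2)[OF assms, of "[]" t 0 y] by (simp add: norm_mult)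
  qed
qed

lemma FC_add:
  assumes "f \<in> schwartz" "g \<in> schwartz"
  shows "FC (\<lambda>x. f x + g x) \<xi> t = FC f \<xi> t + FC g \<xi> t"
  unfolding FC_def fourier_def distrib_right
  by (intro Bochner_Integration.integral_add integrable_slice assms)

lemma FC_cmult: "FC (\<lambda>x. c * f x) \<xi> t = c * FC f \<xi> t"
  unfolding FC_def fourier_def mult.assoc by (rule integral_mult_right_zero)

lemma FC_sum:
  assumes "\<And>i. i \<in> I \<Longrightarrow> f i \<in> schwartz"
  shows "FC (\<lambda>x. \<Sum>i\<in>I. f i x) \<xi> t = (\<Sum>i\<in>I. FC (f i) \<xi> t)"
  unfolding FC_def fourier_def sum_distrib_right
  by (intro Bochner_Integration.integral_sum integrable_slice assms)

lemma FC_translate: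
  assumes "g \<in> schwartz"
  shows "FC (\<lambda>p. g (p + (0, x))) \<xi> t = lattice_char \<xi> (- inv_A x) * FC g \<xi> t"
proof -
  let ?f = "\<lambda>y. g (t, A *v y) * lattice_char \<xi> (- inv_A x + y)"
  have [measurable]: "?f \<in> borel_measurable borel"
  proof -
    have "(\<lambda>y. lattice_char \<xi> (- inv_A x + y)) \<in> borel_measurable borel"
      unfolding lattice_char_add by (intro borel_measurable_times borel_measurable_const measurable_char)
    then show ?thesis by (intro borel_measurable_times measurable_slice assms)
  qed
  have "FC (\<lambda>p. g (p + (0, x))) \<xi> t = (\<integral>y. ?f (inv_A x + y) \<partial>lborel)"
    unfolding FC_def fourier_def
    by (simp add: matrix_vector_right_distrib A_inv_A add.commute)
  also have "\<dots> = (\<integral>y. ?f y \<partial>lborel)"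
    by (rule lborel_integral_translate) measurable
  also have "\<dots> = lattice_char \<xi> (- inv_A x) * FC g \<xi> t"
    unfolding FC_def fourier_def lattice_char_add mult.left_commute[of "g _"]
    by (rule integral_mult_right_zero)
  finally show ?thesis .
qed

lemma FC_bound:
  "\<exists>p. seminorm_bounded p \<and> (\<forall>g\<in>schwartz. \<forall>\<xi> t. (1 + \<bar>t\<bar>) ^ k * cmod (FC g \<xi> t) \<le> p g)"
proof -
  obtain K where K: "K \<ge> 0" "\<And>k vs g t y. g \<in> schwartz \<Longrightarrow> vs \<in> lists Basis \<Longrightarrow>
      (1 + \<bar>t\<bar>) ^ k * cmod (iter_deriv vs g (t, A *v y)) \<le> K * schwartz_seminorm (k + 2 * CARD('n), vs) g * wt y"
    using schwartz_lattice_decay by blast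
  let ?I = "\<integral>y. wt (y :: real ^ 'n) \<partial>lborel"
  let ?s = "\<lambda>g. K * schwartz_seminorm (k + 2 * CARD('n), []) g"
  have "(1 + \<bar>t\<bar>) ^ k * cmod (FC g \<xi> t) \<le> (K * ?I) * schwartz_seminorm (k + 2 * CARD('n), []) g"
    if g: "g \<in> schwartz" for g \<xi> t
  proof -
    have "(1 + \<bar>t\<bar>) ^ k * cmod (FC g \<xi> t) = cmod (\<integral>y. complex_of_real ((1 + \<bar>t\<bar>) ^ k) * (g (t, A *v y) * lattice_char \<xi> y) \<partial>lborel)"
      unfolding FC_def fourier_def integral_mult_right_zero norm_mult norm_of_real by simp
    also have "\<dots> \<le> (\<integral>y. ?s g * wt y \<partial>(lborel :: (real ^ 'n) measure))"
    proof (rule Bochner_Integration.integral_norm_bound_integral)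
      show "integrable lborel (\<lambda>y. complex_of_real ((1 + \<bar>t\<bar>) ^ k) * (g (t, A *v y) * lattice_char \<xi> y))"
        by (intro integrable_mult_right integrable_slice g)
      show "integrable lborel (\<lambda>y. ?s g * wt (y :: real ^ 'n))"
        by (intro integrable_mult_right integrable_wt)
      show "norm (complex_of_real ((1 + \<bar>t\<bar>) ^ k) * (g (t, A *v y) * lattice_char \<xi> y)) \<le> ?s g * wt y" for y
        using K(2)[OF g, of "[]" t k y] unfolding norm_mult norm_of_real by simp
    qed
    also have "\<dots> = ?s g * ?I" by simp
    finally show ?thesis by (simp add: mult_ac)
  qed
  then show ?thesis
    by (intro exI[of _ "\<lambda>g. (K * ?I) * schwartz_seminorm (k + 2 * CARD('n), []) g"] conjI ballI allI)
       (rule seminorm_boundedI[of "[]" _ "K * ?I" "k + 2 * CARD('n)"], simp_all)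
qed

text \<open>Differentiating in a translation parameter treats time and space alike. In time the
  parameter is added to the argument of the coefficient; in space it appears as an explicit
  exponential factor.\<close>

lemma FC_direction:
  assumes g: "g \<in> schwartz" and v: "v \<in> Basis"
  shows "((\<lambda>h. FC (\<lambda>p. g (p + h *\<^sub>R v)) \<xi> t) has_vector_derivative FC (dir_deriv v g) \<xi> t) (at 0)"
proof -
  obtain K where K: "K \<ge> 0" "\<And>k vs g t y. g \<in> schwartz \<Longrightarrow> vs \<in> lists Basis \<Longrightarrow>
      (1 + \<bar>t\<bar>) ^ k * cmod (iter_deriv vs g (t, A *v y)) \<le> K * schwartz_seminorm (k + 2 * CARD('n), vs) g * wt y"
    using schwartz_lattice_decay by blast
  let ?g1 = "dir_deriv v g" and ?g2 = "dir_deriv v (dir_deriv v g)"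
  have g1: "?g1 \<in> schwartz" and g2: "?g2 \<in> schwartz" using g v by (auto intro: schwartz_dir_deriv)
  \<comment> \<open>A translation by at most 1 enlarges the seminorm with weight
    \<open>2 * CARD('n)\<close> by at most \<open>2 ^ (2 * CARD('n))\<close>.\<close>
  let ?S = "2 ^ (2 * CARD('n)) * schwartz_seminorm (2 * CARD('n), []) ?g2"
  have g2b: "cmod (?g2 ((t, A *v y) + s *\<^sub>R v)) \<le> K * ?S * wt y" if "\<bar>s\<bar> \<le> 1" for s y
  proof -
    have nv: "norm (s *\<^sub>R v) \<le> 1" using that v by simp
    have "schwartz_seminorm (0 + 2 * CARD('n), []) (\<lambda>p. ?g2 (p + s *\<^sub>R v)) \<le> (1 + norm (s *\<^sub>R v)) ^ (2 * CARD('n)) * schwartz_seminorm (2 * CARD('n), []) ?g2"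
      by (rule schwartz_seminorm_least) (use schwartz_translate_bound[OF g2, of "[]" _ "2 * CARD('n)" "s *\<^sub>R v"] in simp)
    also have "\<dots> \<le> ?S"
      using nv schwartz_seminorm_nonneg[OF g2, of "[]"] by (intro mult_right_mono power_mono) auto
    finally have "K * schwartz_seminorm (0 + 2 * CARD('n), []) (\<lambda>p. ?g2 (p + s *\<^sub>R v)) * wt y \<le> K * ?S * wt y"
      by (intro mult_right_mono mult_left_mono wt_nonneg K(1))
    with K(2)[OF schwartz_translate[OF g2, of "s *\<^sub>R v"], of "[]" t 0 y] show ?thesis by simp
  qed
  have tr: "(\<lambda>p. g (p + h *\<^sub>R v)) \<in> schwartz" for h by (rule schwartz_translate[OF g])
  show ?thesis
  proof (rule has_vector_derivative_quadratic[where C = "K * ?S * (\<integral>y. wt (y :: real ^ 'n) \<partial>lborel)"])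
    fix h :: real assume h: "\<bar>h\<bar> \<le> 1"
    let ?r = "\<lambda>y. g ((t, A *v y) + h *\<^sub>R v) - g ((t, A *v y) + 0 *\<^sub>R v) - h *\<^sub>R ?g1 (t, A *v y)"
    have "FC (\<lambda>p. g (p + h *\<^sub>R v)) \<xi> t - FC (\<lambda>p. g (p + 0 *\<^sub>R v)) \<xi> t - h *\<^sub>R FC ?g1 \<xi> t =
        (\<integral>y. ?r y * lattice_char \<xi> y \<partial>lborel)"
      unfolding FC_def fourier_def
      using integrable_slice[OF tr[of h], of t \<xi>] integrable_slice[OF tr[of 0], of t \<xi>] integrable_slice[OF g1, of t \<xi>]
      by (simp add: left_diff_distrib)
    also have "cmod \<dots> \<le> (\<integral>y. (K * ?S * h\<^sup>2) * wt y \<partial>(lborel :: (real ^ 'n) measure))"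
    proof (rule Bochner_Integration.integral_norm_bound_integral)
      show "integrable lborel (\<lambda>y. ?r y * lattice_char \<xi> y)"
        using integrable_slice[OF tr[of h], of t \<xi>] integrable_slice[OF tr[of 0], of t \<xi>] integrable_slice[OF g1, of t \<xi>]
        by (simp add: left_diff_distrib)
      show "integrable lborel (\<lambda>y. (K * ?S * h\<^sup>2) * wt (y :: real ^ 'n))"
        by (intro integrable_mult_right integrable_wt)
      show "norm (?r y * lattice_char \<xi> y) \<le> (K * ?S * h\<^sup>2) * wt y" for y
        using second_order_bound[OF schwartz_line_derivative[OF g v] schwartz_line_derivative[OF g1 v] g2b h]
        by (simp add: norm_mult mult_ac)
    qed
    also have "\<dots> = K * ?S * (\<integral>y. wt (y :: real ^ 'n) \<partial>lborel) * h\<^sup>2" by simp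
    finally show "cmod (FC (\<lambda>p. g (p + h *\<^sub>R v)) \<xi> t - FC (\<lambda>p. g (p + 0 *\<^sub>R v)) \<xi> t - h *\<^sub>R FC ?g1 \<xi> t)
        \<le> K * ?S * (\<integral>y. wt (y :: real ^ 'n) \<partial>lborel) * h\<^sup>2" .
  qed
qed

lemma FC_time_derivative:
  assumes "g \<in> schwartz"
  shows "(FC g \<xi> has_vector_derivative FC (dir_deriv (1, 0) g) \<xi> t) (at t)"
proof -
  have "(1, 0) \<in> (Basis :: (real \<times> (real ^ 'n)) set)" by (simp add: Basis_prod_def)
  from FC_direction[OF assms this, of \<xi> t]
  have "((\<lambda>h. FC g \<xi> (t + h)) has_vector_derivative FC (dir_deriv (1, 0) g) \<xi> t) (at 0)"
    by (simp add: FC_def add.commute)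
  then have "((\<lambda>h. FC g \<xi> (t + h)) has_vector_derivative FC (dir_deriv (1, 0) g) \<xi> t) (at (- t + t))"
    by simp
  moreover have "((\<lambda>s. - t + s) has_vector_derivative 1) (at t)"
    by (auto intro!: derivative_eq_intros simp: has_real_derivative_iff_has_vector_derivative[symmetric])
  ultimately have "((\<lambda>h. FC g \<xi> (t + h)) \<circ> (\<lambda>s. - t + s) has_vector_derivative 1 *\<^sub>R FC (dir_deriv (1, 0) g) \<xi> t) (at t)"
    by (intro vector_diff_chain_at)
  then show ?thesis by (simp add: comp_def)
qed

text \<open>Two derivatives at 0 of the same function of the translation parameter are compared: the
  general one, and that of the character produced by translating. This plays the part of integration
  by parts.\<close>

lemma FC_space_derivative:
  assumes g: "g \<in> schwartz"
  shows "FC (dir_deriv (0, axis j 1) g) \<xi> t = - (\<i> * complex_of_real ((B *v int_vec \<xi>) $ j)) * FC g \<xi> t"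
proof -
  let ?b = "2 * pi * (int_vec \<xi> \<bullet> inv_A (axis j 1))"
  have b: "?b = (B *v int_vec \<xi>) $ j"
  proof -
    have "(B *v int_vec \<xi>) $ j = 2 * pi * (\<Sum>i\<in>UNIV. matrix_inv A $ i $ j * int_vec \<xi> $ i)"
      unfolding B by (simp add: matrix_vector_mult_def transpose_def sum_distrib_left mult_ac)
    also have "(\<Sum>i\<in>UNIV. matrix_inv A $ i $ j * int_vec \<xi> $ i) = int_vec \<xi> \<bullet> inv_A (axis j 1)"
      by (simp add: inner_vec_def matrix_vector_mult_basis column_def mult.commute)
    finally show ?thesis by simp
  qed
  have "(0, axis j 1) \<in> (Basis :: (real \<times> (real ^ 'n)) set)" by (simp add: Basis_prod_def axis_in_Basis_iff)
  from FC_direction[OF g this, of \<xi> t]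
  have 1: "((\<lambda>h. FC (\<lambda>p. g (p + (0, h *\<^sub>R axis j 1))) \<xi> t) has_vector_derivative FC (dir_deriv (0, axis j 1) g) \<xi> t) (at 0)"
    by simp
  have "FC (\<lambda>p. g (p + (0, h *\<^sub>R axis j 1))) \<xi> t = exp (\<i> * complex_of_real (- ?b) * complex_of_real h) * FC g \<xi> t" for h
    unfolding FC_translate[OF g] lattice_char_def cis_conv_exp
    by (simp add: matrix_vector_mult_scaleR mult_ac)
  then have fe: "(\<lambda>h. FC (\<lambda>p. g (p + (0, h *\<^sub>R axis j 1))) \<xi> t) = (\<lambda>h. exp (\<i> * complex_of_real (- ?b) * complex_of_real h) * FC g \<xi> t)"
    by blast
  have "((\<lambda>h. exp (\<i> * complex_of_real (- ?b) * complex_of_real h)) has_vector_derivative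
      \<i> * complex_of_real (- ?b)) (at 0)"
    by (rule has_vector_derivative_real_field) (auto intro!: derivative_eq_intros)
  from has_vector_derivative_mult_left[OF this, of "FC g \<xi> t"]
  have 2: "((\<lambda>h. FC (\<lambda>p. g (p + (0, h *\<^sub>R axis j 1))) \<xi> t) has_vector_derivative
      \<i> * complex_of_real (- ?b) * FC g \<xi> t) (at 0)"
    unfolding fe .
  from vector_derivative_unique_at[OF 1 2] show ?thesis unfolding b by simp
qed

section \<open>Decay of the coefficients in the frequency\<close>

lemma norm1_nonneg: "0 \<le> norm1 \<xi>"
  by (simp add: norm1_def sum_nonneg)

text \<open>\<open>transpose A\<close> inverts \<open>B\<close> up to the factor
  \<open>2 * pi\<close>, so \<open>\<xi>\<close> is controlled by \<open>B\<xi>\<close>, whose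
  components are what space derivatives produce.\<close>

lemma norm1_le_dual:
  obtains c where "c \<ge> 1" "\<And>\<xi>. 1 + norm1 \<xi> \<le> c * (1 + (\<Sum>j\<in>UNIV. \<bar>(B *v int_vec \<xi>) $ j\<bar>))"
proof -
  let ?m = "\<Sum>i\<in>UNIV. \<Sum>j\<in>UNIV. \<bar>A $ j $ i\<bar>"
  have m0: "?m \<ge> 0" by (intro sum_nonneg) auto
  have le: "norm1 \<xi> \<le> ?m * (\<Sum>j\<in>UNIV. \<bar>(B *v int_vec \<xi>) $ j\<bar>)" for \<xi>
  proof -
    let ?b = "B *v int_vec \<xi>"
    have "transpose A *v ?b = (2 * pi) *\<^sub>R int_vec \<xi>"
    proof -
      have "transpose A *v ?b = (2 * pi) *\<^sub>R ((transpose A ** transpose (matrix_inv A)) *v int_vec \<xi>)"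
        unfolding B
        by (simp only: scaleR_matrix_vector_assoc[symmetric] matrix_vector_mult_scaleR matrix_vector_mul_assoc)
      also have "transpose A ** transpose (matrix_inv A) = mat 1"
        by (simp add: matrix_transpose_mul[symmetric] matrix_inv_mult transpose_mat)
      finally show ?thesis by simp
    qed
    moreover have "(transpose A *v w) $ i = (\<Sum>j\<in>UNIV. A $ j $ i * w $ j)" for i w
      by (simp add: matrix_vector_mult_def transpose_def)
    ultimately have e: "2 * pi * int_vec \<xi> $ i = (\<Sum>j\<in>UNIV. A $ j $ i * ?b $ j)" for i
      by (metis vector_scaleR_component real_scaleR_def)
    have one: "\<bar>int_vec \<xi> $ i\<bar> \<le> (\<Sum>j\<in>UNIV. \<bar>A $ j $ i\<bar>) * (\<Sum>j\<in>UNIV. \<bar>?b $ j\<bar>)" for i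
    proof -
      have "1 * \<bar>int_vec \<xi> $ i\<bar> \<le> (2 * pi) * \<bar>int_vec \<xi> $ i\<bar>"
        using pi_ge_two by (intro mult_right_mono) auto
      also have "\<dots> = \<bar>2 * pi * int_vec \<xi> $ i\<bar>" by (simp add: abs_mult)
      also have "\<dots> \<le> (\<Sum>j\<in>UNIV. \<bar>A $ j $ i\<bar> * \<bar>?b $ j\<bar>)"
        unfolding e by (rule order_trans[OF sum_abs]) (simp add: abs_mult)
      also have "\<dots> \<le> (\<Sum>j\<in>UNIV. \<bar>A $ j $ i\<bar> * (\<Sum>j\<in>UNIV. \<bar>?b $ j\<bar>))"
        by (intro sum_mono mult_left_mono member_le_sum) auto
      finally show ?thesis by (simp add: sum_distrib_right)
    qed
    have "norm1 \<xi> = (\<Sum>i\<in>UNIV. \<bar>int_vec \<xi> $ i\<bar>)" by (simp add: norm1_def int_vec_def)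
    also have "\<dots> \<le> (\<Sum>i\<in>UNIV. (\<Sum>j\<in>UNIV. \<bar>A $ j $ i\<bar>) * (\<Sum>j\<in>UNIV. \<bar>?b $ j\<bar>))"
      by (intro sum_mono one)
    finally show ?thesis by (simp add: sum_distrib_right)
  qed
  then have "1 + norm1 \<xi> \<le> (1 + ?m) * (1 + (\<Sum>j\<in>UNIV. \<bar>(B *v int_vec \<xi>) $ j\<bar>))" for \<xi>
  proof -
    have gen: "1 + n \<le> (1 + m) * (1 + S)" if "n \<le> m * S" "m \<ge> 0" "S \<ge> 0" for n m S :: real
      using that by (simp add: algebra_simps)
    show ?thesis by (rule gen[OF le m0 sum_nonneg]) simp
  qed
  with m0 show thesis by (intro that[of "1 + ?m"]) linarith
qed

lemma dual_le_norm1: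
  obtains c where "c \<ge> 0" "\<And>\<xi> j. \<bar>(B *v int_vec \<xi>) $ j\<bar> \<le> c * norm1 \<xi>"
proof
  let ?m = "\<Sum>i\<in>UNIV. \<Sum>j\<in>UNIV. \<bar>B $ j $ i\<bar>"
  show "?m \<ge> 0" by (intro sum_nonneg) auto
  fix \<xi> j
  have "\<bar>(B *v int_vec \<xi>) $ j\<bar> \<le> (\<Sum>i\<in>UNIV. \<bar>B $ j $ i\<bar> * \<bar>real_of_int (\<xi> $ i)\<bar>)"
    unfolding matrix_vector_mult_def int_vec_def vec_lambda_beta abs_mult[symmetric] by (rule sum_abs)
  also have "\<dots> \<le> (\<Sum>i\<in>UNIV. ?m * \<bar>real_of_int (\<xi> $ i)\<bar>)"
  proof (intro sum_mono mult_right_mono)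
    fix i
    have "\<bar>B $ j $ i\<bar> \<le> (\<Sum>j\<in>UNIV. \<bar>B $ j $ i\<bar>)" by (rule member_le_sum) auto
    also have "\<dots> \<le> ?m" by (rule member_le_sum) (auto intro: sum_nonneg)
    finally show "\<bar>B $ j $ i\<bar> \<le> ?m" .
  qed auto
  finally show "\<bar>(B *v int_vec \<xi>) $ j\<bar> \<le> ?m * norm1 \<xi>"
    by (simp add: norm1_def sum_distrib_left)
qed

text \<open>Each power of \<open>1 + norm1 \<xi>\<close> is exchanged for one space derivative of
  the test function.\<close>

lemma FC_decay:
  "\<exists>p. seminorm_bounded p \<and> (\<forall>g\<in>schwartz. \<forall>\<xi> t. (1 + norm1 \<xi>) ^ M * ((1 + \<bar>t\<bar>) ^ k * cmod (FC g \<xi> t)) \<le> p g)"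
proof (induction M)
  case 0
  show ?case using FC_bound[of k] by simp
next
  case (Suc M)
  then obtain p where p: "seminorm_bounded p"
    "\<And>g \<xi> t. g \<in> schwartz \<Longrightarrow> (1 + norm1 \<xi>) ^ M * ((1 + \<bar>t\<bar>) ^ k * cmod (FC g \<xi> t)) \<le> p g"
    by blast
  obtain c where c: "c \<ge> 1" "\<And>\<xi>. 1 + norm1 \<xi> \<le> c * (1 + (\<Sum>j\<in>UNIV. \<bar>(B *v int_vec \<xi>) $ j\<bar>))"
    using norm1_le_dual by blast
  let ?v = "\<lambda>j. (0, axis j 1) :: real \<times> (real ^ 'n)"
  have v: "?v j \<in> Basis" for j by (simp add: Basis_prod_def axis_in_Basis_iff)
  let ?q = "\<lambda>g. p g + (\<Sum>j\<in>UNIV. p (dir_deriv (?v j) g))"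
  have q: "seminorm_bounded ?q"
  proof (intro seminorm_bounded_add p(1) seminorm_bounded_sum)
    fix j
    show "seminorm_bounded (\<lambda>g. p (dir_deriv (?v j) g))"
      using seminorm_bounded_iter_deriv[OF p(1), of "[?v j]"] v[of j] by (simp add: iter_deriv_Cons)
  qed
  have sb: "seminorm_bounded (\<lambda>g. c * ?q g)"
    by (rule seminorm_bounded_mono[OF q order_refl]) (use c(1) in simp)
  have "(1 + norm1 \<xi>) ^ Suc M * ((1 + \<bar>t\<bar>) ^ k * cmod (FC g \<xi> t)) \<le> c * ?q g" if g: "g \<in> schwartz" for g \<xi> t
  proof -
    let ?w = "(1 + norm1 \<xi>) ^ M * (1 + \<bar>t\<bar>) ^ k"
    have w: "?w \<ge> 0" using norm1_nonneg[of \<xi>] by simp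
    have "(1 + norm1 \<xi>) * cmod (FC g \<xi> t) \<le>
        c * (1 + (\<Sum>j\<in>UNIV. \<bar>(B *v int_vec \<xi>) $ j\<bar>)) * cmod (FC g \<xi> t)"
      by (intro mult_right_mono c(2)) simp
    also have "\<dots> = c * (cmod (FC g \<xi> t) + (\<Sum>j\<in>UNIV. cmod (FC (dir_deriv (?v j) g) \<xi> t)))"
      by (simp add: FC_space_derivative[OF g] norm_mult sum_distrib_right distrib_right)
    finally have "?w * ((1 + norm1 \<xi>) * cmod (FC g \<xi> t)) \<le>
        ?w * (c * (cmod (FC g \<xi> t) + (\<Sum>j\<in>UNIV. cmod (FC (dir_deriv (?v j) g) \<xi> t))))"
      using w by (rule mult_left_mono)
    also have "\<dots> = c * (?w * cmod (FC g \<xi> t) + (\<Sum>j\<in>UNIV. ?w * cmod (FC (dir_deriv (?v j) g) \<xi> t)))"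
      by (simp only: distrib_left sum_distrib_left mult_ac)
    also have "\<dots> \<le> c * ?q g"
      using c(1) p(2)[OF g, of \<xi> t] p(2)[OF schwartz_dir_deriv[OF g v], of \<xi> t]
      by (intro mult_left_mono add_mono sum_mono) (simp_all add: mult.assoc)
    finally show ?thesis by (simp add: mult_ac)
  qed
  with sb show ?case by (intro exI[of _ "\<lambda>g. c * ?q g"]) blast
qed

end

section \<open>Periodic distributions are controlled by Fourier coefficients\<close>

lemma Basis_unit_vec: "Basis = range (unit_vec :: 'n::finite option \<Rightarrow> real \<times> (real ^ 'n))"
proof -
  have "range (unit_vec :: 'n option \<Rightarrow> real \<times> (real ^ 'n)) = insert (1, 0) (range (\<lambda>i. (0, axis i 1)))"
    by (simp add: UNIV_option_conv image_comp)
  then show ?thesis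
    by (auto simp: Basis_prod_def Basis_vec_def)
qed

lemma unit_vec_Basis: "unit_vec v \<in> Basis"
  by (simp add: Basis_unit_vec)

lemma map_unit_vec_lists: "map unit_vec us \<in> lists Basis"
  by (auto simp: unit_vec_Basis)

lemma lists_Basis_unit_vec:
  assumes "vs \<in> lists (Basis :: (real \<times> (real ^ 'n::finite)) set)"
  obtains us where "vs = map unit_vec us"
proof -
  have "\<exists>us. vs = map unit_vec us"
    using assms unfolding Basis_unit_vec lists_image by blast
  then show ?thesis using that by blast
qed

lemma splits_length: "p \<in> set (splits vs) \<Longrightarrow> length (fst p) \<le> length vs \<and> length (snd p) \<le> length vs"
  by (induction vs arbitrary: p) fastforce+

section \<open>Norms that see only the partial Fourier coefficients\<close>

context lattice begin

definition time_deriv :: "nat \<Rightarrow> (real \<times> (real ^ 'n) \<Rightarrow> complex) \<Rightarrow> (real \<times> (real ^ 'n) \<Rightarrow> complex)" where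
  "time_deriv l f = iter_deriv (replicate l (1, 0)) f"

lemma time_deriv_Suc: "time_deriv (Suc l) f = dir_deriv (1, 0) (time_deriv l f)"
  by (simp add: time_deriv_def iter_deriv_Cons)

lemma replicate_time_lists: "replicate l (1, 0) \<in> lists (Basis :: (real \<times> (real ^ 'n)) set)"
  by (auto simp: in_lists_conv_set set_replicate_conv_if Basis_prod_def)

lemma schwartz_time_deriv: "f \<in> schwartz \<Longrightarrow> time_deriv l f \<in> schwartz"
  unfolding time_deriv_def by (rule schwartz_iter_deriv[OF _ replicate_time_lists])

lemma FC_time_deriv:
  "f \<in> schwartz \<Longrightarrow> (FC (time_deriv l f) \<xi> has_vector_derivative FC (time_deriv (Suc l) f) \<xi> t) (at t)"
  unfolding time_deriv_Suc by (rule FC_time_derivative[OF schwartz_time_deriv])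

text \<open>The time direction contributes 1 because time derivatives stay on the coefficient
  function and are only counted.\<close>

fun dual_factor :: "int ^ 'n \<Rightarrow> 'n option \<Rightarrow> complex" where
  "dual_factor \<xi> None = 1"
| "dual_factor \<xi> (Some j) = - (\<i> * complex_of_real ((B *v int_vec \<xi>) $ j))"

text \<open>On the coefficients the space derivatives are scalars, so only the number of occurrences
  of each direction matters. The order chosen for a monomial thus disappears here.\<close>

lemma FC_iter_deriv:
  assumes f: "f \<in> schwartz"
  shows "FC (iter_deriv (map unit_vec us) f) \<xi> t =
    (\<Prod>v\<leftarrow>us. dual_factor \<xi> v) * FC (time_deriv (count_list us None) f) \<xi> t"
proof (induction us arbitrary: t)
  case Nil
  then show ?case by (simp add: time_deriv_def)
next
  case (Cons v us)
  let ?G = "iter_deriv (map unit_vec us) f"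
  let ?s = "\<Prod>v\<leftarrow>us. dual_factor \<xi> v" and ?l = "count_list us None"
  have G: "?G \<in> schwartz" by (rule schwartz_iter_deriv[OF f map_unit_vec_lists])
  show ?case
  proof (cases v)
    case None
    have 1: "(FC ?G \<xi> has_vector_derivative FC (dir_deriv (1, 0) ?G) \<xi> t) (at t)"
      by (rule FC_time_derivative[OF G])
    \<comment> \<open>The induction hypothesis holds for all times, so it may be differentiated in
      time and compared with the derivative already known.\<close>
    have "FC ?G \<xi> = (\<lambda>t. ?s * FC (time_deriv ?l f) \<xi> t)" using Cons.IH by blast
    moreover have "((\<lambda>t. ?s * FC (time_deriv ?l f) \<xi> t) has_vector_derivative ?s * FC (time_deriv (Suc ?l) f) \<xi> t) (at t)"
      by (rule has_vector_derivative_mult_right[OF FC_time_deriv[OF f]])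
    ultimately have 2: "(FC ?G \<xi> has_vector_derivative ?s * FC (time_deriv (Suc ?l) f) \<xi> t) (at t)" by simp
    from vector_derivative_unique_at[OF 1 2] show ?thesis
      by (simp add: None iter_deriv_Cons)
  next
    case (Some j)
    then show ?thesis
      by (simp add: iter_deriv_Cons FC_space_derivative[OF G] Cons.IH mult.assoc)
  qed
qed

definition coeff_weight :: "nat \<Rightarrow> nat \<Rightarrow> (int ^ 'n) \<times> real \<Rightarrow> real" where
  "coeff_weight M k = (\<lambda>(\<xi>, t). (1 + norm1 \<xi>) ^ M * (1 + \<bar>t\<bar>) ^ k)"

text \<open>Only time derivatives are listed: space derivatives are factors polynomial in
  \<open>\<xi>\<close> and are covered by the exponent \<open>M\<close>.\<close>

definition coeff_norm :: "nat \<Rightarrow> nat \<Rightarrow> nat \<Rightarrow> (real \<times> (real ^ 'n) \<Rightarrow> complex) \<Rightarrow> real" where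
  "coeff_norm M k L f = (\<Sum>l\<le>L. SUP z. coeff_weight M k z * cmod (FC (time_deriv l f) (fst z) (snd z)))"

lemma coeff_weight_nonneg: "0 \<le> coeff_weight M k z"
  by (cases z) (auto simp: coeff_weight_def intro!: mult_nonneg_nonneg zero_le_power add_nonneg_nonneg norm1_nonneg)

lemma coeff_bdd:
  assumes f: "f \<in> schwartz"
  shows "bdd_above (range (\<lambda>z. coeff_weight M k z * cmod (FC (time_deriv l f) (fst z) (snd z))))"
proof -
  obtain p where p: "\<forall>g\<in>schwartz. \<forall>\<xi> t. (1 + norm1 \<xi>) ^ M * ((1 + \<bar>t\<bar>) ^ k * cmod (FC g \<xi> t)) \<le> p g"
    using FC_decay by blast
  show ?thesis
    using p schwartz_time_deriv[OF f, of l]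
    by (intro bdd_aboveI2[where M = "p (time_deriv l f)"]) (auto simp: coeff_weight_def mult.assoc split: prod.split)
qed

lemma coeff_norm_upper:
  assumes f: "f \<in> schwartz" and l: "l \<le> L" and M: "M' \<le> M" and k: "k' \<le> k"
  shows "(1 + norm1 \<xi>) ^ M' * (1 + \<bar>t\<bar>) ^ k' * cmod (FC (time_deriv l f) \<xi> t) \<le> coeff_norm M k L f"
proof -
  let ?S = "\<lambda>l. SUP z. coeff_weight M k z * cmod (FC (time_deriv l f) (fst z) (snd z))"
  have S: "coeff_weight M k z * cmod (FC (time_deriv l f) (fst z) (snd z)) \<le> ?S l" for l z
    by (rule cSUP_upper[OF UNIV_I coeff_bdd[OF f]])
  have S0: "0 \<le> ?S l" for l
    by (rule order_trans[OF _ S[of "(0, 0)" l]]) (intro mult_nonneg_nonneg coeff_weight_nonneg norm_ge_zero)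
  have "(1 + norm1 \<xi>) ^ M' * (1 + \<bar>t\<bar>) ^ k' * cmod (FC (time_deriv l f) \<xi> t) \<le>
      coeff_weight M k (\<xi>, t) * cmod (FC (time_deriv l f) \<xi> t)"
    using M k norm1_nonneg[of \<xi>] unfolding coeff_weight_def prod.case
    by (intro mult_right_mono mult_mono power_increasing) auto
  also have "\<dots> \<le> ?S l" using S[of "(\<xi>, t)" l] by simp
  also have "\<dots> \<le> coeff_norm M k L f"
    unfolding coeff_norm_def using l S0 by (intro member_le_sum) auto
  finally show ?thesis .
qed

lemma coeff_norm_least:
  assumes "\<And>l \<xi> t. l \<le> L \<Longrightarrow> (1 + norm1 \<xi>) ^ M * (1 + \<bar>t\<bar>) ^ k * cmod (FC (time_deriv l f) \<xi> t) \<le> b"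
  shows "coeff_norm M k L f \<le> (real L + 1) * b"
proof -
  have "coeff_norm M k L f \<le> (\<Sum>l\<le>L. b)"
    unfolding coeff_norm_def
    by (intro sum_mono cSUP_least) (use assms in \<open>auto simp: coeff_weight_def split: prod.split\<close>)
  then show ?thesis by (simp add: add.commute)
qed

lemma coeff_norm_nonneg: "f \<in> schwartz \<Longrightarrow> 0 \<le> coeff_norm M k L f"
  using coeff_norm_upper[of f 0 L 0 M 0 k 0 0] by (simp add: order_trans[OF norm_ge_zero])

lemma coeff_norm_mono:
  assumes f: "f \<in> schwartz" and "M \<le> M'" "k \<le> k'" "L \<le> L'"
  shows "coeff_norm M k L f \<le> (real L + 1) * coeff_norm M' k' L' f"
  by (rule coeff_norm_least) (use assms in \<open>auto intro!: coeff_norm_upper[OF f]\<close>)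

lemma coeff_norm_seminorm_bounded: "seminorm_bounded (coeff_norm M k L)"
proof -
  obtain p where p: "seminorm_bounded p"
    "\<And>g \<xi> t. g \<in> schwartz \<Longrightarrow> (1 + norm1 \<xi>) ^ M * ((1 + \<bar>t\<bar>) ^ k * cmod (FC g \<xi> t)) \<le> p g"
    using FC_decay by blast
  have "seminorm_bounded (\<lambda>f. \<Sum>l\<le>L. p (time_deriv l f))"
    unfolding time_deriv_def
    by (intro seminorm_bounded_sum seminorm_bounded_iter_deriv p(1) replicate_time_lists)
  then show ?thesis
  proof (rule seminorm_bounded_mono[where c = 1])
    fix f :: "real \<times> (real ^ 'n) \<Rightarrow> complex" assume f: "f \<in> schwartz"
    have "coeff_norm M k L f \<le> (\<Sum>l\<le>L. p (time_deriv l f))"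
      unfolding coeff_norm_def
      by (intro sum_mono cSUP_least)
        (use p(2)[OF schwartz_time_deriv[OF f]] in \<open>auto simp: coeff_weight_def mult.assoc split: prod.split\<close>)
    then show "coeff_norm M k L f \<le> 1 * (\<Sum>l\<le>L. p (time_deriv l f))" by simp
  qed simp
qed

lemma time_deriv_add:
  "f \<in> schwartz \<Longrightarrow> g \<in> schwartz \<Longrightarrow> time_deriv l (\<lambda>x. f x + g x) = (\<lambda>x. time_deriv l f x + time_deriv l g x)"
  unfolding time_deriv_def by (rule iter_deriv_add[OF schwartz_smooth schwartz_smooth replicate_time_lists])

lemma time_deriv_cmult:
  "f \<in> schwartz \<Longrightarrow> time_deriv l (\<lambda>x. c * f x) = (\<lambda>x. c * time_deriv l f x)"
  unfolding time_deriv_def by (rule iter_deriv_cmult[OF schwartz_smooth replicate_time_lists])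

lemma time_deriv_translate:
  "f \<in> schwartz \<Longrightarrow> time_deriv l (\<lambda>x. f (x + h)) = (\<lambda>x. time_deriv l f (x + h))"
  unfolding time_deriv_def by (rule iter_deriv_translate[OF schwartz_smooth replicate_time_lists])

lemma coeff_norm_add:
  assumes f: "f \<in> schwartz" and g: "g \<in> schwartz"
  shows "coeff_norm M k L (\<lambda>x. f x + g x) \<le> coeff_norm M k L f + coeff_norm M k L g"
  unfolding coeff_norm_def sum.distrib[symmetric]
proof (intro sum_mono cSUP_least)
  fix l and z :: "(int ^ 'n) \<times> real"
  let ?u = "\<lambda>f z. coeff_weight M k z * cmod (FC (time_deriv l f) (fst z) (snd z))"
  have "?u (\<lambda>x. f x + g x) z \<le> ?u f z + ?u g z"
    unfolding time_deriv_add[OF f g] FC_add[OF schwartz_time_deriv[OF f] schwartz_time_deriv[OF g]]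
      distrib_left[symmetric]
    by (intro mult_left_mono norm_triangle_ineq coeff_weight_nonneg)
  also have "\<dots> \<le> (SUP z. ?u f z) + (SUP z. ?u g z)"
    by (intro add_mono cSUP_upper coeff_bdd f g UNIV_I)
  finally show "?u (\<lambda>x. f x + g x) z \<le> (SUP z. ?u f z) + (SUP z. ?u g z)" .
qed simp

lemma coeff_norm_cmult:
  assumes f: "f \<in> schwartz"
  shows "coeff_norm M k L (\<lambda>x. c * f x) = cmod c * coeff_norm M k L f"
proof -
  have le: "coeff_norm M k L (\<lambda>x. c * f x) \<le> cmod c * coeff_norm M k L f" if f: "f \<in> schwartz" for c f
    unfolding coeff_norm_def sum_distrib_left
  proof (intro sum_mono cSUP_least)
    fix l and z :: "(int ^ 'n) \<times> real"
    let ?u = "\<lambda>f z. coeff_weight M k z * cmod (FC (time_deriv l f) (fst z) (snd z))"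
    have "?u (\<lambda>x. c * f x) z = cmod c * ?u f z"
      by (simp add: time_deriv_cmult[OF f] FC_cmult norm_mult)
    also have "\<dots> \<le> cmod c * (SUP z. ?u f z)"
      by (intro mult_left_mono cSUP_upper coeff_bdd f UNIV_I) simp
    finally show "?u (\<lambda>x. c * f x) z \<le> cmod c * (SUP z. ?u f z)" .
  qed simp
  show ?thesis
  proof (cases "c = 0")
    case True
    have "coeff_norm M k L (\<lambda>x. c * f x) \<ge> 0" by (intro coeff_norm_nonneg schwartz_cmult f)
    with le[OF f, of c] True show ?thesis by simp
  next
    case False
    \<comment> \<open>The converse inequality is the first one for the scalar
      \<open>inverse c\<close>.\<close>
    have "cmod c * coeff_norm M k L f = cmod c * coeff_norm M k L (\<lambda>x. inverse c * (c * f x))"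
      using False by (simp add: mult.assoc[symmetric])
    also have "\<dots> \<le> cmod c * (cmod (inverse c) * coeff_norm M k L (\<lambda>x. c * f x))"
      by (intro mult_left_mono le schwartz_cmult f) simp
    also have "\<dots> = coeff_norm M k L (\<lambda>x. c * f x)"
      using False by (simp add: norm_inverse)
    finally show ?thesis using le[OF f, of c] by simp
  qed
qed

lemma FC_lattice_translate:
  assumes "f \<in> schwartz"
  shows "FC (\<lambda>x. f (x + (0, A *v int_vec a))) \<xi> t = FC f \<xi> t"
proof -
  have "lattice_char \<xi> (- int_vec a) = 1"
  proof -
    have "lattice_char \<xi> (- int_vec a) * lattice_char \<xi> (int_vec a) = lattice_char \<xi> 0"
      by (simp add: lattice_char_add[symmetric])
    then show ?thesis by (simp add: lattice_char_int) (simp add: lattice_char_def)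
  qed
  then show ?thesis by (simp add: FC_translate[OF assms] inv_A_A)
qed

lemma coeff_norm_lattice_translate:
  assumes "f \<in> schwartz"
  shows "coeff_norm M k L (\<lambda>x. f (x + (0, A *v int_vec a)) - f x) = 0"
proof -
  have tr: "(\<lambda>x. f (x + (0, A *v int_vec a))) \<in> schwartz" by (rule schwartz_translate[OF assms])
  have "FC (time_deriv l (\<lambda>x. f (x + (0, A *v int_vec a)) - f x)) \<xi> t = 0" for l \<xi> t
  proof -
    have "time_deriv l (\<lambda>x. f (x + (0, A *v int_vec a)) + (-1) * f x) =
        (\<lambda>x. time_deriv l f (x + (0, A *v int_vec a)) + (-1) * time_deriv l f x)"
      by (simp only: time_deriv_add[OF tr schwartz_cmult[OF assms]] time_deriv_translate[OF assms] time_deriv_cmult[OF assms])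
    moreover have "FC (\<lambda>x. time_deriv l f (x + (0, A *v int_vec a)) + (-1) * time_deriv l f x) \<xi> t = 0"
      by (subst FC_add) (simp_all add: schwartz_translate schwartz_cmult[of _ "-1", simplified] schwartz_time_deriv[OF assms]
          FC_lattice_translate FC_cmult[of "-1", simplified])
    ultimately show ?thesis by simp
  qed
  then show ?thesis by (simp add: coeff_norm_def)
qed

text \<open>Provides the regularity asked for by the Poisson inequality. The constant may depend on
  \<open>g\<close> and \<open>t\<close>, since it does not appear in the conclusion there.\<close>

lemma slice_lipschitz:
  fixes t :: real
  assumes g: "g \<in> schwartz"
  obtains C where "C \<ge> 0" "\<And>y. cmod (g (t, A *v y)) \<le> C * wt y"
    "\<And>a x. (\<And>i. \<bar>x $ i\<bar> \<le> 1/2) \<Longrightarrow>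
       cmod (g (t, A *v (int_vec a + x)) - g (t, A *v int_vec a)) \<le> C * wt (int_vec a) * (\<Sum>i\<in>UNIV. \<bar>x $ i\<bar>)"
proof -
  obtain K where K: "K \<ge> 0" "\<And>k vs g t y. g \<in> schwartz \<Longrightarrow> vs \<in> lists Basis \<Longrightarrow>
      (1 + \<bar>t\<bar>) ^ k * cmod (iter_deriv vs g (t, A *v y)) \<le> K * schwartz_seminorm (k + 2 * CARD('n), vs) g * wt y"
    using schwartz_lattice_decay by blast
  have "bounded_linear ((*v) A)" by (simp add: linear_linear matrix_vector_mul_linear)
  then obtain L where L: "\<And>x. norm (A *v x) \<le> norm x * L" "L > 0"
    using bounded_linear.pos_bounded by metis
  let ?s = "\<lambda>vs. K * schwartz_seminorm (0 + 2 * CARD('n), vs) g"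
  have b: "cmod (iter_deriv vs g (t, A *v y)) \<le> ?s vs * wt y" if "vs \<in> lists Basis" for vs y
    using K(2)[OF g that, of t 0 y] by simp
  have s0: "?s vs \<ge> 0" if "vs \<in> lists Basis" for vs
    by (intro mult_nonneg_nonneg K(1) schwartz_seminorm_nonneg g that)
  let ?G = "\<Sum>v\<in>Basis. ?s [v]"
  have G0: "?G \<ge> 0" by (intro sum_nonneg s0) auto
  let ?C = "?s [] + ?G * L * 4 ^ CARD('n)"
  show thesis
  proof (rule that)
    show C0: "0 \<le> ?C" using s0[of "[]"] G0 L(2) by simp
    show "cmod (g (t, A *v y)) \<le> ?C * wt y" for y
    proof -
      have "cmod (g (t, A *v y)) \<le> ?s [] * wt y" using b[of "[]" y] by simp
      also have "\<dots> \<le> ?C * wt y" using G0 L(2) by (intro mult_right_mono wt_nonneg) simp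
      finally show ?thesis .
    qed
    fix a :: "int ^ 'n" and x :: "real ^ 'n" assume x: "\<And>i. \<bar>x $ i\<bar> \<le> 1/2"
    let ?h = "\<lambda>y. g (t, A *v y)"
    let ?D = "\<lambda>y w. dir_deriv (0, A *v w) g (t, A *v y)"
    have gd: "(g has_derivative (\<lambda>v. dir_deriv v g p)) (at p)" for p
      using smooth_has_derivative[OF schwartz_smooth[OF g], of "[]" p] by simp
    have hd: "(?h has_derivative ?D y) (at y)" for y
    proof -
      have "((\<lambda>y. (t, A *v y)) has_derivative (\<lambda>w. (0, A *v w))) (at y)"
        by (intro has_derivative_Pair has_derivative_const bounded_linear_imp_has_derivative)
           (simp add: linear_linear matrix_vector_mul_linear)
      from has_derivative_compose[OF this gd] show ?thesis .
    qed
    have Db: "cmod (?D y w) \<le> (?G * wt y * L) * norm w" for y w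
    proof -
      let ?v = "(0, A *v w) :: real \<times> (real ^ 'n)" and ?p = "(t, A *v y)"
      have lin: "linear (\<lambda>v. dir_deriv v g ?p)" by (rule has_derivative_linear[OF gd])
      have "?D y w = dir_deriv (\<Sum>b\<in>Basis. (?v \<bullet> b) *\<^sub>R b) g ?p" by (simp only: euclidean_representation)
      also have "\<dots> = (\<Sum>b\<in>Basis. (?v \<bullet> b) *\<^sub>R dir_deriv b g ?p)"
        by (simp only: linear_sum[OF lin] linear_cmul[OF lin])
      also have "cmod \<dots> \<le> (\<Sum>b\<in>Basis. norm ?v * (?s [b] * wt y))"
      proof (rule sum_norm_le)
        fix b :: "real \<times> (real ^ 'n)" assume bB: "b \<in> Basis"
        have "cmod (dir_deriv b g ?p) \<le> ?s [b] * wt y" using b[of "[b]" y] bB by (simp add: iter_deriv_Cons)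
        moreover have "\<bar>?v \<bullet> b\<bar> \<le> norm ?v" using bB by (rule Basis_le_norm)
        ultimately show "norm ((?v \<bullet> b) *\<^sub>R dir_deriv b g ?p) \<le> norm ?v * (?s [b] * wt y)"
          unfolding norm_scaleR by (intro mult_mono) auto
      qed
      also have "\<dots> = (?G * wt y) * norm ?v" by (simp add: sum_distrib_left sum_distrib_right mult_ac)
      also have "\<dots> \<le> (?G * wt y) * (norm w * L)"
        using G0 wt_nonneg[of y] L(1)[of w] by (intro mult_left_mono) (auto simp: norm_Pair)
      finally show ?thesis by (simp add: mult_ac)
    qed
    \<comment> \<open>One factor \<open>2 ^ CARD('n)\<close> comes from \<open>wt_shift\<close>, the
      other from \<open>wt\<close> being at least \<open>(1/2) ^ CARD('n)\<close> on the
      cell.\<close>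
    have wtx: "wt (int_vec a + s *\<^sub>R x) \<le> 4 ^ CARD('n) * wt (int_vec a)" if s: "s \<in> {0..1}" for s
    proof -
      let ?z = "s *\<^sub>R x"
      have "(\<Prod>i\<in>(UNIV :: 'n set). 1 / 2 :: real) \<le> wt ?z"
        unfolding wt_def
      proof (rule prod_mono, intro conjI)
        fix i
        have "\<bar>s * x $ i\<bar> \<le> 1 * (1/2)" unfolding abs_mult using s x by (intro mult_mono) auto
        then have "(s * x $ i)\<^sup>2 \<le> 1" by (simp add: abs_square_le_1)
        then show "1 / 2 \<le> inverse (1 + ((s *\<^sub>R x) $ i)\<^sup>2)"
          by (simp add: field_simps add_pos_nonneg)
      qed simp
      then have "(1/2) ^ CARD('n) * wt (?z + int_vec a) \<le> wt ?z * wt (?z + int_vec a)"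
        by (intro mult_right_mono wt_nonneg) simp
      also have "\<dots> \<le> 2 ^ CARD('n) * wt (int_vec a)"
        using wt_shift[of ?z "int_vec a"] by (simp add: mult.commute)
      finally have "wt (?z + int_vec a) \<le> 2 ^ CARD('n) * (2 ^ CARD('n) * wt (int_vec a))"
        by (simp add: power_divide field_simps)
      then show ?thesis by (simp add: add.commute mult.assoc[symmetric] power_mult_distrib[symmetric])
    qed
    have "norm (?h (int_vec a + x) - ?h (int_vec a)) \<le> norm x * (?G * (4 ^ CARD('n) * wt (int_vec a)) * L)"
    proof (rule differentiable_bound_segment[where G = UNIV and f' = ?D])
      show "(?h has_derivative ?D y) (at y within UNIV)" for y by (simp add: hd)
      fix s :: real assume s: "s \<in> {0..1}"
      show "onorm (?D (int_vec a + s *\<^sub>R x)) \<le> ?G * (4 ^ CARD('n) * wt (int_vec a)) * L"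
      proof (rule onorm_le)
        fix w
        have "norm (?D (int_vec a + s *\<^sub>R x) w) \<le> (?G * wt (int_vec a + s *\<^sub>R x) * L) * norm w" by (rule Db)
        also have "\<dots> \<le> (?G * (4 ^ CARD('n) * wt (int_vec a)) * L) * norm w"
          using G0 L(2) by (intro mult_right_mono mult_left_mono wtx s) auto
        finally show "norm (?D (int_vec a + s *\<^sub>R x) w) \<le> (?G * (4 ^ CARD('n) * wt (int_vec a)) * L) * norm w" .
      qed
    qed simp
    also have "\<dots> = (?G * L * 4 ^ CARD('n)) * wt (int_vec a) * norm x" by (simp add: mult_ac)
    also have "\<dots> \<le> ?C * wt (int_vec a) * (\<Sum>i\<in>UNIV. \<bar>x $ i\<bar>)"
      using s0[of "[]"] G0 L(2) wt_nonneg[of "int_vec a"] C0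
      by (intro mult_mono mult_right_mono norm_le_l1_cart) auto
    finally show "cmod (?h (int_vec a + x) - ?h (int_vec a)) \<le> ?C * wt (int_vec a) * (\<Sum>i\<in>UNIV. \<bar>x $ i\<bar>)" .
  qed
qed

text \<open>The Poisson inequality yields a threshold for \<open>N\<close> that depends on
  \<open>t\<close> and on the translation \<open>y\<close>. The factor \<open>wt y\<close> removes
  this dependence: it recentres the translated tail, which is then small uniformly by
  \<open>wt_tail\<close>.\<close>

lemma poisson_slice:
  assumes g: "g \<in> schwartz" and Bd: "\<And>F t. finite F \<Longrightarrow> (1 + \<bar>t\<bar>) ^ k * (\<Sum>\<xi>\<in>F. cmod (FC g \<xi> t)) \<le> Bd"
    and \<epsilon>: "\<epsilon> > 0"
  shows "\<exists>N1. \<forall>N\<ge>N1. \<forall>t y. (1 + \<bar>t\<bar>) ^ k * wt y *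
     cmod (\<Sum>a\<in>lattice_box N. g (t, A *v (y + int_vec a))) \<le> Bd + \<epsilon>"
proof -
  obtain K where K: "K \<ge> 0" "\<And>k vs g t y. g \<in> schwartz \<Longrightarrow> vs \<in> lists Basis \<Longrightarrow>
      (1 + \<bar>t\<bar>) ^ k * cmod (iter_deriv vs g (t, A *v y)) \<le> K * schwartz_seminorm (k + 2 * CARD('n), vs) g * wt y"
    using schwartz_lattice_decay by blast
  let ?s = "K * schwartz_seminorm (k + 2 * CARD('n), []) g"
  have s0: "?s \<ge> 0" by (intro mult_nonneg_nonneg K(1) schwartz_seminorm_nonneg g) simp
  define \<delta> where "\<delta> = \<epsilon> / (2 * (?s * 2 ^ CARD('n) + 1))"
  have den: "?s * 2 ^ CARD('n) + 1 > 0" using s0 by (simp add: add_nonneg_pos)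
  have \<delta>: "\<delta> > 0" using \<epsilon> den by (simp add: \<delta>_def)
  obtain N1 where N1: "\<And>F. finite F \<Longrightarrow> F \<inter> lattice_box N1 = {} \<Longrightarrow> (\<Sum>a\<in>F. wt (int_vec (a :: int ^ 'n))) < \<delta>"
    using wt_tail[OF \<delta>] by blast
  have Bd0: "Bd \<ge> 0" using Bd[of "{}" 0] by simp
  show ?thesis
  proof (intro exI[of _ N1] allI impI)
    fix N and t :: real and y assume N: "N1 \<le> N"
    let ?w = "(1 + \<bar>t\<bar>) ^ k"
    have w: "?w > 0" by (simp add: add_pos_nonneg)
    let ?h = "(0, A *v y) :: real \<times> (real ^ 'n)"
    let ?g = "\<lambda>p. g (p + ?h)"
    let ?\<psi> = "\<lambda>z. ?g (t, A *v z)"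
    have \<psi>: "?\<psi> z = g (t, A *v (y + z))" for z
      by (simp add: matrix_vector_right_distrib add.commute)
    have gs: "?g \<in> schwartz" by (rule schwartz_translate[OF g])
    obtain C where C: "C \<ge> 0" "\<And>z. cmod (?\<psi> z) \<le> C * wt z"
      "\<And>a x. (\<And>i. \<bar>x $ i\<bar> \<le> 1/2) \<Longrightarrow>
         cmod (?\<psi> (int_vec a + x) - ?\<psi> (int_vec a)) \<le> C * wt (int_vec a) * (\<Sum>i\<in>UNIV. \<bar>x $ i\<bar>)"
      using slice_lipschitz[OF gs, of t] by blast
    have "\<exists>N0. \<forall>N\<ge>N0. cmod (\<Sum>a\<in>lattice_box N. ?\<psi> (int_vec a)) \<le> Bd / ?w + \<epsilon> / (2 * ?w)"
    proof (rule poisson_inequality[OF _ C])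
      have g': "continuous_on UNIV ?g"
        using smooth_continuous_iter_deriv[of ?g "[]" UNIV] schwartz_smooth[OF gs] by simp
      have "continuous_on UNIV (\<lambda>y. (t, A *v y))" by (intro continuous_intros)
      from continuous_on_compose2[OF g' this] show "continuous_on UNIV ?\<psi>" by simp
      show "(\<Sum>\<xi>\<in>F. cmod (fourier ?\<psi> \<xi>)) \<le> Bd / ?w" if "finite F" for F
      proof -
        \<comment> \<open>A translation in space multiplies each coefficient by a number of modulus
          1, so the assumed bound applies to every translate.\<close>
        have "cmod (fourier ?\<psi> \<xi>) = cmod (FC g \<xi> t)" for \<xi>
          using FC_translate[OF g, of "A *v y" \<xi> t] by (simp add: FC_def norm_mult)
        then show ?thesis using Bd[OF that, of t] w by (simp add: pos_le_divide_eq mult.commute)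
      qed
      show "0 < \<epsilon> / (2 * ?w)" using \<epsilon> w by simp
    qed
    then obtain N0 where N0: "\<And>N. N \<ge> N0 \<Longrightarrow> cmod (\<Sum>a\<in>lattice_box N. ?\<psi> (int_vec a)) \<le> Bd / ?w + \<epsilon> / (2 * ?w)"
      by blast
    \<comment> \<open>\<open>N'\<close> passes the threshold belonging to this \<open>t\<close> and
      \<open>y\<close>; the difference to the cube of size \<open>N\<close> is the tail just
      described.\<close>
    define N' where "N' = max N N0"
    let ?R = "lattice_box N' - lattice_box N :: (int ^ 'n) set"
    have sub: "lattice_box N \<subseteq> (lattice_box N' :: (int ^ 'n) set)" by (rule lattice_box_mono) (simp add: N'_def)
    have "(\<Sum>a\<in>lattice_box N. ?\<psi> (int_vec a)) = (\<Sum>a\<in>lattice_box N'. ?\<psi> (int_vec a)) - (\<Sum>a\<in>?R. ?\<psi> (int_vec a))"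
      by (simp add: sum_diff[OF finite_lattice_box sub])
    then have 1: "cmod (\<Sum>a\<in>lattice_box N. ?\<psi> (int_vec a)) \<le> (Bd / ?w + \<epsilon> / (2 * ?w)) + (\<Sum>a\<in>?R. cmod (?\<psi> (int_vec a)))"
      using norm_triangle_ineq4[of "\<Sum>a\<in>lattice_box N'. ?\<psi> (int_vec a)" "\<Sum>a\<in>?R. ?\<psi> (int_vec a)"]
        N0[of N'] norm_sum[of "\<lambda>a. ?\<psi> (int_vec a)" ?R]
      by (simp add: N'_def)
    have 2: "?w * wt y * (\<Sum>a\<in>?R. cmod (?\<psi> (int_vec a))) \<le> \<epsilon> / 2"
    proof -
      have "?w * wt y * (\<Sum>a\<in>?R. cmod (?\<psi> (int_vec a))) = (\<Sum>a\<in>?R. wt y * (?w * cmod (?\<psi> (int_vec a))))"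
        by (simp add: sum_distrib_left mult_ac)
      also have "\<dots> \<le> (\<Sum>a\<in>?R. (?s * 2 ^ CARD('n)) * wt (int_vec a))"
      proof (rule sum_mono)
        fix a
        have "wt y * (?w * cmod (?\<psi> (int_vec a))) \<le> wt y * (?s * wt (y + int_vec a))"
          using K(2)[OF g, of "[]" t k "y + int_vec a"] unfolding \<psi> by (intro mult_left_mono wt_nonneg) simp
        also have "\<dots> = ?s * (wt (y + int_vec a) * wt y)" by simp
        also have "\<dots> \<le> ?s * (2 ^ CARD('n) * wt (int_vec a))" by (intro mult_left_mono wt_shift s0)
        finally show "wt y * (?w * cmod (?\<psi> (int_vec a))) \<le> (?s * 2 ^ CARD('n)) * wt (int_vec a)"
          by (simp add: mult.assoc)
      qed
      also have "\<dots> = (?s * 2 ^ CARD('n)) * (\<Sum>a\<in>?R. wt (int_vec a))" by (simp add: sum_distrib_left)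
      also have "\<dots> \<le> (?s * 2 ^ CARD('n)) * \<delta>"
      proof (intro mult_left_mono less_imp_le[OF N1])
        show "finite ?R" by (simp add: finite_lattice_box)
        show "?R \<inter> lattice_box N1 = {}" using lattice_box_mono[OF N] by blast
      qed (use s0 in simp)
      also have "\<dots> \<le> (?s * 2 ^ CARD('n) + 1) * \<delta>" using \<delta> by (intro mult_right_mono) auto
      also have "\<dots> = \<epsilon> / 2"
      proof -
        have "r * (\<epsilon> / (2 * r)) = \<epsilon> / 2" if "r > 0" for r :: real using that by simp
        from this[OF den] show ?thesis unfolding \<delta>_def .
      qed
      finally show ?thesis .
    qed
    have "?w * wt y * cmod (\<Sum>a\<in>lattice_box N. ?\<psi> (int_vec a)) \<le>
        ?w * wt y * ((Bd / ?w + \<epsilon> / (2 * ?w)) + (\<Sum>a\<in>?R. cmod (?\<psi> (int_vec a))))"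
      using w wt_nonneg[of y] by (intro mult_left_mono 1) simp
    also have "\<dots> = wt y * (Bd + \<epsilon> / 2) + ?w * wt y * (\<Sum>a\<in>?R. cmod (?\<psi> (int_vec a)))"
    proof -
      have "?w * wt y * (Bd / ?w + \<epsilon> / (2 * ?w)) = wt y * (Bd + \<epsilon> / 2)"
        using w by (simp add: field_simps)
      then show ?thesis by (simp only: distrib_left)
    qed
    also have "\<dots> \<le> 1 * (Bd + \<epsilon> / 2) + \<epsilon> / 2"
      using 2 Bd0 \<epsilon> wt_le_1[of y] by (intro add_mono mult_right_mono) auto
    finally show "?w * wt y * cmod (\<Sum>a\<in>lattice_box N. g (t, A *v (y + int_vec a))) \<le> Bd + \<epsilon>"
      unfolding \<psi> by simp
  qed
qed

text \<open>\<open>length w\<close> powers of the frequency pay for the space derivatives, and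
  \<open>2 * CARD('n)\<close> further ones make the sum over \<open>\<xi>\<close> converge, as the
  inverse of that power is at most \<open>wt\<close>.\<close>

lemma FC_iter_deriv_sum:
  assumes w: "w \<in> lists Basis"
  shows "\<exists>C\<ge>0. \<forall>f\<in>schwartz. \<forall>k F t. finite F \<longrightarrow> (1 + \<bar>t\<bar>) ^ k * (\<Sum>\<xi>\<in>F. cmod (FC (iter_deriv w f) \<xi> t))
     \<le> C * coeff_norm (length w + 2 * CARD('n)) k (length w) f"
proof -
  obtain us where us: "w = map unit_vec us" using lists_Basis_unit_vec[OF w] .
  obtain c where c: "c \<ge> 0" "\<And>\<xi> j. \<bar>(B *v int_vec \<xi>) $ j\<bar> \<le> c * norm1 \<xi>" using dual_le_norm1 by blast
  let ?c = "1 + c"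
  obtain W where W: "W > 0" "\<And>F. finite F \<Longrightarrow> (\<Sum>a\<in>F. wt (int_vec (a :: int ^ 'n))) \<le> W"
    using sum_wt_bounded by blast
  have fac: "cmod (dual_factor \<xi> v) \<le> ?c * (1 + norm1 \<xi>)" for \<xi> v
  proof (cases v)
    case None
    have "1 * 1 \<le> ?c * (1 + norm1 \<xi>)" using c(1) norm1_nonneg[of \<xi>] by (intro mult_mono) auto
    with None show ?thesis by simp
  next
    case (Some j)
    have "cmod (dual_factor \<xi> v) = \<bar>(B *v int_vec \<xi>) $ j\<bar>" by (simp add: Some norm_mult)
    also have "\<dots> \<le> c * norm1 \<xi>" by (rule c(2))
    also have "\<dots> \<le> ?c * (1 + norm1 \<xi>)" using c(1) norm1_nonneg[of \<xi>] by (intro mult_mono) auto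
    finally show ?thesis .
  qed
  have prod: "cmod (\<Prod>v\<leftarrow>vs. dual_factor \<xi> v) \<le> (?c * (1 + norm1 \<xi>)) ^ length vs" for \<xi> vs
  proof (induction vs)
    case (Cons v vs)
    then show ?case using fac[of \<xi> v] c(1) norm1_nonneg[of \<xi>]
      by (simp add: norm_mult) (intro mult_mono, auto)
  qed simp
  have wt1: "1 \<le> (1 + norm1 \<xi>) ^ (2 * CARD('n)) * wt (int_vec \<xi>)" for \<xi> :: "int ^ 'n"
  proof -
    have "norm (int_vec \<xi>) \<le> norm1 \<xi>"
      using norm_le_l1_cart[of "int_vec \<xi>"] by (simp add: norm1_def int_vec_def)
    then have "inverse ((1 + norm1 \<xi>) ^ (2 * CARD('n))) \<le> inverse ((1 + norm (int_vec \<xi>)) ^ (2 * CARD('n)))"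
      by (intro le_imp_inverse_le power_mono zero_less_power) (auto simp: add_pos_nonneg)
    also have "\<dots> \<le> wt (int_vec \<xi>)" by (rule inverse_power_le_wt)
    finally have "(1 + norm1 \<xi>) ^ (2 * CARD('n)) * inverse ((1 + norm1 \<xi>) ^ (2 * CARD('n))) \<le>
        (1 + norm1 \<xi>) ^ (2 * CARD('n)) * wt (int_vec \<xi>)"
      using norm1_nonneg[of \<xi>] by (intro mult_left_mono) auto
    moreover have "(1 + norm1 \<xi>) ^ (2 * CARD('n)) * inverse ((1 + norm1 \<xi>) ^ (2 * CARD('n))) = 1"
      using norm1_nonneg[of \<xi>] by (intro right_inverse) simp
    ultimately show ?thesis by linarith
  qed
  show ?thesis
  proof (intro exI[of _ "?c ^ length us * W"] conjI ballI allI impI)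
    show "0 \<le> ?c ^ length us * W" using c(1) W(1) by simp
    fix f :: "real \<times> (real ^ 'n) \<Rightarrow> complex" and k F t
    assume f: "f \<in> schwartz" and F: "finite (F :: (int ^ 'n) set)"
    let ?l = "count_list us None"
    let ?Q = "coeff_norm (length us + 2 * CARD('n)) k (length us) f"
    have "(1 + \<bar>t\<bar>) ^ k * (\<Sum>\<xi>\<in>F. cmod (FC (iter_deriv w f) \<xi> t)) = (\<Sum>\<xi>\<in>F. (1 + \<bar>t\<bar>) ^ k * cmod (FC (iter_deriv w f) \<xi> t))"
      by (rule sum_distrib_left)
    also have "\<dots> \<le> (\<Sum>\<xi>\<in>F. (?c ^ length us * ?Q) * wt (int_vec \<xi>))"
    proof (rule sum_mono)
      fix \<xi>
      let ?n = "1 + norm1 \<xi>" and ?X = "(1 + \<bar>t\<bar>) ^ k * cmod (FC (time_deriv ?l f) \<xi> t)"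
      have n: "?n \<ge> 0" using norm1_nonneg[of \<xi>] by simp
      have "(1 + \<bar>t\<bar>) ^ k * cmod (FC (iter_deriv w f) \<xi> t) = cmod (\<Prod>v\<leftarrow>us. dual_factor \<xi> v) * ?X"
        unfolding us FC_iter_deriv[OF f] norm_mult by simp
      also have "\<dots> \<le> (?c * ?n) ^ length us * ?X" by (intro mult_right_mono prod) simp
      also have "\<dots> = ((?c * ?n) ^ length us * ?X) * 1" by simp
      also have "\<dots> \<le> ((?c * ?n) ^ length us * ?X) * (?n ^ (2 * CARD('n)) * wt (int_vec \<xi>))"
        using c(1) n by (intro mult_left_mono wt1 mult_nonneg_nonneg) auto
      also have "\<dots> = (?c ^ length us * wt (int_vec \<xi>)) * (?n ^ (length us + 2 * CARD('n)) * (1 + \<bar>t\<bar>) ^ k * cmod (FC (time_deriv ?l f) \<xi> t))"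
        by (simp only: power_mult_distrib power_add mult_ac)
      also have "\<dots> \<le> (?c ^ length us * wt (int_vec \<xi>)) * ?Q"
        using c(1) by (intro mult_left_mono coeff_norm_upper f mult_nonneg_nonneg wt_nonneg)
          (auto simp: count_le_length)
      finally show "(1 + \<bar>t\<bar>) ^ k * cmod (FC (iter_deriv w f) \<xi> t) \<le> (?c ^ length us * ?Q) * wt (int_vec \<xi>)"
        by (simp add: mult_ac)
    qed
    also have "\<dots> = (?c ^ length us * ?Q) * (\<Sum>\<xi>\<in>F. wt (int_vec \<xi>))" by (simp add: sum_distrib_left)
    also have "\<dots> \<le> (?c ^ length us * ?Q) * W"
      using c(1) by (intro mult_left_mono W(2) F mult_nonneg_nonneg coeff_norm_nonneg f) auto
    finally show "(1 + \<bar>t\<bar>) ^ k * (\<Sum>\<xi>\<in>F. cmod (FC (iter_deriv w f) \<xi> t))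
     \<le> ?c ^ length us * W * coeff_norm (length w + 2 * CARD('n)) k (length w) f"
      by (simp add: us mult_ac)
  qed
qed

end

section \<open>Periodization against one bump\<close>

lemma bounded_derivs_reindex:
  assumes "bounded_derivs W F"
  shows "bounded_derivs (\<lambda>j. W (h j)) (\<lambda>j. F (h j))"
  using assms unfolding bounded_derivs_def by blast

lemma one_plus_sum_le_prod:
  fixes f :: "'i \<Rightarrow> real"
  assumes "finite I" "\<And>i. f i \<ge> 0"
  shows "1 + (\<Sum>i\<in>I. f i) \<le> (\<Prod>i\<in>I. 1 + f i)"
  using assms(1)
proof (induction I)
  case (insert i I)
  have "1 \<le> (\<Prod>i\<in>I. 1 + f i)" using assms(2) by (intro prod_ge_1) simp
  then have "f i * 1 \<le> f i * (\<Prod>i\<in>I. 1 + f i)" using assms(2) by (intro mult_left_mono) auto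
  with insert show ?case by (simp add: distrib_right)
qed simp

lemma sum_logistic_telescope:
  "(\<Sum>k\<in>{- int N..int N}. logistic (s - real_of_int k + 1) - logistic (s - real_of_int k + 0)) =
     logistic (s + (real N + 1)) - logistic (s + - real N)"
proof (induction N)
  case 0
  then show ?case by simp
next
  case (Suc N)
  have "{- int (Suc N)..int (Suc N)} = insert (int N + 1) (insert (- int N - 1) {- int N..int N})"
    by auto
  then show ?case using Suc by (simp add: algebra_simps)
qed

context lattice begin

definition coord :: "'n \<Rightarrow> real \<times> (real ^ 'n) \<Rightarrow> real" where
  "coord i p = inv_A (snd p) $ i"

lemma bounded_linear_coord: "bounded_linear (coord i)"
proof -
  have "bounded_linear inv_A" by (simp add: linear_linear matrix_vector_mul_linear)
  from bounded_linear_compose[OF bounded_linear_vec_nth bounded_linear_compose[OF this bounded_linear_snd]]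
  show ?thesis unfolding coord_def[abs_def] .
qed

lemma sum_bump:
  "(\<Sum>a\<in>lattice_box N. bump coord (p - (0, A *v int_vec a))) = plateau coord N p"
proof -
  have "coord i (p - (0, A *v int_vec a)) = coord i p - real_of_int (a $ i)" for i and a :: "int ^ 'n"
    by (simp add: coord_def matrix_vector_mult_diff_distrib inv_A_A) (simp add: int_vec_def)
  then have "(\<Sum>a\<in>lattice_box N. bump coord (p - (0, A *v int_vec a))) = (\<Sum>a\<in>lattice_box N. \<Prod>i\<in>UNIV.
      logistic (coord i p - real_of_int (a $ i) + 1) - logistic (coord i p - real_of_int (a $ i) + 0))"
    by (simp only: bump_def)
  also have "\<dots> = (\<Prod>i\<in>UNIV. \<Sum>k\<in>{- int N..int N}.
      logistic (coord i p - real_of_int k + 1) - logistic (coord i p - real_of_int k + 0))"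
    by (rule sum_lattice_box)
  finally show ?thesis by (simp only: sum_logistic_telescope plateau_def)
qed

abbreviation bumpc :: "real \<times> (real ^ 'n) \<Rightarrow> complex" where
  "bumpc p \<equiv> complex_of_real (bump coord p)"

lemma smooth_bumpc: "smooth bumpc"
  using bounded_derivs_smooth[OF bounded_derivs_bump[where l = coord and K = 0, OF bounded_linear_coord]] .

lemma schwartz_bump_mult:
  assumes "f \<in> schwartz" shows "(\<lambda>p. bumpc p * f p) \<in> schwartz"
proof (rule schwartz_mult_left[OF bounded_derivs_mono[OF bounded_derivs_bump[where l = coord and K = 0, OF bounded_linear_coord], of 1]])
qed (use assms in auto)

lemma schwartz_plateau_mult:
  assumes "f \<in> schwartz" shows "(\<lambda>p. complex_of_real (plateau coord N p) * f p) \<in> schwartz"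
  using bounded_derivs_reindex[OF bounded_derivs_plateau[of coord, OF bounded_linear_coord], of "\<lambda>_. N"] assms
  by (intro schwartz_mult_left) auto

text \<open>One power of decay of \<open>f\<close> beyond \<open>k\<close> pays for the factor
  \<open>1 + norm x\<close> in the bound for the complement of the plateau.\<close>

lemma plateau_seminorm:
  assumes f: "f \<in> schwartz" and vs: "vs \<in> lists Basis"
  shows "\<exists>C. \<forall>N. schwartz_seminorm (k, vs) (\<lambda>p. f p - complex_of_real (plateau coord N p) * f p) \<le> C / (real N + 1)"
proof -
  have "bounded_derivs (\<lambda>N x. (1 + norm x) / (real N + 1) * inverse ((1 + norm x) ^ Suc k))
     (\<lambda>N p. complex_of_real (1 - plateau coord N p) * f p)"
    by (rule bounded_derivs_mult[OF bounded_derivs_one_minus_plateau[OF bounded_linear_coord] schwartz_bounded_derivs[OF f]])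
  then obtain C where C: "\<And>N x. cmod (iter_deriv vs (\<lambda>p. complex_of_real (1 - plateau coord N p) * f p) x) \<le>
      C * ((1 + norm x) / (real N + 1) * inverse ((1 + norm x) ^ Suc k))"
    using vs by (rule bounded_derivsE) blast
  show ?thesis
  proof (intro exI allI schwartz_seminorm_least)
    fix N and x :: "real \<times> (real ^ 'n)"
    have e: "(\<lambda>p. f p - complex_of_real (plateau coord N p) * f p) = (\<lambda>p. complex_of_real (1 - plateau coord N p) * f p)"
      by (simp add: left_diff_distrib)
    have gen: "X ^ k * (C * (X / (real N + 1) * inverse (X ^ Suc k))) = C / (real N + 1)" if "X > 0" for X :: real
      using that by (simp add: divide_simps)
    have "(1 + norm x) ^ k * cmod (iter_deriv vs (\<lambda>p. complex_of_real (1 - plateau coord N p) * f p) x) \<le>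
        (1 + norm x) ^ k * (C * ((1 + norm x) / (real N + 1) * inverse ((1 + norm x) ^ Suc k)))"
      by (intro mult_left_mono C) simp
    also have "\<dots> = C / (real N + 1)" by (rule gen) (simp add: add_pos_nonneg)
    finally show "(1 + norm x) ^ k * cmod (iter_deriv vs (\<lambda>p. f p - complex_of_real (plateau coord N p) * f p) x)
        \<le> C / (real N + 1)" unfolding e .
  qed
qed

lemma tempered_plateau_limit:
  assumes T: "T \<in> tempered" and f: "f \<in> schwartz"
  shows "(\<lambda>N. T (\<lambda>p. complex_of_real (plateau coord N p) * f p)) \<longlonglongrightarrow> T f"
proof -
  obtain C F where F: "C \<ge> 0" "finite F" "F \<subseteq> UNIV \<times> lists Basis"
    "\<And>f. f \<in> schwartz \<Longrightarrow> cmod (T f) \<le> C * (\<Sum>r\<in>F. schwartz_seminorm r f)"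
    using tempered_bounded[OF T] by (rule seminorm_boundedE) (rule that)
  let ?d = "\<lambda>N p. f p - complex_of_real (plateau coord N p) * f p"
  have "\<exists>D. \<forall>N. schwartz_seminorm r (?d N) \<le> D / (real N + 1)" if rF: "r \<in> F" for r
  proof -
    obtain k vs where r: "r = (k, vs)" "vs \<in> lists Basis" by (rule seminorm_indexE[OF F(3) rF])
    then show ?thesis using plateau_seminorm[OF f, of vs k] by simp
  qed
  then obtain D where D: "\<And>r N. r \<in> F \<Longrightarrow> schwartz_seminorm r (?d N) \<le> D r / (real N + 1)" by metis
  have b: "cmod (T (\<lambda>p. complex_of_real (plateau coord N p) * f p) - T f) \<le> (C * (\<Sum>r\<in>F. D r)) * (1 / (real N + 1))" for N
  proof -
    have "cmod (T (\<lambda>p. complex_of_real (plateau coord N p) * f p) - T f) = cmod (T (?d N))"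
      by (simp add: tempered_diff[OF T f schwartz_plateau_mult[OF f]] norm_minus_commute)
    also have "\<dots> \<le> C * (\<Sum>r\<in>F. schwartz_seminorm r (?d N))"
      by (intro F(4) schwartz_diff f schwartz_plateau_mult)
    also have "\<dots> \<le> C * (\<Sum>r\<in>F. D r / (real N + 1))"
      by (intro mult_left_mono sum_mono D F(1))
    finally show ?thesis by (simp add: sum_divide_distrib[symmetric])
  qed
  have "(\<lambda>N. 1 / (real N + 1)) \<longlonglongrightarrow> 0"
    using LIMSEQ_inverse_real_of_nat by (simp add: inverse_eq_divide add.commute)
  then have "(\<lambda>N. (C * (\<Sum>r\<in>F. D r)) * (1 / (real N + 1))) \<longlonglongrightarrow> (C * (\<Sum>r\<in>F. D r)) * 0"
    by (rule tendsto_mult_left)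
  then have "(\<lambda>N. T (\<lambda>p. complex_of_real (plateau coord N p) * f p) - T f) \<longlonglongrightarrow> 0"
    by (intro Lim_null_comparison[OF always_eventually[OF allI[OF b]]]) simp
  then show ?thesis by (simp add: LIM_zero_iff)
qed

definition partial_period :: "nat \<Rightarrow> (real \<times> (real ^ 'n) \<Rightarrow> complex) \<Rightarrow> real \<times> (real ^ 'n) \<Rightarrow> complex" where
  "partial_period N f p = (\<Sum>a\<in>lattice_box N. f (p + (0, A *v int_vec a)))"

lemma schwartz_partial_period: "f \<in> schwartz \<Longrightarrow> partial_period N f \<in> schwartz"
  unfolding partial_period_def[abs_def] by (intro schwartz_sum schwartz_translate)

lemma iter_deriv_partial_period:
  assumes f: "f \<in> schwartz" and w: "w \<in> lists Basis"
  shows "iter_deriv w (partial_period N f) = partial_period N (iter_deriv w f)"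
proof -
  have "iter_deriv w (partial_period N f) = (\<lambda>x. \<Sum>a\<in>lattice_box N. iter_deriv w (\<lambda>p. f (p + (0, A *v int_vec a))) x)"
    unfolding partial_period_def[abs_def]
    by (rule iter_deriv_sum[OF finite_lattice_box smooth_translate[OF schwartz_smooth[OF f]] w])
  then show ?thesis
    by (simp add: partial_period_def[abs_def] iter_deriv_translate[OF schwartz_smooth[OF f] w])
qed

lemma int_vec_minus: "int_vec (- a) = - int_vec a"
  by (simp add: int_vec_def vec_eq_iff)

lemma periodic_translate:
  assumes T: "T \<in> periodic_tempered A" and f: "f \<in> schwartz"
  shows "T (\<lambda>p. f (p + (0, A *v int_vec a))) = T f"
proof -
  \<comment> \<open>Translating a distribution moves test functions in the opposite direction, so
    invariance is used for \<open>- a\<close>.\<close>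
  have "dist_translate (0, A *v int_vec (- a)) T = T"
    using T unfolding periodic_tempered_def by blast
  then have "T f = dist_translate (0, A *v int_vec (- a)) T f" by simp
  also have "\<dots> = T (\<lambda>y. f (y - (0, A *v int_vec (- a))))"
    using f by (simp add: dist_translate_def)
  also have "(\<lambda>y. f (y - (0, A *v int_vec (- a)))) = (\<lambda>p. f (p + (0, A *v int_vec a)))"
    by (simp add: int_vec_minus linear_neg[OF matrix_vector_mul_linear] diff_conv_add_uminus del: add_uminus_conv_diff)
  finally show ?thesis ..
qed

text \<open>Invariance is applied to each summand, which shifts the translation from the bump to
  \<open>f\<close>. In this way a truncated periodization appears inside \<open>T\<close>, protected
  by a fixed bump.\<close>

lemma periodic_plateau:
  assumes T: "T \<in> periodic_tempered A" and f: "f \<in> schwartz"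
  shows "T (\<lambda>p. complex_of_real (plateau coord N p) * f p) = T (\<lambda>p. bumpc p * partial_period N f p)"
proof -
  have tT: "T \<in> tempered" using T by (simp add: periodic_tempered_def)
  let ?h = "\<lambda>a. (0, A *v int_vec a) :: real \<times> (real ^ 'n)"
  have s1: "(\<lambda>p. bumpc p * f (p + ?h a)) \<in> schwartz" for a
    by (intro schwartz_bump_mult schwartz_translate f)
  have s2: "(\<lambda>p. bumpc (p - ?h a) * f p) \<in> schwartz" for a
    using schwartz_translate_diff[OF s1[of a], of "?h a"] by simp
  have "(\<lambda>p. complex_of_real (plateau coord N p) * f p) = (\<lambda>p. \<Sum>a\<in>lattice_box N. bumpc (p - ?h a) * f p)"
    unfolding sum_bump[symmetric] by (simp add: sum_distrib_right)
  then have "T (\<lambda>p. complex_of_real (plateau coord N p) * f p) = (\<Sum>a\<in>lattice_box N. T (\<lambda>p. bumpc (p - ?h a) * f p))"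
    by (simp only: tempered_sum[OF tT finite_lattice_box s2])
  also have "\<dots> = (\<Sum>a\<in>lattice_box N. T (\<lambda>p. bumpc p * f (p + ?h a)))"
  proof (rule sum.cong[OF refl])
    fix a :: "int ^ 'n"
    have "T (\<lambda>p. bumpc (p - ?h a) * f p) = T (\<lambda>p. bumpc ((p + ?h a) - ?h a) * f (p + ?h a))"
      by (rule periodic_translate[OF T s2, symmetric])
    then show "T (\<lambda>p. bumpc (p - ?h a) * f p) = T (\<lambda>p. bumpc p * f (p + ?h a))"
      by (simp only: add_diff_cancel_right')
  qed
  also have "\<dots> = T (\<lambda>p. \<Sum>a\<in>lattice_box N. bumpc p * f (p + ?h a))"
    by (rule tempered_sum[OF tT finite_lattice_box s1, symmetric])
  finally show ?thesis by (simp only: partial_period_def sum_distrib_left)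
qed

lemma bump_decay:
  assumes u: "u \<in> lists Basis"
  obtains C where "C \<ge> 0"
    "\<And>t y. (1 + norm (t, A *v y)) ^ k * cmod (iter_deriv u bumpc (t, A *v y)) \<le> C * ((1 + \<bar>t\<bar>) ^ k * wt y)"
proof -
  have "bounded_linear ((*v) A)" by (simp add: linear_linear matrix_vector_mul_linear)
  then obtain L where L: "\<And>x. norm (A *v x) \<le> norm x * L" "L > 0"
    using bounded_linear.pos_bounded by metis
  \<comment> \<open>Of the \<open>k + 2\<close> powers of decay in each coordinate, \<open>k\<close>
    compensate the growth of \<open>(1 + norm p)^k\<close> in space, and the remaining two give
    \<open>wt\<close>.\<close>
  obtain C where C: "C \<ge> 0"
    "\<And>x. cmod (iter_deriv u bumpc x) \<le> C * (\<Prod>i\<in>UNIV. inverse ((1 + \<bar>coord i x\<bar>) ^ (k + 2)))"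
    using bounded_derivsE[OF bounded_derivs_bump[of coord, OF bounded_linear_coord, of "k + 2"] u] by metis
  show thesis
  proof (rule that)
    show "0 \<le> (1 + L) ^ k * C" using L(2) C(1) by simp
    fix t :: real and y :: "real ^ 'n"
    let ?p = "\<Prod>i\<in>UNIV. 1 + \<bar>y $ i\<bar>"
    have p1: "1 \<le> ?p" by (intro prod_ge_1) simp
    have y: "1 + norm y \<le> ?p"
      using norm_le_l1_cart[of y] one_plus_sum_le_prod[of UNIV "\<lambda>i. \<bar>y $ i\<bar>"] by simp
    have "1 + norm (t, A *v y) \<le> (1 + \<bar>t\<bar>) * (1 + norm (A *v y))"
    proof -
      have "norm (t, A *v y) \<le> \<bar>t\<bar> + norm (A *v y)" using norm_Pair_le[of t "A *v y"] by simp
      moreover have "0 \<le> \<bar>t\<bar> * norm (A *v y)" by simp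
      ultimately show ?thesis unfolding distrib_left distrib_right mult_1 mult_1_right by linarith
    qed
    also have "\<dots> \<le> (1 + \<bar>t\<bar>) * ((1 + L) * ?p)"
    proof (rule mult_left_mono)
      have "1 + norm (A *v y) \<le> (1 + L) * (1 + norm y)"
        using L(1)[of y] L(2) norm_ge_zero[of y]
        unfolding distrib_left distrib_right mult_1 mult_1_right mult.commute[of L] by linarith
      also have "\<dots> \<le> (1 + L) * ?p" using L(2) y by (intro mult_left_mono) auto
      finally show "1 + norm (A *v y) \<le> (1 + L) * ?p" .
    qed simp
    finally have "(1 + norm (t, A *v y)) ^ k \<le> ((1 + \<bar>t\<bar>) * ((1 + L) * ?p)) ^ k"
      by (rule power_mono) simp
    moreover have "cmod (iter_deriv u bumpc (t, A *v y)) \<le> C * inverse (?p ^ (k + 2))"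
      using C(2)[of "(t, A *v y)"]
      by (simp add: coord_def inv_A_A prod_inversef[symmetric, unfolded comp_def] prod_power_distrib del: power_Suc)
    ultimately have "(1 + norm (t, A *v y)) ^ k * cmod (iter_deriv u bumpc (t, A *v y)) \<le>
        ((1 + \<bar>t\<bar>) * ((1 + L) * ?p)) ^ k * (C * inverse (?p ^ (k + 2)))"
      using L(2) p1 by (intro mult_mono) auto
    also have "\<dots> = ((1 + L) ^ k * C) * ((1 + \<bar>t\<bar>) ^ k * inverse (?p\<^sup>2))"
    proof -
      have "(T * (L' * q)) ^ k * (C * inverse (q ^ (k + 2))) = (L' ^ k * C) * (T ^ k * inverse (q\<^sup>2))"
        if "q > 0" for T L' q :: real
        using that by (simp add: power_mult_distrib power_add divide_simps power2_eq_square)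
      from this[of ?p "1 + \<bar>t\<bar>" "1 + L"] p1 show ?thesis by simp
    qed
    also have "\<dots> \<le> ((1 + L) ^ k * C) * ((1 + \<bar>t\<bar>) ^ k * wt y)"
    proof (intro mult_left_mono)
      have "(\<Prod>i\<in>UNIV. inverse ((1 + \<bar>y $ i\<bar>)\<^sup>2)) \<le> wt y"
        unfolding wt_def
      proof (intro prod_mono conjI le_imp_inverse_le)
        fix i
        show "1 + (y $ i)\<^sup>2 \<le> (1 + \<bar>y $ i\<bar>)\<^sup>2" by (simp add: power2_sum)
      qed (auto simp: add_pos_nonneg)
      then show "inverse (?p\<^sup>2) \<le> wt y"
        by (simp add: prod_inversef[symmetric, unfolded comp_def] prod_power_distrib)
    qed (use L(2) C(1) in auto)
    finally show "(1 + norm (t, A *v y)) ^ k * cmod (iter_deriv u bumpc (t, A *v y)) \<le>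
        ((1 + L) ^ k * C) * ((1 + \<bar>t\<bar>) ^ k * wt y)" .
  qed
qed

text \<open>Bump decay supplies exactly the factor \<open>(1 + \<bar>t\<bar>)^k * wt y\<close> under
  which the Poisson bound is uniform. \<open>C\<close> is the same for all \<open>f\<close>, whereas
  the threshold may depend on \<open>f\<close> and \<open>\<epsilon>\<close>: the limit in
  \<open>N\<close> is taken later with \<open>f\<close> fixed.\<close>

lemma bump_period_term:
  assumes u: "u \<in> lists Basis" and w: "w \<in> lists Basis"
  shows "\<exists>C\<ge>0. \<forall>f\<in>schwartz. \<forall>\<epsilon>>0. \<exists>N1. \<forall>N\<ge>N1. \<forall>p.
     (1 + norm p) ^ k * cmod (iter_deriv u bumpc p * iter_deriv w (partial_period N f) p)
       \<le> C * coeff_norm (length w + 2 * CARD('n)) k (length w) f + \<epsilon>"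
proof -
  obtain C where C: "C \<ge> 0"
    "\<And>t y. (1 + norm (t, A *v y)) ^ k * cmod (iter_deriv u bumpc (t, A *v y)) \<le> C * ((1 + \<bar>t\<bar>) ^ k * wt y)"
    using bump_decay[OF u, of k] by blast
  obtain D where D: "D \<ge> 0" "\<And>f F t. f \<in> schwartz \<Longrightarrow> finite F \<Longrightarrow>
     (1 + \<bar>t\<bar>) ^ k * (\<Sum>\<xi>\<in>F. cmod (FC (iter_deriv w f) \<xi> t)) \<le> D * coeff_norm (length w + 2 * CARD('n)) k (length w) f"
    using FC_iter_deriv_sum[OF w] by metis
  show ?thesis
  proof (intro exI[of _ "C * D"] conjI ballI allI impI)
    show "0 \<le> C * D" using C(1) D(1) by simp
    fix f :: "real \<times> (real ^ 'n) \<Rightarrow> complex" and \<epsilon> :: real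
    assume f: "f \<in> schwartz" and \<epsilon>: "0 < \<epsilon>"
    let ?Q = "coeff_norm (length w + 2 * CARD('n)) k (length w) f"
    let ?e = "\<epsilon> / (C + 1)"
    have e: "?e > 0" using \<epsilon> C(1) by simp
    obtain N1 where N1: "\<And>N t y. N \<ge> N1 \<Longrightarrow> (1 + \<bar>t\<bar>) ^ k * wt y *
       cmod (\<Sum>a\<in>lattice_box N. iter_deriv w f (t, A *v (y + int_vec a))) \<le> D * ?Q + ?e"
      using poisson_slice[OF schwartz_iter_deriv[OF f w] D(2)[OF f] e] by metis
    show "\<exists>N1. \<forall>N\<ge>N1. \<forall>p. (1 + norm p) ^ k * cmod (iter_deriv u bumpc p * iter_deriv w (partial_period N f) p)
       \<le> C * D * ?Q + \<epsilon>"
    proof (intro exI[of _ N1] allI impI)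
      fix N and p :: "real \<times> (real ^ 'n)" assume N: "N1 \<le> N"
      obtain t x where tx: "p = (t, x)" by (cases p)
      define y where "y = inv_A x"
      have p: "p = (t, A *v y)" by (simp add: tx y_def A_inv_A)
      have pp: "iter_deriv w (partial_period N f) p = (\<Sum>a\<in>lattice_box N. iter_deriv w f (t, A *v (y + int_vec a)))"
        unfolding iter_deriv_partial_period[OF f w] partial_period_def p by (simp add: matrix_vector_right_distrib)
      have "(1 + norm p) ^ k * cmod (iter_deriv u bumpc p * iter_deriv w (partial_period N f) p) =
          ((1 + norm p) ^ k * cmod (iter_deriv u bumpc p)) * cmod (iter_deriv w (partial_period N f) p)"
        by (simp add: norm_mult)
      also have "\<dots> \<le> (C * ((1 + \<bar>t\<bar>) ^ k * wt y)) * cmod (iter_deriv w (partial_period N f) p)"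
        unfolding p by (intro mult_right_mono C(2)) simp
      also have "\<dots> = C * ((1 + \<bar>t\<bar>) ^ k * wt y * cmod (\<Sum>a\<in>lattice_box N. iter_deriv w f (t, A *v (y + int_vec a))))"
        unfolding pp by simp
      also have "\<dots> \<le> C * (D * ?Q + ?e)" by (intro mult_left_mono N1 N C(1))
      also have "\<dots> \<le> C * D * ?Q + \<epsilon>"
      proof -
        have "C * ?e \<le> (C + 1) * ?e" using e by (intro mult_right_mono) auto
        also have "\<dots> = \<epsilon>" using C(1) by simp
        finally show ?thesis by (simp add: distrib_left mult.assoc)
      qed
      finally show "(1 + norm p) ^ k * cmod (iter_deriv u bumpc p * iter_deriv w (partial_period N f) p) \<le> C * D * ?Q + \<epsilon>" .
    qed
  qed
qed

lemma bump_period_seminorm: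
  assumes vs: "vs \<in> lists Basis"
  shows "\<exists>C\<ge>0. \<forall>f\<in>schwartz. \<forall>\<epsilon>>0. \<exists>N1. \<forall>N\<ge>N1.
     schwartz_seminorm (k, vs) (\<lambda>p. bumpc p * partial_period N f p)
       \<le> C * coeff_norm (length vs + 2 * CARD('n)) k (length vs) f + \<epsilon>"
proof -
  let ?Q = "\<lambda>f. coeff_norm (length vs + 2 * CARD('n)) k (length vs) f"
  \<comment> \<open>As in the product rule for bounds, the induction is over arbitrary lists of
    splittings; \<open>\<epsilon>\<close> is halved for each further term.\<close>
  have "\<exists>C\<ge>0. \<forall>f\<in>schwartz. \<forall>\<epsilon>>0. \<exists>N1. \<forall>N\<ge>N1. \<forall>p.
     (1 + norm p) ^ k * (\<Sum>q\<leftarrow>qs. cmod (iter_deriv (fst q) bumpc p * iter_deriv (snd q) (partial_period N f) p))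
       \<le> C * ?Q f + \<epsilon>"
    if "set qs \<subseteq> set (splits vs)" for qs
    using that
  proof (induction qs)
    case Nil
    show ?case by (intro exI[of _ 0]) auto
  next
    case (Cons q qs)
    then have q: "q \<in> set (splits vs)" by simp
    note uw = splits_lists[OF vs q]
    from Cons obtain C where C: "C \<ge> 0" "\<And>f \<epsilon>. f \<in> schwartz \<Longrightarrow> \<epsilon> > 0 \<Longrightarrow> \<exists>N1. \<forall>N\<ge>N1. \<forall>p.
     (1 + norm p) ^ k * (\<Sum>q\<leftarrow>qs. cmod (iter_deriv (fst q) bumpc p * iter_deriv (snd q) (partial_period N f) p))
       \<le> C * ?Q f + \<epsilon>" by auto
    obtain D where D: "D \<ge> 0" "\<And>f \<epsilon>. f \<in> schwartz \<Longrightarrow> \<epsilon> > 0 \<Longrightarrow> \<exists>N1. \<forall>N\<ge>N1. \<forall>p.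
     (1 + norm p) ^ k * cmod (iter_deriv (fst q) bumpc p * iter_deriv (snd q) (partial_period N f) p)
       \<le> D * coeff_norm (length (snd q) + 2 * CARD('n)) k (length (snd q)) f + \<epsilon>"
      using bump_period_term[OF uw, of k] by auto
    let ?L = "real (length (snd q)) + 1"
    show ?case
    proof (intro exI[of _ "D * ?L + C"] conjI ballI allI impI)
      show "0 \<le> D * ?L + C" using C(1) D(1) by simp
      fix f :: "real \<times> (real ^ 'n) \<Rightarrow> complex" and \<epsilon> :: real
      assume f: "f \<in> schwartz" and \<epsilon>: "0 < \<epsilon>"
      have e2: "\<epsilon> / 2 > 0" using \<epsilon> by simp
      obtain N1 where N1: "\<And>N p. N \<ge> N1 \<Longrightarrow> (1 + norm p) ^ k *
         (\<Sum>q\<leftarrow>qs. cmod (iter_deriv (fst q) bumpc p * iter_deriv (snd q) (partial_period N f) p)) \<le> C * ?Q f + \<epsilon> / 2"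
        using C(2)[OF f e2] by blast
      obtain N2 where N2: "\<And>N p. N \<ge> N2 \<Longrightarrow> (1 + norm p) ^ k *
         cmod (iter_deriv (fst q) bumpc p * iter_deriv (snd q) (partial_period N f) p)
           \<le> D * coeff_norm (length (snd q) + 2 * CARD('n)) k (length (snd q)) f + \<epsilon> / 2"
        using D(2)[OF f e2] by blast
      have "coeff_norm (length (snd q) + 2 * CARD('n)) k (length (snd q)) f \<le> ?L * ?Q f"
        using splits_length[OF q] by (intro coeff_norm_mono f) auto
      then have DQ: "D * coeff_norm (length (snd q) + 2 * CARD('n)) k (length (snd q)) f \<le> D * ?L * ?Q f"
        using D(1) by (simp add: mult_left_mono mult.assoc)
      show "\<exists>N1. \<forall>N\<ge>N1. \<forall>p. (1 + norm p) ^ k *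
         (\<Sum>q\<leftarrow>q # qs. cmod (iter_deriv (fst q) bumpc p * iter_deriv (snd q) (partial_period N f) p))
           \<le> (D * ?L + C) * ?Q f + \<epsilon>"
      proof (intro exI[of _ "max N1 N2"] allI impI)
        fix N p assume "max N1 N2 \<le> N"
        then have "N1 \<le> N" "N2 \<le> N" by auto
        from N1[OF this(1), of p] N2[OF this(2), of p] DQ
        show "(1 + norm p) ^ k *
         (\<Sum>q\<leftarrow>q # qs. cmod (iter_deriv (fst q) bumpc p * iter_deriv (snd q) (partial_period N f) p))
           \<le> (D * ?L + C) * ?Q f + \<epsilon>"
          using distrib_right[of "D * ?L" C "?Q f"]
          unfolding list.map sum_list.Cons distrib_left[of "(1 + norm p) ^ k"] by linarith
      qed
    qed
  qed
  from this[of "splits vs"] obtain C where C: "C \<ge> 0" "\<And>f \<epsilon>. f \<in> schwartz \<Longrightarrow> \<epsilon> > 0 \<Longrightarrow> \<exists>N1. \<forall>N\<ge>N1. \<forall>p.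
     (1 + norm p) ^ k * (\<Sum>q\<leftarrow>splits vs. cmod (iter_deriv (fst q) bumpc p * iter_deriv (snd q) (partial_period N f) p))
       \<le> C * ?Q f + \<epsilon>" by auto
  show ?thesis
  proof (intro exI[of _ C] conjI ballI allI impI C(1))
    fix f :: "real \<times> (real ^ 'n) \<Rightarrow> complex" and \<epsilon> :: real
    assume f: "f \<in> schwartz" and \<epsilon>: "0 < \<epsilon>"
    obtain N1 where N1: "\<And>N p. N \<ge> N1 \<Longrightarrow> (1 + norm p) ^ k *
       (\<Sum>q\<leftarrow>splits vs. cmod (iter_deriv (fst q) bumpc p * iter_deriv (snd q) (partial_period N f) p)) \<le> C * ?Q f + \<epsilon>"
      using C(2)[OF f \<epsilon>] by blast
    show "\<exists>N1. \<forall>N\<ge>N1. schwartz_seminorm (k, vs) (\<lambda>p. bumpc p * partial_period N f p) \<le> C * ?Q f + \<epsilon>"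
    proof (intro exI[of _ N1] allI impI schwartz_seminorm_least)
      fix N p assume N: "N1 \<le> N"
      have "cmod (\<Sum>q\<leftarrow>qs. h q) \<le> (\<Sum>q\<leftarrow>qs. cmod (h q))" for qs :: "('x \<times> 'x) list" and h
        by (induction qs) (auto intro: order_trans[OF norm_triangle_ineq])
      then have "cmod (iter_deriv vs (\<lambda>p. bumpc p * partial_period N f p) p) \<le>
          (\<Sum>q\<leftarrow>splits vs. cmod (iter_deriv (fst q) bumpc p * iter_deriv (snd q) (partial_period N f) p))"
        unfolding iter_deriv_mult[OF smooth_bumpc schwartz_smooth[OF schwartz_partial_period[OF f]] vs] .
      then have "(1 + norm p) ^ k * cmod (iter_deriv vs (\<lambda>p. bumpc p * partial_period N f p) p) \<le>
          (1 + norm p) ^ k * (\<Sum>q\<leftarrow>splits vs. cmod (iter_deriv (fst q) bumpc p * iter_deriv (snd q) (partial_period N f) p))"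
        by (rule mult_left_mono) simp
      also note N1[OF N, of p]
      finally show "(1 + norm p) ^ k * cmod (iter_deriv vs (\<lambda>p. bumpc p * partial_period N f p) p) \<le> C * ?Q f + \<epsilon>" .
    qed
  qed
qed

lemma bump_period_seminorms:
  assumes "finite F" "F \<subseteq> UNIV \<times> lists Basis"
  shows "\<exists>C M k L. C \<ge> 0 \<and> (\<forall>f\<in>schwartz. \<forall>\<epsilon>>0. \<exists>N1. \<forall>N\<ge>N1.
     (\<Sum>r\<in>F. schwartz_seminorm r (\<lambda>p. bumpc p * partial_period N f p)) \<le> C * coeff_norm M k L f + \<epsilon>)"
  using assms
proof (induction F)
  case empty
  show ?case by (intro exI[of _ 0]) auto
next
  case (insert r F)
  obtain k vs where r: "r = (k, vs)" "vs \<in> lists Basis"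
    by (rule seminorm_indexE[OF insert.prems insertI1])
  have "F \<subseteq> UNIV \<times> lists Basis" using insert.prems by (rule order_trans[OF subset_insertI])
  from insert.IH[OF this]
  obtain C M k' L where C: "C \<ge> 0" and C': "\<forall>f\<in>schwartz. \<forall>\<epsilon>>0. \<exists>N1. \<forall>N\<ge>N1.
     (\<Sum>r\<in>F. schwartz_seminorm r (\<lambda>p. bumpc p * partial_period N f p)) \<le> C * coeff_norm M k' L f + \<epsilon>"
    by (elim exE conjE)
  let ?M = "length vs + 2 * CARD('n)" and ?L = "length vs"
  obtain D where D: "D \<ge> 0" "\<And>f \<epsilon>. f \<in> schwartz \<Longrightarrow> \<epsilon> > 0 \<Longrightarrow> \<exists>N1. \<forall>N\<ge>N1.
     schwartz_seminorm r (\<lambda>p. bumpc p * partial_period N f p) \<le> D * coeff_norm ?M k ?L f + \<epsilon>"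
    using bump_period_seminorm[OF r(2), of k] unfolding r(1) by auto
  let ?Q = "coeff_norm (max M ?M) (max k' k) (max L ?L)"
  show ?case
  proof (rule exI[of _ "C * (real L + 1) + D * (real ?L + 1)"], rule exI[of _ "max M ?M"],
      rule exI[of _ "max k' k"], rule exI[of _ "max L ?L"], intro conjI ballI allI impI)
    show "0 \<le> C * (real L + 1) + D * (real ?L + 1)" using C D(1) by simp
    fix f :: "real \<times> (real ^ 'n) \<Rightarrow> complex" and \<epsilon> :: real
    assume f: "f \<in> schwartz" and \<epsilon>: "0 < \<epsilon>"
    have e2: "\<epsilon> / 2 > 0" using \<epsilon> by simp
    obtain N1 where N1: "\<And>N. N \<ge> N1 \<Longrightarrow>
       (\<Sum>r\<in>F. schwartz_seminorm r (\<lambda>p. bumpc p * partial_period N f p)) \<le> C * coeff_norm M k' L f + \<epsilon> / 2"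
      using C'[rule_format, OF f e2] by blast
    obtain N2 where N2: "\<And>N. N \<ge> N2 \<Longrightarrow>
       schwartz_seminorm r (\<lambda>p. bumpc p * partial_period N f p) \<le> D * coeff_norm ?M k ?L f + \<epsilon> / 2"
      using D(2)[OF f e2] by blast
    have "C * coeff_norm M k' L f \<le> C * ((real L + 1) * ?Q f)"
      by (intro mult_left_mono coeff_norm_mono f C) auto
    moreover have "D * coeff_norm ?M k ?L f \<le> D * ((real ?L + 1) * ?Q f)"
      by (intro mult_left_mono coeff_norm_mono f D(1)) auto
    moreover have "(C * (real L + 1) + D * (real ?L + 1)) * ?Q f = C * ((real L + 1) * ?Q f) + D * ((real ?L + 1) * ?Q f)"
      by (simp only: distrib_right mult.assoc)
    ultimately have le: "C * coeff_norm M k' L f + D * coeff_norm ?M k ?L f \<le> (C * (real L + 1) + D * (real ?L + 1)) * ?Q f"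
      by linarith
    show "\<exists>N1. \<forall>N\<ge>N1. (\<Sum>r\<in>insert r F. schwartz_seminorm r (\<lambda>p. bumpc p * partial_period N f p))
        \<le> (C * (real L + 1) + D * (real ?L + 1)) * ?Q f + \<epsilon>"
    proof (intro exI[of _ "max N1 N2"] allI impI)
      fix N assume "max N1 N2 \<le> N"
      then have "N1 \<le> N" "N2 \<le> N" by auto
      from N1[OF this(1)] N2[OF this(2)] le
      show "(\<Sum>r\<in>insert r F. schwartz_seminorm r (\<lambda>p. bumpc p * partial_period N f p))
        \<le> (C * (real L + 1) + D * (real ?L + 1)) * ?Q f + \<epsilon>"
        unfolding sum.insert[OF insert.hyps] by linarith
    qed
  qed
qed

text \<open>\<open>T f\<close> is the limit of \<open>T\<close> on bump times truncated
  periodization, and these values obey the coefficient bound up to \<open>\<epsilon>\<close> for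
  large \<open>N\<close>. In the limit the seminorms involving individual points of space have
  disappeared.\<close>

lemma periodic_tempered_bound:
  assumes T: "T \<in> periodic_tempered A"
  obtains C M k L where "C \<ge> 0" "\<And>f. f \<in> schwartz \<Longrightarrow> cmod (T f) \<le> C * coeff_norm M k L f"
proof -
  have tT: "T \<in> tempered" using T by (simp add: periodic_tempered_def)
  obtain C0 F where F: "C0 \<ge> 0" "finite F" "F \<subseteq> UNIV \<times> lists Basis"
    "\<And>f. f \<in> schwartz \<Longrightarrow> cmod (T f) \<le> C0 * (\<Sum>r\<in>F. schwartz_seminorm r f)"
    using tempered_bounded[OF tT] by (rule seminorm_boundedE) (rule that)
  from bump_period_seminorms[OF F(2,3)]
  obtain C M k L where C: "C \<ge> 0" and C': "\<forall>f\<in>schwartz. \<forall>\<epsilon>>0. \<exists>N1. \<forall>N\<ge>N1.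
     (\<Sum>r\<in>F. schwartz_seminorm r (\<lambda>p. bumpc p * partial_period N f p)) \<le> C * coeff_norm M k L f + \<epsilon>"
    by (elim exE conjE)
  show thesis
  proof (rule that)
    show "0 \<le> C0 * C" using F(1) C by simp
    fix f :: "real \<times> (real ^ 'n) \<Rightarrow> complex" assume f: "f \<in> schwartz"
    have lim: "(\<lambda>N. cmod (T (\<lambda>p. bumpc p * partial_period N f p))) \<longlonglongrightarrow> cmod (T f)"
      using tendsto_norm[OF tempered_plateau_limit[OF tT f]] unfolding periodic_plateau[OF T f] .
    have "cmod (T f) \<le> C0 * (C * coeff_norm M k L f + \<epsilon>)" if \<epsilon>: "\<epsilon> > 0" for \<epsilon>
    proof (rule tendsto_upperbound[OF lim])
      obtain N1 where N1: "\<And>N. N \<ge> N1 \<Longrightarrow>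
         (\<Sum>r\<in>F. schwartz_seminorm r (\<lambda>p. bumpc p * partial_period N f p)) \<le> C * coeff_norm M k L f + \<epsilon>"
        using C'[rule_format, OF f \<epsilon>] by blast
      have "cmod (T (\<lambda>p. bumpc p * partial_period N f p)) \<le> C0 * (C * coeff_norm M k L f + \<epsilon>)" if "N \<ge> N1" for N
      proof -
        have "cmod (T (\<lambda>p. bumpc p * partial_period N f p)) \<le>
            C0 * (\<Sum>r\<in>F. schwartz_seminorm r (\<lambda>p. bumpc p * partial_period N f p))"
          by (intro F(4) schwartz_bump_mult schwartz_partial_period f)
        also have "\<dots> \<le> C0 * (C * coeff_norm M k L f + \<epsilon>)" by (intro mult_left_mono N1 that F(1))
        finally show ?thesis .
      qed
      then show "\<forall>\<^sub>F N in sequentially. cmod (T (\<lambda>p. bumpc p * partial_period N f p)) \<le> C0 * (C * coeff_norm M k L f + \<epsilon>)"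
        unfolding eventually_sequentially by blast
    qed simp
    note le = this
    show "cmod (T f) \<le> C0 * C * coeff_norm M k L f"
    proof (rule field_le_epsilon)
      fix e :: real assume e: "0 < e"
      \<comment> \<open>Dividing by \<open>C0 + 1\<close> keeps the error below \<open>e\<close>,
        also if \<open>C0 = 0\<close>.\<close>
      have "cmod (T f) \<le> C0 * (C * coeff_norm M k L f + e / (C0 + 1))" using e F(1) by (intro le) simp
      also have "\<dots> = C0 * C * coeff_norm M k L f + C0 * (e / (C0 + 1))" by (simp add: distrib_left)
      also have "C0 * (e / (C0 + 1)) \<le> (C0 + 1) * (e / (C0 + 1))" using e F(1) by (intro mult_right_mono) auto
      also have "(C0 + 1) * (e / (C0 + 1)) = e" using F(1) by simp
      finally show "cmod (T f) \<le> C0 * C * coeff_norm M k L f + e" by simp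
    qed
  qed
qed

end

section \<open>The transposed operator\<close>

text \<open>Shows that the choice inside \<open>dist_monom\<close> succeeds; the finiteness of the
  variable type enters here.\<close>

lemma ex_list_count:
  fixes f :: "'a::finite \<Rightarrow> nat"
  shows "\<exists>vs. \<forall>v. count_list vs v = f v"
proof -
  have "\<exists>vs. \<forall>v. count_list vs v = (if v \<in> I then f v else 0)" if "finite I" for I
    using that
  proof (induction I)
    case empty
    show ?case by (intro exI[of _ "[]"]) simp
  next
    case (insert i I)
    then obtain vs where vs: "\<forall>v. count_list vs v = (if v \<in> I then f v else 0)" by blast
    have r: "count_list (replicate n i) v = (if v = i then n else 0)" for n v
      by (induction n) auto
    show ?case
      using vs insert.hyps by (intro exI[of _ "replicate (f i) i @ vs"]) (auto simp: r)
  qed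
  from this[of UNIV] show ?thesis by simp
qed

lemma prod_list_count:
  fixes h :: "'a::finite \<Rightarrow> complex"
  shows "(\<Prod>v\<leftarrow>vs. h v) = (\<Prod>v\<in>UNIV. h v ^ count_list vs v)"
proof (induction vs)
  case (Cons x vs)
  have "(\<Prod>v\<in>UNIV. h v ^ count_list (x # vs) v) = (\<Prod>v\<in>UNIV. h v ^ count_list vs v * (if v = x then h v else 1))"
    by (rule prod.cong) auto
  then show ?case by (simp add: Cons.IH prod.distrib prod.delta mult.commute)
qed simp

text \<open>The same choice term as in \<open>dist_monom\<close>, so both sides of the transposition
  refer to one and the same list.\<close>

definition monom_list :: "('n::finite option \<Rightarrow>\<^sub>0 nat) \<Rightarrow> 'n option list" where
  "monom_list \<alpha> = (SOME vs. \<forall>v. count_list vs v = Poly_Mapping.lookup \<alpha> v)"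

lemma count_monom_list: "count_list (monom_list \<alpha>) v = Poly_Mapping.lookup \<alpha> v"
  using someI_ex[OF ex_list_count[of "Poly_Mapping.lookup \<alpha>"]] unfolding monom_list_def by blast

text \<open>The list is reversed because transposing a composition reverses its order.\<close>

definition monom_deriv :: "('n::finite option \<Rightarrow>\<^sub>0 nat) \<Rightarrow> (real \<times> (real ^ 'n) \<Rightarrow> complex) \<Rightarrow> real \<times> (real ^ 'n) \<Rightarrow> complex" where
  "monom_deriv \<alpha> f = iter_deriv (map unit_vec (rev (monom_list \<alpha>))) f"

definition monom_sign :: "('n::finite option \<Rightarrow>\<^sub>0 nat) \<Rightarrow> complex" where
  "monom_sign \<alpha> = (-1) ^ length (monom_list \<alpha>)"

definition transposed_pdo :: "'n::finite pdo \<Rightarrow> (real \<times> (real ^ 'n) \<Rightarrow> complex) \<Rightarrow> real \<times> (real ^ 'n) \<Rightarrow> complex" where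
  "transposed_pdo P f = (\<lambda>x. \<Sum>\<alpha>\<in>Poly_Mapping.keys P. (Poly_Mapping.lookup P \<alpha> * monom_sign \<alpha>) * monom_deriv \<alpha> f x)"

lemma schwartz_monom_deriv: "f \<in> schwartz \<Longrightarrow> monom_deriv \<alpha> f \<in> schwartz"
  unfolding monom_deriv_def by (rule schwartz_iter_deriv[OF _ map_unit_vec_lists])

lemma schwartz_transposed_pdo: "f \<in> schwartz \<Longrightarrow> transposed_pdo P f \<in> schwartz"
  unfolding transposed_pdo_def by (intro schwartz_sum schwartz_cmult schwartz_monom_deriv)

lemma transposed_pdo_add:
  assumes "f \<in> schwartz" "g \<in> schwartz"
  shows "transposed_pdo P (\<lambda>x. f x + g x) = (\<lambda>x. transposed_pdo P f x + transposed_pdo P g x)"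
  unfolding transposed_pdo_def monom_deriv_def
    iter_deriv_add[OF assms[THEN schwartz_smooth] map_unit_vec_lists]
  by (simp add: distrib_left sum.distrib)

lemma transposed_pdo_cmult:
  assumes "f \<in> schwartz"
  shows "transposed_pdo P (\<lambda>x. c * f x) = (\<lambda>x. c * transposed_pdo P f x)"
  unfolding transposed_pdo_def monom_deriv_def
    iter_deriv_cmult[OF schwartz_smooth[OF assms] map_unit_vec_lists]
  by (simp add: sum_distrib_left mult.left_commute)

lemma transposed_pdo_translate:
  assumes "f \<in> schwartz"
  shows "transposed_pdo P (\<lambda>x. f (x + h)) = (\<lambda>x. transposed_pdo P f (x + h))"
  unfolding transposed_pdo_def monom_deriv_def
    iter_deriv_translate[OF schwartz_smooth[OF assms] map_unit_vec_lists] ..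

lemma foldr_dist_deriv:
  assumes "f \<in> schwartz"
  shows "foldr (\<lambda>v. dist_deriv (unit_vec v)) vs T f = (-1) ^ length vs * T (iter_deriv (map unit_vec (rev vs)) f)"
  using assms
proof (induction vs arbitrary: f)
  case (Cons v vs)
  have "dir_deriv (unit_vec v) f \<in> schwartz"
    by (rule schwartz_dir_deriv[OF Cons.prems unit_vec_Basis])
  then show ?case
    using Cons.prems Cons.IH[of "dir_deriv (unit_vec v) f"]
    by (simp add: dist_deriv_def iter_deriv_append iter_deriv_Cons)
qed simp

lemma pdo_apply_eq:
  assumes T: "T \<in> tempered" and f: "f \<in> schwartz"
  shows "pdo_apply P T f = T (transposed_pdo P f)"
proof -
  have "pdo_apply P T f = (\<Sum>\<alpha>\<in>Poly_Mapping.keys P. (Poly_Mapping.lookup P \<alpha> * monom_sign \<alpha>) * T (monom_deriv \<alpha> f))"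
    unfolding pdo_apply_def dist_monom_def monom_list_def[symmetric] foldr_dist_deriv[OF f]
    using f by (simp add: foldr_dist_deriv[OF f] monom_sign_def monom_deriv_def mult.assoc)
  also have "\<dots> = (\<Sum>\<alpha>\<in>Poly_Mapping.keys P. T (\<lambda>x. (Poly_Mapping.lookup P \<alpha> * monom_sign \<alpha>) * monom_deriv \<alpha> f x))"
    by (simp only: tempered_cmult[OF T schwartz_monom_deriv[OF f]])
  also have "\<dots> = T (transposed_pdo P f)"
    unfolding transposed_pdo_def
    by (rule tempered_sum[OF T finite_keys schwartz_cmult[OF schwartz_monom_deriv[OF f]], symmetric])
  finally show ?thesis .
qed

lemma seminorm_bounded_transposed_pdo:
  assumes T: "T \<in> tempered"
  shows "seminorm_bounded (\<lambda>f. cmod (T (transposed_pdo P f)))"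
proof -
  have "seminorm_bounded (\<lambda>f. \<Sum>\<alpha>\<in>Poly_Mapping.keys P.
      cmod (Poly_Mapping.lookup P \<alpha> * monom_sign \<alpha>) * cmod (T (monom_deriv \<alpha> f)))"
  proof (rule seminorm_bounded_sum)
    fix \<alpha>
    have "seminorm_bounded (\<lambda>f. cmod (T (monom_deriv \<alpha> f)))"
      unfolding monom_deriv_def by (rule seminorm_bounded_iter_deriv[OF tempered_bounded[OF T] map_unit_vec_lists])
    then show "seminorm_bounded (\<lambda>f. cmod (Poly_Mapping.lookup P \<alpha> * monom_sign \<alpha>) * cmod (T (monom_deriv \<alpha> f)))"
      by (rule seminorm_bounded_mono[OF _ order_refl]) simp
  qed
  then show ?thesis
  proof (rule seminorm_bounded_mono[where c = 1])
    fix f :: "real \<times> (real ^ 'a) \<Rightarrow> complex" assume f: "f \<in> schwartz"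
    have "T (transposed_pdo P f) = (\<Sum>\<alpha>\<in>Poly_Mapping.keys P. (Poly_Mapping.lookup P \<alpha> * monom_sign \<alpha>) * T (monom_deriv \<alpha> f))"
      unfolding transposed_pdo_def tempered_sum[OF T finite_keys schwartz_cmult[OF schwartz_monom_deriv[OF f]]]
        tempered_cmult[OF T schwartz_monom_deriv[OF f]] ..
    then show "cmod (T (transposed_pdo P f)) \<le> 1 * (\<Sum>\<alpha>\<in>Poly_Mapping.keys P.
      cmod (Poly_Mapping.lookup P \<alpha> * monom_sign \<alpha>) * cmod (T (monom_deriv \<alpha> f)))"
      by (simp add: sum_norm_le norm_mult)
  qed simp
qed

lemma pdo_apply_periodic:
  fixes P :: "'n::finite pdo"
  assumes T: "T \<in> periodic_tempered A"
  shows "pdo_apply P T \<in> periodic_tempered A"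
proof -
  have tT: "T \<in> tempered" using T by (simp add: periodic_tempered_def)
  note eq = pdo_apply_eq[OF tT]
  have "pdo_apply P T \<in> tempered"
    unfolding tempered_iff
  proof (intro conjI ballI allI)
    show "pdo_apply P T \<in> extensional schwartz" unfolding pdo_apply_def by (rule restrict_extensional)
    show "pdo_apply P T (\<lambda>x. f x + g x) = pdo_apply P T f + pdo_apply P T g"
      if "f \<in> schwartz" "g \<in> schwartz" for f g
      using that by (simp add: eq schwartz_add transposed_pdo_add tempered_add[OF tT] schwartz_transposed_pdo)
    show "pdo_apply P T (\<lambda>x. c * f x) = c * pdo_apply P T f" if "f \<in> schwartz" for c f
      using that by (simp add: eq schwartz_cmult transposed_pdo_cmult tempered_cmult[OF tT] schwartz_transposed_pdo)
    show "seminorm_bounded (\<lambda>f. cmod (pdo_apply P T f))"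
      by (rule seminorm_bounded_mono[OF seminorm_bounded_transposed_pdo[OF tT, of P], of _ 1]) (simp_all add: eq)
  qed
  moreover have "dist_translate (0, a) (pdo_apply P T) = pdo_apply P T"
    if a: "a \<in> range (\<lambda>k. A *v int_vec k)" for a
  proof (rule ext)
    fix f :: "real \<times> (real ^ 'n) \<Rightarrow> complex"
    show "dist_translate (0, a) (pdo_apply P T) f = pdo_apply P T f"
    proof (cases "f \<in> schwartz")
      case True
      have tr: "dist_translate (0, a) T = T" using T a unfolding periodic_tempered_def by blast
      have "dist_translate (0, a) (pdo_apply P T) f = T (transposed_pdo P (\<lambda>y. f (y - (0, a))))"
        using True by (simp add: dist_translate_def eq schwartz_translate_diff)
      also have "transposed_pdo P (\<lambda>y. f (y - (0, a))) = (\<lambda>y. transposed_pdo P f (y - (0, a)))"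
        unfolding diff_conv_add_uminus by (rule transposed_pdo_translate[OF True])
      also have "T (\<lambda>y. transposed_pdo P f (y - (0, a))) = dist_translate (0, a) T (transposed_pdo P f)"
        using schwartz_transposed_pdo[OF True] by (simp add: dist_translate_def)
      also have "\<dots> = pdo_apply P T f" unfolding tr eq[OF True] ..
      finally show ?thesis .
    next
      case False
      then show ?thesis by (simp add: dist_translate_def pdo_apply_def)
    qed
  qed
  ultimately show ?thesis by (simp add: periodic_tempered_def)
qed

section \<open>A priori estimates for the transposed operator\<close>

text \<open>Each level is minus the derivative of the preceding one. An identity proved for the
  coefficients themselves therefore passes to all their time derivatives.\<close>

lemma deriv_chain_unique:
  assumes g: "deriv_chain g" and h: "deriv_chain h" and "g 0 = h 0"
  shows "g i = h i"
proof (induction i)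
  case 0
  then show ?case by (rule assms(3))
next
  case (Suc i)
  have "- g (Suc i) t = - h (Suc i) t" for t
    using g h Suc unfolding deriv_chain_def by (metis vector_derivative_unique_at)
  then show ?case by auto
qed

lemma poly_op_smult: "poly_op (smult c q) g i t = c * poly_op q g i t"
  using poly_op_eq[OF degree_smult_le[of c q], of g i t]
  by (simp add: poly_op_def sum_distrib_left mult.assoc)

lemma poly_op_sum_monom:
  assumes "finite I"
  shows "poly_op (\<Sum>\<alpha>\<in>I. monom (a \<alpha>) (n \<alpha>)) g i t = (\<Sum>\<alpha>\<in>I. a \<alpha> * g (i + n \<alpha>) t)"
proof -
  let ?N = "\<Sum>\<alpha>\<in>I. n \<alpha>"
  have n: "n \<alpha> \<le> ?N" if "\<alpha> \<in> I" for \<alpha> by (rule member_le_sum[OF that _ assms]) simp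
  have "degree (\<Sum>\<alpha>\<in>I. monom (a \<alpha>) (n \<alpha>)) \<le> ?N"
    using assms n by (intro degree_sum_le) (auto intro: order_trans[OF degree_monom_le])
  from poly_op_eq[OF this]
  have "poly_op (\<Sum>\<alpha>\<in>I. monom (a \<alpha>) (n \<alpha>)) g i t =
      (\<Sum>j\<le>?N. \<Sum>\<alpha>\<in>I. (if n \<alpha> = j then a \<alpha> * g (i + j) t else 0))"
    unfolding coeff_sum sum_distrib_right by (simp only:) (intro sum.cong refl, simp)
  also have "\<dots> = (\<Sum>\<alpha>\<in>I. \<Sum>j\<le>?N. (if n \<alpha> = j then a \<alpha> * g (i + j) t else 0))"
    by (rule sum.swap)
  also have "\<dots> = (\<Sum>\<alpha>\<in>I. a \<alpha> * g (i + n \<alpha>) t)"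
    using n by (intro sum.cong) (auto simp: sum.delta')
  finally show ?thesis .
qed

lemma degree_prod_linear: "degree (\<Prod>j\<in>{1..m}. [:- l j, 1:] :: complex poly) = m"
  by (subst degree_prod_eq_sum_degree) auto

section \<open>The symbol as a polynomial in the time variable, and the final estimate\<close>

context lattice begin

text \<open>\<open>P(\<tau>, iB\<xi>)\<close> as an element of a polynomial ring in
  \<open>\<tau>\<close>, so that the factorization at all complex \<open>\<tau>\<close> becomes an
  identity of polynomials and degrees can be compared.\<close>

definition time_symbol :: "'n pdo \<Rightarrow> int ^ 'n \<Rightarrow> complex poly" where
  "time_symbol P \<xi> = (\<Sum>\<alpha>\<in>Poly_Mapping.keys P. monom (Poly_Mapping.lookup P \<alpha> *
     (\<Prod>i\<in>UNIV. (\<i> * complex_of_real ((B *v int_vec \<xi>) $ i)) ^ Poly_Mapping.lookup \<alpha> (Some i)))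
     (Poly_Mapping.lookup \<alpha> None))"

lemma poly_time_symbol:
  "poly (time_symbol P \<xi>) \<tau> = symbol_eval P \<tau> (\<chi> i. \<i> * complex_of_real ((B *v int_vec \<xi>) $ i))"
  by (simp add: time_symbol_def symbol_eval_def poly_sum poly_monom mult_ac)

lemma degree_time_symbol:
  "degree (time_symbol P \<xi>) \<le> (\<Sum>\<alpha>\<in>Poly_Mapping.keys P. Poly_Mapping.lookup \<alpha> None)"
  unfolding time_symbol_def
proof (rule degree_sum_le[OF finite_keys])
  fix \<alpha> assume \<alpha>: "\<alpha> \<in> Poly_Mapping.keys P"
  show "degree (monom (Poly_Mapping.lookup P \<alpha> *
     (\<Prod>i\<in>UNIV. (\<i> * complex_of_real ((B *v int_vec \<xi>) $ i)) ^ Poly_Mapping.lookup \<alpha> (Some i)))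
     (Poly_Mapping.lookup \<alpha> None)) \<le> (\<Sum>\<alpha>\<in>Poly_Mapping.keys P. Poly_Mapping.lookup \<alpha> None)"
    by (rule order_trans[OF degree_monom_le member_le_sum[OF \<alpha>]]) simp_all
qed

text \<open>The sign makes this a chain for \<open>-d/dt\<close>, the time derivative that occurs in
  the transposed operator.\<close>

definition coeff_chain :: "(real \<times> (real ^ 'n) \<Rightarrow> complex) \<Rightarrow> int ^ 'n \<Rightarrow> nat \<Rightarrow> real \<Rightarrow> complex" where
  "coeff_chain f \<xi> i t = (-1) ^ i * FC (time_deriv i f) \<xi> t"

lemma deriv_chain_coeff_chain:
  assumes f: "f \<in> schwartz" shows "deriv_chain (coeff_chain f \<xi>)"
proof -
  have "rapid (coeff_chain f \<xi> i)" for i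
    unfolding rapid_def
  proof
    fix m
    obtain p where p: "\<forall>g\<in>schwartz. \<forall>\<xi> t. (1 + \<bar>t\<bar>) ^ m * cmod (FC g \<xi> t) \<le> p g" using FC_bound[of m] by blast
    then show "\<exists>C. \<forall>t. (1 + \<bar>t\<bar>) ^ m * cmod (coeff_chain f \<xi> i t) \<le> C"
      using schwartz_time_deriv[OF f, of i]
      by (intro exI[of _ "p (time_deriv i f)"]) (simp add: coeff_chain_def norm_mult norm_power)
  qed
  moreover have "(coeff_chain f \<xi> i has_vector_derivative - coeff_chain f \<xi> (Suc i) t) (at t)" for i t
    using has_vector_derivative_mult_right[OF FC_time_deriv[OF f, of i \<xi> t], of "(-1) ^ i"]
    by (simp add: coeff_chain_def[abs_def])
  ultimately show ?thesis by (simp add: deriv_chain_def)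
qed

text \<open>The sign of the transposition is distributed over the single derivatives: each space
  factor \<open>-(iB\<xi>)\<close> turns into \<open>iB\<xi>\<close>, and the sign left over from
  the time derivatives is the one built into \<open>coeff_chain\<close>.\<close>

lemma FC_monom_deriv:
  assumes f: "f \<in> schwartz"
  shows "monom_sign \<alpha> * FC (monom_deriv \<alpha> f) \<xi> t =
    (\<Prod>i\<in>UNIV. (\<i> * complex_of_real ((B *v int_vec \<xi>) $ i)) ^ Poly_Mapping.lookup \<alpha> (Some i)) *
    coeff_chain f \<xi> (Poly_Mapping.lookup \<alpha> None) t"
proof -
  let ?us = "monom_list \<alpha>" and ?l = "Poly_Mapping.lookup \<alpha> None"
  have c: "count_list (rev ?us) v = Poly_Mapping.lookup \<alpha> v" for v
    by (simp add: count_monom_list)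
  have FC: "FC (monom_deriv \<alpha> f) \<xi> t = (\<Prod>v\<in>UNIV. dual_factor \<xi> v ^ Poly_Mapping.lookup \<alpha> v) * FC (time_deriv ?l f) \<xi> t"
    unfolding monom_deriv_def FC_iter_deriv[OF f] prod_list_count c ..
  have sgn: "monom_sign \<alpha> = (\<Prod>v\<in>UNIV. (-1) ^ Poly_Mapping.lookup \<alpha> v)"
    using prod_list_count[of "\<lambda>_. -1" ?us] by (simp add: monom_sign_def count_monom_list map_replicate_const)
  have "monom_sign \<alpha> * (\<Prod>v\<in>UNIV. dual_factor \<xi> v ^ Poly_Mapping.lookup \<alpha> v) =
      (\<Prod>v\<in>UNIV. (- dual_factor \<xi> v) ^ Poly_Mapping.lookup \<alpha> v)"
    unfolding sgn prod.distrib[symmetric] power_mult_distrib[symmetric] by simp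
  also have "\<dots> = (-1) ^ ?l * (\<Prod>i\<in>UNIV. (\<i> * complex_of_real ((B *v int_vec \<xi>) $ i)) ^ Poly_Mapping.lookup \<alpha> (Some i))"
    by (simp add: UNIV_option_conv prod.reindex)
  finally show ?thesis
    unfolding FC coeff_chain_def by (simp add: mult.assoc[symmetric] mult.commute)
qed

lemma FC_transposed_pdo:
  assumes f: "f \<in> schwartz"
  shows "FC (transposed_pdo P f) \<xi> t = poly_op (time_symbol P \<xi>) (coeff_chain f \<xi>) 0 t"
proof -
  have "FC (transposed_pdo P f) \<xi> t = (\<Sum>\<alpha>\<in>Poly_Mapping.keys P. Poly_Mapping.lookup P \<alpha> * (monom_sign \<alpha> * FC (monom_deriv \<alpha> f) \<xi> t))"
    unfolding transposed_pdo_def FC_sum[OF schwartz_cmult[OF schwartz_monom_deriv[OF f]]] FC_cmult by (simp add: mult.assoc)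
  then show ?thesis
    unfolding FC_monom_deriv[OF f] time_symbol_def poly_op_sum_monom[OF finite_keys] by (simp add: mult.assoc)
qed

lemma coeff_chain_transposed_pdo:
  assumes f: "f \<in> schwartz"
  shows "coeff_chain (transposed_pdo P f) \<xi> i = poly_op (time_symbol P \<xi>) (coeff_chain f \<xi>) i"
proof (rule deriv_chain_unique)
  show "deriv_chain (coeff_chain (transposed_pdo P f) \<xi>)"
    by (rule deriv_chain_coeff_chain[OF schwartz_transposed_pdo[OF f]])
  show "deriv_chain (poly_op (time_symbol P \<xi>) (coeff_chain f \<xi>))"
    by (rule deriv_chain_poly_op[OF deriv_chain_coeff_chain[OF f]])
  show "coeff_chain (transposed_pdo P f) \<xi> 0 = poly_op (time_symbol P \<xi>) (coeff_chain f \<xi>) 0"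
    by (rule ext) (simp add: coeff_chain_def time_deriv_def FC_transposed_pdo[OF f])
qed

text \<open>\<open>decay_product\<close> is applied at each frequency and at each level of the chain
  separately. Hence no time derivative is lost and \<open>L\<close> stays the same; the losses are
  powers of \<open>1 + norm1 \<xi>\<close> and of \<open>1 + \<bar>t\<bar>\<close>.\<close>

lemma coeff_norm_estimate:
  fixes P :: "'n pdo" and m :: "int ^ 'n \<Rightarrow> nat" and lam :: "nat \<Rightarrow> int ^ 'n \<Rightarrow> complex"
    and c :: "int ^ 'n \<Rightarrow> complex" and d :: "int ^ 'n \<Rightarrow> real"
  assumes factorization: "\<And>\<xi> \<tau>. symbol_eval P \<tau> (\<chi> i. \<i> * complex_of_real ((B *v int_vec \<xi>) $ i))
                          = c \<xi> * (\<Prod>j\<in>{1..m \<xi>}. (\<tau> - lam j \<xi>))"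
    and c_nonzero: "\<And>\<xi>. c \<xi> \<noteq> 0"
    and d_pos: "\<And>\<xi>. d \<xi> > 0"
    and d: "\<And>\<xi> j. j \<in> {1..m \<xi>} \<Longrightarrow> Re (lam j \<xi>) = 0 \<or> \<bar>Re (lam j \<xi>)\<bar> \<ge> d \<xi>"
    and c_growth: "(\<lambda>\<xi>. inverse (c \<xi>)) \<in> poly_growth"
    and d_growth: "(\<lambda>\<xi>. complex_of_real (inverse (d \<xi>))) \<in> poly_growth"
  shows "\<exists>C M' k'. C \<ge> 0 \<and> (\<forall>f\<in>schwartz. coeff_norm M k L f \<le> C * coeff_norm M' k' L (transposed_pdo P f))"
proof -
  obtain kc where kc: "\<And>\<xi>. cmod (inverse (c \<xi>)) \<le> real kc * (1 + norm1 \<xi>) ^ kc"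
    using c_growth unfolding poly_growth_def by blast
  obtain kd where kd': "\<And>\<xi>. cmod (complex_of_real (inverse (d \<xi>))) \<le> real kd * (1 + norm1 \<xi>) ^ kd"
    using d_growth unfolding poly_growth_def by blast
  have kd: "inverse (d \<xi>) \<le> real kd * (1 + norm1 \<xi>) ^ kd" for \<xi>
    using kd'[of \<xi>] unfolding norm_of_real by (rule order_trans[OF abs_ge_self])
  let ?deg = "\<Sum>\<alpha>\<in>Poly_Mapping.keys P. Poly_Mapping.lookup \<alpha> None"
  have symb: "time_symbol P \<xi> = smult (c \<xi>) (\<Prod>j\<in>{1..m \<xi>}. [:- lam j \<xi>, 1:])" for \<xi>
  proof -
    have "poly (time_symbol P \<xi>) = poly (smult (c \<xi>) (\<Prod>j\<in>{1..m \<xi>}. [:- lam j \<xi>, 1:]))"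
      by (rule ext) (simp add: poly_time_symbol factorization poly_prod)
    then show ?thesis by (simp only: poly_eq_poly_eq_iff)
  qed
  \<comment> \<open>The leading coefficient does not vanish, so the number of roots is the degree in
    \<open>\<tau>\<close>, which is bounded independently of \<open>\<xi>\<close>.\<close>
  have deg: "m \<xi> \<le> ?deg" for \<xi>
    using degree_time_symbol[of P \<xi>] unfolding symb degree_smult_eq degree_prod_linear using c_nonzero[of \<xi>] by simp
  have "\<forall>m. \<exists>K e. K \<ge> 0 \<and> (\<forall>(D::real) l g i B. D \<ge> 1 \<longrightarrow>
     (\<forall>j\<in>{1..m}. Re (l j) = 0 \<or> \<bar>Re (l j)\<bar> \<ge> 1 / D) \<longrightarrow> deriv_chain g \<longrightarrow>
     (\<forall>t. (1 + \<bar>t\<bar>) ^ (k + 2 * m) * cmod (poly_op (\<Prod>j\<in>{1..m}. [:- l j, 1:]) g i t) \<le> B) \<longrightarrow>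
     (\<forall>t. (1 + \<bar>t\<bar>) ^ k * cmod (g i t) \<le> K * D ^ e * B))"
    using decay_product by metis
  then obtain K e where K: "\<And>m. K m \<ge> 0" and Ke: "\<And>m (D::real) l g i B t. D \<ge> 1 \<Longrightarrow>
     (\<forall>j\<in>{1..m}. Re (l j) = 0 \<or> \<bar>Re (l j)\<bar> \<ge> 1 / D) \<Longrightarrow> deriv_chain g \<Longrightarrow>
     (\<forall>t. (1 + \<bar>t\<bar>) ^ (k + 2 * m) * cmod (poly_op (\<Prod>j\<in>{1..m}. [:- l j, 1:]) g i t) \<le> B) \<Longrightarrow>
     (1 + \<bar>t\<bar>) ^ k * cmod (g i t) \<le> K m * D ^ e m * B"
    by metis
  \<comment> \<open>Since \<open>m \<xi>\<close> takes finitely many values, summing over all of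
    them gives a constant and an exponent valid at every frequency.\<close>
  define Km where "Km = (\<Sum>m\<le>?deg. K m)"
  define em where "em = (\<Sum>m\<le>?deg. e m)"
  have KKm: "K (m \<xi>) \<le> Km" and eem: "e (m \<xi>) \<le> em" for \<xi>
    unfolding Km_def em_def using deg K by (auto intro!: member_le_sum)
  have Km0: "Km \<ge> 0" unfolding Km_def using K by (intro sum_nonneg) auto
  \<comment> \<open>Frequency powers: \<open>kd * em\<close> to absorb \<open>D ^ em\<close>, and
    \<open>kc\<close> for the inverse leading coefficient. Time powers: two for each possible
    factor.\<close>
  let ?M' = "M + kd * em + kc" and ?k' = "k + 2 * ?deg"
  let ?C = "Km * (1 + real kd) ^ em * real kc"
  have C0: "?C \<ge> 0" using Km0 by simp
  have "coeff_norm M k L f \<le> (real L + 1) * (?C * coeff_norm ?M' ?k' L (transposed_pdo P f))" if f: "f \<in> schwartz" for f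
  proof (rule coeff_norm_least)
    fix l and \<xi> :: "int ^ 'n" and t :: real assume l: "l \<le> L"
    let ?Y = "coeff_norm ?M' ?k' L (transposed_pdo P f)"
    let ?n = "1 + norm1 \<xi>"
    have n1: "?n \<ge> 1" using norm1_nonneg[of \<xi>] by simp
    have Y0: "?Y \<ge> 0" by (rule coeff_norm_nonneg[OF schwartz_transposed_pdo[OF f]])
    \<comment> \<open>\<open>1 + kd\<close> in place of \<open>kd\<close> guarantees
      \<open>D \<ge> 1\<close>, also when \<open>kd = 0\<close>.\<close>
    define D where "D = (1 + real kd) * ?n ^ kd"
    have D1: "D \<ge> 1" unfolding D_def using mult_mono[of 1 "1 + real kd" 1 "?n ^ kd"] n1 by simp
    have "inverse (d \<xi>) \<le> D"
    proof -
      have "real kd * ?n ^ kd \<le> D" unfolding D_def using n1 by (intro mult_right_mono) auto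
      with kd[of \<xi>] show ?thesis by linarith
    qed
    then have dD: "1 / D \<le> d \<xi>" using d_pos[of \<xi>] D1 by (simp add: field_simps)
    \<comment> \<open>Dividing by the full weight \<open>?n ^ ?M'\<close> keeps the gain in
      frequency that is spent below on \<open>D ^ em\<close> and on the inverse of
      \<open>c \<xi>\<close>.\<close>
    let ?B = "cmod (inverse (c \<xi>)) * (?Y / ?n ^ ?M')"
    have "(1 + \<bar>t\<bar>) ^ k * cmod (coeff_chain f \<xi> l t) \<le> K (m \<xi>) * D ^ e (m \<xi>) * ?B"
    proof (rule Ke[OF D1, where l = "\<lambda>j. lam j \<xi>"])
      show "\<forall>j\<in>{1..m \<xi>}. Re (lam j \<xi>) = 0 \<or> 1 / D \<le> \<bar>Re (lam j \<xi>)\<bar>"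
        using d[of _ \<xi>] dD by (meson order_trans)
      show "deriv_chain (coeff_chain f \<xi>)" by (rule deriv_chain_coeff_chain[OF f])
      show "\<forall>t. (1 + \<bar>t\<bar>) ^ (k + 2 * m \<xi>) * cmod (poly_op (\<Prod>j\<in>{1..m \<xi>}. [:- lam j \<xi>, 1:]) (coeff_chain f \<xi>) l t) \<le> ?B"
      proof
        fix t :: real
        let ?p = "poly_op (\<Prod>j\<in>{1..m \<xi>}. [:- lam j \<xi>, 1:]) (coeff_chain f \<xi>) l t"
        have "coeff_chain (transposed_pdo P f) \<xi> l t = c \<xi> * ?p"
          unfolding coeff_chain_transposed_pdo[OF f] symb poly_op_smult ..
        then have "?p = inverse (c \<xi>) * coeff_chain (transposed_pdo P f) \<xi> l t"
          using c_nonzero[of \<xi>] by simp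
        then have "cmod ?p = cmod (inverse (c \<xi>)) * cmod (FC (time_deriv l (transposed_pdo P f)) \<xi> t)"
          by (simp only: coeff_chain_def norm_mult norm_power norm_minus_cancel norm_one power_one mult_1)
        moreover have "?n ^ ?M' * (1 + \<bar>t\<bar>) ^ (k + 2 * m \<xi>) * cmod (FC (time_deriv l (transposed_pdo P f)) \<xi> t) \<le> ?Y"
          using deg[of \<xi>] by (intro coeff_norm_upper schwartz_transposed_pdo f l) auto
        then have "(1 + \<bar>t\<bar>) ^ (k + 2 * m \<xi>) * cmod (FC (time_deriv l (transposed_pdo P f)) \<xi> t) \<le> ?Y / ?n ^ ?M'"
          using n1 by (subst pos_le_divide_eq) (auto simp: mult_ac)
        ultimately show "(1 + \<bar>t\<bar>) ^ (k + 2 * m \<xi>) * cmod ?p \<le> ?B"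
          using mult_left_mono[of "(1 + \<bar>t\<bar>) ^ (k + 2 * m \<xi>) * cmod (FC (time_deriv l (transposed_pdo P f)) \<xi> t)"
              "?Y / ?n ^ ?M'" "cmod (inverse (c \<xi>))"] by (simp only: norm_ge_zero mult.left_commute)
      qed
    qed
    also have "\<dots> \<le> Km * D ^ em * ((real kc * ?n ^ kc) * (?Y / ?n ^ ?M'))"
      using KKm[of \<xi>] eem[of \<xi>] D1 Km0 kc[of \<xi>] Y0 n1 K
      by (intro mult_mono power_increasing mult_nonneg_nonneg divide_nonneg_nonneg) auto
    also have "\<dots> = (?C * ?Y) / ?n ^ M"
    proof -
      have "Km * (\<kappa> * n ^ kd) ^ em * ((real kc * n ^ kc) * (Y / n ^ (M + kd * em + kc))) = (Km * \<kappa> ^ em * real kc * Y) / n ^ M"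
        if "n > 0" for \<kappa> n Y :: real
        using that by (simp add: power_mult_distrib power_add power_mult divide_simps)
      from this[of ?n "1 + real kd" ?Y] n1 show ?thesis unfolding D_def by simp
    qed
    finally have "(1 + \<bar>t\<bar>) ^ k * cmod (FC (time_deriv l f) \<xi> t) \<le> (?C * ?Y) / ?n ^ M"
      by (simp only: coeff_chain_def norm_mult norm_power norm_minus_cancel norm_one power_one mult_1)
    then show "?n ^ M * (1 + \<bar>t\<bar>) ^ k * cmod (FC (time_deriv l f) \<xi> t) \<le> ?C * ?Y"
      using n1 by (subst (asm) pos_le_divide_eq) (auto simp: mult_ac)
  qed
  with C0 show ?thesis
    by (intro exI[of _ "(real L + 1) * ?C"] exI[of _ ?M'] exI[of _ ?k'] conjI ballI) (simp_all add: mult.assoc)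
qed

lemma surjective_of_estimate:
  fixes P :: "'n pdo"
  assumes est: "\<And>M k L. \<exists>C M' k'. C \<ge> 0 \<and> (\<forall>f\<in>schwartz. coeff_norm M k L f \<le> C * coeff_norm M' k' L (transposed_pdo P f))"
    and T: "T \<in> periodic_tempered A"
  shows "\<exists>S\<in>periodic_tempered A. pdo_apply P S = T"
proof -
  have tT: "T \<in> tempered" using T by (simp add: periodic_tempered_def)
  obtain C M k L where C: "C \<ge> 0" "\<And>f. f \<in> schwartz \<Longrightarrow> cmod (T f) \<le> C * coeff_norm M k L f"
    using periodic_tempered_bound[OF T] by blast
  obtain D M' k' where D: "D \<ge> 0" "\<And>f. f \<in> schwartz \<Longrightarrow> coeff_norm M k L f \<le> D * coeff_norm M' k' L (transposed_pdo P f)"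
    using est[of M k L] by blast
  let ?p = "\<lambda>f. (C * D) * coeff_norm M' k' L f"
  have CD: "C * D \<ge> 0" using C(1) D(1) by simp
  obtain S0 where S0: "\<And>f. f \<in> schwartz \<Longrightarrow> S0 (transposed_pdo P f) = T f"
    "\<And>f g. f \<in> schwartz \<Longrightarrow> g \<in> schwartz \<Longrightarrow> S0 (\<lambda>x. f x + g x) = S0 f + S0 g"
    "\<And>c f. f \<in> schwartz \<Longrightarrow> S0 (\<lambda>x. c * f x) = c * S0 f"
    "\<And>f. f \<in> schwartz \<Longrightarrow> cmod (S0 f) \<le> ?p f"
  proof (rule hahn_banach_range[of schwartz ?p "transposed_pdo P" T])
    show "?p (\<lambda>x. f x + g x) \<le> ?p f + ?p g" if "f \<in> schwartz" "g \<in> schwartz" for f g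
      unfolding distrib_left[symmetric] by (intro mult_left_mono coeff_norm_add that CD)
    show "?p (\<lambda>x. c * f x) = cmod c * ?p f" if "f \<in> schwartz" for c f
      by (simp add: coeff_norm_cmult[OF that])
    show "cmod (T f) \<le> ?p (transposed_pdo P f)" if "f \<in> schwartz" for f
      using order_trans[OF C(2)[OF that] mult_left_mono[OF D(2)[OF that] C(1)]] by (simp add: mult.assoc)
  qed (auto intro: schwartz_0 schwartz_add schwartz_cmult schwartz_transposed_pdo transposed_pdo_add
      transposed_pdo_cmult tempered_add[OF tT] tempered_cmult[OF tT])
  let ?S = "restrict S0 schwartz"
  have S: "?S f = S0 f" if "f \<in> schwartz" for f using that by simp
  have tS: "?S \<in> tempered"
    unfolding tempered_iff
  proof (intro conjI ballI allI restrict_extensional)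
    show "seminorm_bounded (\<lambda>f. cmod (?S f))"
      by (rule seminorm_bounded_mono[OF coeff_norm_seminorm_bounded[of M' k' L] _ CD]) (simp add: S0(4))
  qed (simp_all add: S0 schwartz_add schwartz_cmult)
  have "dist_translate (0, a) ?S = ?S" if a: "a \<in> range (\<lambda>k. A *v int_vec k)" for a
  proof (rule ext)
    fix f :: "real \<times> (real ^ 'n) \<Rightarrow> complex"
    show "dist_translate (0, a) ?S f = ?S f"
    proof (cases "f \<in> schwartz")
      case True
      obtain b where b: "a = A *v int_vec b" using a by blast
      let ?g = "\<lambda>x. f (x + (0, A *v int_vec (- b)))"
      have g: "?g \<in> schwartz" by (rule schwartz_translate[OF True])
      have shift: "(\<lambda>y. f (y - (0, a))) = ?g"
        by (simp add: b int_vec_minus linear_neg[OF matrix_vector_mul_linear] diff_conv_add_uminus del: add_uminus_conv_diff)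
      have "S0 ?g - S0 f = S0 (\<lambda>x. ?g x + (-1) * f x)"
        by (simp only: S0(2)[OF g schwartz_cmult[OF True]] S0(3)[OF True]) simp
      also have "(\<lambda>x. ?g x + (-1) * f x) = (\<lambda>x. ?g x - f x)" by simp
      finally have "cmod (S0 ?g - S0 f) \<le> ?p (\<lambda>x. ?g x - f x)"
        using S0(4)[OF schwartz_diff[OF g True]] by simp
      then have "S0 ?g = S0 f" unfolding coeff_norm_lattice_translate[OF True] by simp
      then show ?thesis using True g by (simp add: dist_translate_def shift)
    next
      case False
      then show ?thesis by (simp add: dist_translate_def)
    qed
  qed
  with tS have pS: "?S \<in> periodic_tempered A" by (simp add: periodic_tempered_def)
  have "pdo_apply P ?S = T"
  proof (rule ext)
    fix f :: "real \<times> (real ^ 'n) \<Rightarrow> complex"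
    show "pdo_apply P ?S f = T f"
    proof (cases "f \<in> schwartz")
      case True
      then show ?thesis by (simp add: pdo_apply_eq[OF tS] S0(1) schwartz_transposed_pdo)
    next
      case False
      have "T \<in> extensional schwartz" using tT unfolding tempered_def by blast
      from extensional_arb[OF this False] show ?thesis using False by (simp add: pdo_apply_def)
    qed
  qed
  with pS show ?thesis by blast
qed

end

theorem corollary3p1:
  fixes P :: "'n::finite pdo"
    and A B :: "real ^ 'n ^ 'n"
    and m :: "int ^ 'n \<Rightarrow> nat"
    and c :: "int ^ 'n \<Rightarrow> complex"
    and lam :: "nat \<Rightarrow> int ^ 'n \<Rightarrow> complex"
    and d :: "int ^ 'n \<Rightarrow> real"
  assumes A: "invertible A"
    and B: "B = (2 * pi) *\<^sub>R transpose (matrix_inv A)"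
    and factorization: "\<And>\<xi> \<tau>. symbol_eval P \<tau> (\<chi> i. \<i> * complex_of_real ((B *v int_vec \<xi>) $ i))
                          = c \<xi> * (\<Prod>j\<in>{1..m \<xi>}. (\<tau> - lam j \<xi>))"
    and c_nonzero: "\<And>\<xi>. c \<xi> \<noteq> 0"
    and d: "\<And>\<xi>. d \<xi> = (if \<forall>j\<in>{1..m \<xi>}. Re (lam j \<xi>) = 0 then 1
                        else Min {\<bar>Re (lam j \<xi>)\<bar> | j. j \<in> {1..m \<xi>} \<and> Re (lam j \<xi>) \<noteq> 0})"
    and c_growth: "(\<lambda>\<xi>. inverse (c \<xi>)) \<in> poly_growth"
    and d_growth: "(\<lambda>\<xi>. complex_of_real (inverse (d \<xi>))) \<in> poly_growth"
  shows "pdo_apply P ` periodic_tempered A = periodic_tempered A"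
proof -
  interpret lattice A B by unfold_locales (rule A, rule B)
  let ?R = "\<lambda>\<xi>. {\<bar>Re (lam j \<xi>)\<bar> | j. j \<in> {1..m \<xi>} \<and> Re (lam j \<xi>) \<noteq> 0}"
  have fin: "finite (?R \<xi>)" for \<xi> by simp
  \<comment> \<open>The estimate sees \<open>d\<close> only through its positivity and the gap it
    leaves around the imaginary axis. Both hold because the minimum is attained over a finite
    nonempty set of positive numbers, or else the default value 1 applies.\<close>
  have d_pos: "d \<xi> > 0" for \<xi>
  proof (cases "\<forall>j\<in>{1..m \<xi>}. Re (lam j \<xi>) = 0")
    case True
    then show ?thesis by (simp add: d)
  next
    case False
    then have "?R \<xi> \<noteq> {}" by blast
    from Min_in[OF fin this] show ?thesis unfolding d if_not_P[OF False] by auto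
  qed
  have d_le: "Re (lam j \<xi>) = 0 \<or> \<bar>Re (lam j \<xi>)\<bar> \<ge> d \<xi>" if j: "j \<in> {1..m \<xi>}" for j \<xi>
  proof (cases "Re (lam j \<xi>) = 0")
    case False
    with j have "\<not> (\<forall>j\<in>{1..m \<xi>}. Re (lam j \<xi>) = 0)" by blast
    moreover have "\<bar>Re (lam j \<xi>)\<bar> \<in> ?R \<xi>" using j False by blast
    ultimately have "d \<xi> \<le> \<bar>Re (lam j \<xi>)\<bar>" using Min_le[OF fin] by (simp only: d if_False)
    then show ?thesis ..
  qed simp
  have est: "\<exists>C M' k'. C \<ge> 0 \<and> (\<forall>f\<in>schwartz. coeff_norm M k L f \<le> C * coeff_norm M' k' L (transposed_pdo P f))" for M k L
    by (rule coeff_norm_estimate[OF factorization c_nonzero d_pos d_le c_growth d_growth])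
  show ?thesis
  proof
    show "pdo_apply P ` periodic_tempered A \<subseteq> periodic_tempered A"
      using pdo_apply_periodic by blast
    show "periodic_tempered A \<subseteq> pdo_apply P ` periodic_tempered A"
      using surjective_of_estimate[OF est] by blast
  qed
qed

end
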